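(* Fix positive integers $a_1,a_2,a_3,a_4$. Let $S(n)$ be the maximum size of a Sidon subset $A\subseteq\{1,\dots,n\}$ such that there are no pairwise distinct $x_1,\dots,x_5\in A$ with $a_1x_1+a_2x_2+a_3x_3+a_4x_4=(a_1+a_2+a_3+a_4)x_5$. Then $S(n)=o(\sqrt n)$ and $S(n)\ge n^{1/2-o(1)}$; that is, $S(n)/\sqrt n\to 0$, and for every $\varepsilon>0$ we have $S(n)\ge n^{1/2-\varepsilon}$ for all sufficiently large $n$.
   Context: A set $A$ of integers is a Sidon set if it has no nontrivial solution to $x_1+x_2=x_3+x_4$ with $x_i\in A$, where a solution is trivial if $(x_1,x_2)=(x_3,x_4)$ or $(x_1,x_2)=(x_4,x_3)$. *)

theory Defs
  imports Complex_Main
begin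

definition sidon :: "int set \<Rightarrow> bool" where
  "sidon A \<longleftrightarrow> (\<forall>x1\<in>A. \<forall>x2\<in>A. \<forall>x3\<in>A. \<forall>x4\<in>A.
     x1 + x2 = x3 + x4 \<longrightarrow> ((x1, x2) = (x3, x4) \<or> (x1, x2) = (x4, x3)))"

definition avoids_eq :: "int \<Rightarrow> int \<Rightarrow> int \<Rightarrow> int \<Rightarrow> int set \<Rightarrow> bool" where
  "avoids_eq a1 a2 a3 a4 A \<longleftrightarrow> \<not> (\<exists>x1\<in>A. \<exists>x2\<in>A. \<exists>x3\<in>A. \<exists>x4\<in>A. \<exists>x5\<in>A.
     distinct [x1, x2, x3, x4, x5] \<and>
     a1 * x1 + a2 * x2 + a3 * x3 + a4 * x4 = (a1 + a2 + a3 + a4) * x5)"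

definition S_max :: "int \<Rightarrow> int \<Rightarrow> int \<Rightarrow> int \<Rightarrow> nat \<Rightarrow> nat" where
  "S_max a1 a2 a3 a4 n = Max {card A | A. A \<subseteq> {1..int n} \<and> sidon A \<and> avoids_eq a1 a2 a3 a4 A}"

end

theory Submission
  imports Defs "HOL-Library.FuncSet" "HOL-Computational_Algebra.Primes" "HOL-Real_Asymp.Real_Asymp"
begin

text \<open>
  Upper bound. Embed a Sidon set \<open>A\<close> of size at least \<open>\<delta> \<surd>n\<close> into \<open>\<int>/N\<close> with \<open>N\<close> a constant multiple
  of \<open>n\<close>, and write \<open>mu A\<close> for the Fourier transform of the uniform probability measure on \<open>A\<close>. The Sidon
  property bounds \<open>\<Sum>|mu A|\<^sup>4\<close>, which controls the five-variable count up to a uniform error in \<open>mu A\<close>, and it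
  bounds the \<open>L\<^sup>2\<close> norm of the convolution of \<open>A\<close> with any dense set \<open>B\<close>. So \<open>A\<close> may be replaced by its
  smoothing along a Bohr set. An energy increment over successively finer Bohr sets yields a smoothing that
  approximates \<open>A\<close> in the count and is almost invariant, in \<open>L\<^sup>2\<close>, under a coarser Bohr set; almost invariance
  produces a positive proportion of solutions near the diagonal. Hence \<open>A\<close> has at least \<open>c |A|\<^sup>5 / N\<close>
  solutions, whereas only \<open>O(|A|\<^sup>2)\<close> of them have a repeated entry.

  Lower bound. Intersect the Erdos--Turan Sidon set of about \<open>\<surd>n\<close> elements with a suitable translate of a
  Behrend set of size \<open>n\<^sup>1\<^sup>-\<^sup>o\<^sup>(\<^sup>1\<^sup>)\<close>; by strict convexity of the sphere, a Behrend set has only constant solutions.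
\<close>

section \<open>Fourier analysis on the integers modulo N\<close>

text \<open>A Sidon set modulo \<open>N\<close> has size at most of order sqrt N, so its density
  tends to 0 and positive-density arguments do not apply to it directly. What rescues the argument
  is that the smoothing has mean 1 and bounded second moment, as for a dense set. Five variables
  suit the available moment: the count is a sum of products of five dilates of
  \<open>mu N A\<close>, four of which are absorbed by the fourth moment while the fifth supplies
  the small factor. The constants depend on the coefficients and on \<open>K\<close>, a bound for 2
  N / |A|^2 + 1, but never on \<open>N\<close>. The energies met in the iteration lie in [0, K] and
  each step gains 1 / (9216 K). Here 9216 = 2 * 9 * 512: 512 makes room for four exceptional sets of
  shifts, 9 is lost in comparing two smoothings, and 2 splits the tolerance between energy gap and
  Fourier error. The contradiction is between |A|^5 / N, of order |A|^3, and |A|^2. In the lower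
  bound the Behrend dimension stays fixed for each \<epsilon>, since a small power of n may be lost;
  the same tolerance lets a weak Chebyshev estimate supply the primes.\<close>

definition ee :: "int \<Rightarrow> int \<Rightarrow> complex" where
  "ee N k = cis (2 * pi * of_int k / of_int N)"

lemma ee_add: "ee N (k + l) = ee N k * ee N l"
  by (simp add: ee_def cis_mult add_divide_distrib distrib_left)

lemma ee_0 [simp]: "ee N 0 = 1"
  by (simp add: ee_def)

lemma norm_ee [simp]: "cmod (ee N k) = 1"
  by (simp add: ee_def)

lemma cnj_ee: "cnj (ee N k) = ee N (- k)"
  by (simp add: ee_def cis_cnj)

lemma ee_dvd:
  assumes "N dvd k" shows "ee N k = 1"
proof (cases "N = 0")
  case False
  obtain l where "k = N * l" using assms by (elim dvdE)
  then have "2 * pi * of_int k / of_int N = 2 * pi * (of_int l :: real)"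
    using False by simp
  then show ?thesis by (simp add: ee_def)
qed (simp add: ee_def)

lemma ee_cong: "N dvd k - l \<Longrightarrow> ee N k = ee N l"
  using ee_dvd[of N "k - l"] ee_add[of N "k - l" l] by simp

lemma ee_eq_1_iff:
  assumes "N > 0" shows "ee N k = 1 \<longleftrightarrow> N dvd k"
proof
  assume "ee N k = 1"
  then have "cos (2 * pi * of_int k / of_int N) = 1"
    by (metis ee_def cis.sel(1) one_complex.sel(1))
  then obtain l :: int where "2 * pi * of_int k / of_int N = of_int l * 2 * pi"
    using cos_one_2pi_int by metis
  then have "real_of_int k = of_int (l * N)"
    using assms by (simp add: field_simps)
  then have "k = l * N" by linarith
  then show "N dvd k" by simp
qed (rule ee_dvd)

lemma ee_power: "ee N k ^ n = ee N (int n * k)"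
  by (simp add: ee_def DeMoivre algebra_simps)

text \<open>A chord is no longer than its arc: the chord equals 2 |sin ((a - b) / 2)|.\<close>

lemma norm_cis_diff_le: "cmod (cis a - cis b) \<le> \<bar>a - b\<bar>"
proof -
  have half: "2 * ((a - b) / 2) = a - b" by simp
  have "cmod (cis a - cis b) ^ 2 = (cos a - cos b)\<^sup>2 + (sin a - sin b)\<^sup>2"
    by (simp add: cmod_def)
  also have "\<dots> = ((cos a)\<^sup>2 + (sin a)\<^sup>2) + ((cos b)\<^sup>2 + (sin b)\<^sup>2) - 2 * cos (a - b)"
    by (simp add: cos_diff power2_eq_square algebra_simps)
  also have "\<dots> = 2 - 2 * cos (a - b)" by simp
  also have "\<dots> = (2 * \<bar>sin ((a - b) / 2)\<bar>)\<^sup>2"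
    using cos_double_sin[of "(a - b) / 2", unfolded half] by (simp add: power_mult_distrib)
  also have "\<dots> \<le> \<bar>a - b\<bar>\<^sup>2"
    using abs_sin_x_le_abs_x[of "(a - b) / 2"] by (intro power_mono) auto
  finally show ?thesis by (rule power2_le_imp_le) simp
qed

lemma sum_ee:
  assumes "N > 0"
  shows "(\<Sum>r\<in>{0..<N}. ee N (r * k)) = (if N dvd k then of_int N else 0)"
proof (cases "N dvd k")
  case True
  then show ?thesis using assms by (simp add: ee_dvd)
next
  case False
  have "(\<Sum>r\<in>{0..<N}. ee N (r * k)) = (\<Sum>j<nat N. ee N k ^ j)"
    by (rule sum.reindex_bij_witness[of _ int nat]) (auto simp: ee_power)
  also have "\<dots> = 0"
    using False assms ee_power[of N k "nat N"] by (subst geometric_sum) (auto simp: ee_eq_1_iff ee_dvd)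
  finally show ?thesis using False by simp
qed

text \<open>Orthogonality of characters as a counting device: summing over \<open>r\<close> keeps
  exactly the points of \<open>P\<close> where \<open>L\<close> vanishes modulo \<open>N\<close>.
  The additive counts and inversion formulas below arise by choosing \<open>P\<close>,
  \<open>L\<close> and the weights.\<close>

lemma sum_sum_ee:
  assumes "N > 0" and P: "finite P"
  shows "(\<Sum>r\<in>{0..<N}. \<Sum>p\<in>P. W p * ee N (r * L p)) = of_int N * (\<Sum>p\<in>{p\<in>P. N dvd L p}. W p)"
proof -
  have "(\<Sum>r\<in>{0..<N}. \<Sum>p\<in>P. W p * ee N (r * L p)) = (\<Sum>p\<in>P. W p * (\<Sum>r\<in>{0..<N}. ee N (r * L p)))"
    by (subst sum.swap) (simp add: sum_distrib_left)
  also have "\<dots> = (\<Sum>p\<in>P. if N dvd L p then of_int N * W p else 0)"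
    using assms by (intro sum.cong) (auto simp: sum_ee)
  also have "\<dots> = (\<Sum>p\<in>{p\<in>P. N dvd L p}. of_int N * W p)"
    using P by (simp add: sum.inter_filter)
  finally show ?thesis by (simp add: sum_distrib_left)
qed

lemma dvd_diff_imp_eq:
  fixes N x y :: int
  assumes "N dvd x - y" "x \<in> {0..<N}" "y \<in> {0..<N}"
  shows "x = y"
  using assms by (simp add: mod_eq_dvd_iff[symmetric])

lemma parseval:
  assumes "N > 0"
  shows "(\<Sum>x\<in>{0..<N}. (cmod (\<Sum>r\<in>{0..<N}. c r * ee N (- (r * x))))\<^sup>2)
       = of_int N * (\<Sum>r\<in>{0..<N}. (cmod (c r))\<^sup>2)"
proof -
  let ?Z = "{0..<N}"
  have "complex_of_real (\<Sum>x\<in>?Z. (cmod (\<Sum>r\<in>?Z. c r * ee N (- (r * x))))\<^sup>2)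
      = (\<Sum>x\<in>?Z. (\<Sum>r\<in>?Z. c r * ee N (- (r * x))) * (\<Sum>r\<in>?Z. cnj (c r) * ee N (r * x)))"
    unfolding of_real_sum complex_norm_square by (simp add: cnj_ee)
  also have "\<dots> = (\<Sum>x\<in>?Z. \<Sum>p\<in>?Z \<times> ?Z. c (fst p) * cnj (c (snd p)) * ee N (x * (snd p - fst p)))"
    by (intro sum.cong refl)
       (auto simp: sum_product sum.cartesian_product split_def ee_add[symmetric] algebra_simps
         intro!: sum.cong arg_cong[where f = "ee N"])
  also have "\<dots> = of_int N * (\<Sum>p\<in>{p\<in>?Z \<times> ?Z. N dvd snd p - fst p}. c (fst p) * cnj (c (snd p)))"
    using assms by (intro sum_sum_ee) auto
  also have "(\<Sum>p\<in>{p\<in>?Z \<times> ?Z. N dvd snd p - fst p}. c (fst p) * cnj (c (snd p)))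
      = (\<Sum>r\<in>?Z. c r * cnj (c r))"
    by (rule sum.reindex_bij_witness[of _ "\<lambda>r. (r, r)" fst]) (auto dest: dvd_diff_imp_eq)
  also have "of_int N * (\<Sum>r\<in>?Z. c r * cnj (c r))
      = complex_of_real (of_int N * (\<Sum>r\<in>?Z. (cmod (c r))\<^sup>2))"
    by (simp add: complex_norm_square[symmetric] )
  finally show ?thesis using of_real_eq_iff by blast
qed

section \<open>Transforms of sets, and what the Sidon property says about them\<close>

definition mu :: "int \<Rightarrow> int set \<Rightarrow> int \<Rightarrow> complex" where
  "mu N A r = (\<Sum>a\<in>A. ee N (r * a)) / of_nat (card A)"

lemma mu_cong: "N dvd r - s \<Longrightarrow> mu N A r = mu N A s"
  unfolding mu_def
  by (intro arg_cong2[where f = "(/)"] sum.cong refl ee_cong)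
     (simp add: left_diff_distrib[symmetric])

lemma mu_mod: "mu N A (r mod N) = mu N A r"
  by (rule mu_cong) (simp add: mod_eq_dvd_iff[symmetric])

lemma norm_mu_le_1: "cmod (mu N A r) \<le> 1"
proof (cases "card A = 0")
  case False
  have "cmod (\<Sum>a\<in>A. ee N (r * a)) \<le> (\<Sum>a\<in>A. cmod (ee N (r * a)))" by (rule norm_sum)
  then show ?thesis using False by (simp add: mu_def norm_divide)
qed (auto simp: mu_def)

lemma mu_0: "finite A \<Longrightarrow> A \<noteq> {} \<Longrightarrow> mu N A 0 = 1"
  by (simp add: mu_def)

lemma sum_mu_square_mult:
  assumes N: "N > 0" and A: "finite A" and B: "finite B"
  shows "(\<Sum>r\<in>{0..<N}. (cmod (mu N A r))\<^sup>2 * (cmod (mu N B r))\<^sup>2)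
    = of_int N * real (card {p \<in> (A \<times> A) \<times> (B \<times> B).
          N dvd fst (fst p) - snd (fst p) + (fst (snd p) - snd (snd p))}) /
        (real (card A) ^ 2 * real (card B) ^ 2)"
proof -
  let ?Z = "{0..<N}" and ?P = "(A \<times> A) \<times> (B \<times> B)"
  define L :: "(int \<times> int) \<times> (int \<times> int) \<Rightarrow> int" where
    "L p = fst (fst p) - snd (fst p) + (fst (snd p) - snd (snd p))" for p
  define S where "S A r = (\<Sum>a\<in>A. ee N (r * a))" for A r
  have sq: "complex_of_real ((cmod (S A r))\<^sup>2) = (\<Sum>p\<in>A \<times> A. ee N (r * (fst p - snd p)))" for A r
    unfolding S_def complex_norm_square
    by (auto simp: cnj_ee sum_product sum.cartesian_product split_def ee_add[symmetric] algebra_simps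
         intro!: sum.cong arg_cong[where f = "ee N"])
  have "complex_of_real (\<Sum>r\<in>?Z. (cmod (S A r))\<^sup>2 * (cmod (S B r))\<^sup>2)
      = (\<Sum>r\<in>?Z. \<Sum>p\<in>?P. 1 * ee N (r * L p))"
    unfolding of_real_sum of_real_mult sq L_def
    by (auto simp: sum_product sum.cartesian_product split_def ee_add[symmetric] algebra_simps
         intro!: sum.cong arg_cong[where f = "ee N"])
  also have "\<dots> = of_int N * (\<Sum>p\<in>{p\<in>?P. N dvd L p}. 1)"
    using N A B by (intro sum_sum_ee) auto
  also have "\<dots> = complex_of_real (of_int N * real (card {p\<in>?P. N dvd L p}))" by simp
  finally have "(\<Sum>r\<in>?Z. (cmod (S A r))\<^sup>2 * (cmod (S B r))\<^sup>2) = of_int N * real (card {p\<in>?P. N dvd L p})"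
    using of_real_eq_iff by blast
  moreover have "(cmod (mu N A r))\<^sup>2 * (cmod (mu N B r))\<^sup>2
      = (cmod (S A r))\<^sup>2 * (cmod (S B r))\<^sup>2 / (real (card A) ^ 2 * real (card B) ^ 2)" for r
    by (simp add: mu_def S_def norm_divide power_divide)
  ultimately show ?thesis
    by (simp add: L_def sum_divide_distrib[symmetric])
qed

lemma sum_mu_square:
  assumes N: "N > 0" and B: "B \<subseteq> {0..<N}" "B \<noteq> {}"
  shows "(\<Sum>r\<in>{0..<N}. (cmod (mu N B r))\<^sup>2) = of_int N / real (card B)"
proof -
  have fB: "finite B" using B finite_subset by blast
  \<comment> \<open>\<open>mu N {0}\<close> is constantly 1, so the two-set count degenerates to
    Parseval for \<open>B\<close>.\<close>
  have "(\<Sum>r\<in>{0..<N}. (cmod (mu N B r))\<^sup>2) = (\<Sum>r\<in>{0..<N}. (cmod (mu N B r))\<^sup>2 * (cmod (mu N {0} r))\<^sup>2)"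
    by (simp add: mu_def)
  also have "\<dots> = of_int N * real (card {p \<in> (B \<times> B) \<times> ({0} \<times> {0}).
          N dvd fst (fst p) - snd (fst p) + (fst (snd p) - snd (snd p))}) /
        (real (card B) ^ 2 * real (card {0::int}) ^ 2)"
    using N fB by (intro sum_mu_square_mult) auto
  also have "card {p \<in> (B \<times> B) \<times> ({0} \<times> {0}).
          N dvd fst (fst p) - snd (fst p) + (fst (snd p) - snd (snd p))} = card B"
    using B by (intro bij_betw_same_card[of "\<lambda>p. fst (fst p)"] bij_betwI[where g = "\<lambda>b. ((b, b), (0, 0))"])
       (auto intro: dvd_diff_imp_eq[OF _ subsetD[OF B(1)] subsetD[OF B(1)]])
  finally show ?thesis using B fB by (simp add: power2_eq_square field_simps)
qed

text \<open>Sums are compared modulo \<open>N\<close> because Fourier counts see only residues; a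
  Sidon set of integers qualifies once \<open>N\<close> exceeds every difference of two
  sums.\<close>

definition sidon_mod :: "int \<Rightarrow> int set \<Rightarrow> bool" where
  "sidon_mod N A \<longleftrightarrow> A \<subseteq> {0..<N} \<and> (\<forall>a\<in>A. \<forall>b\<in>A. \<forall>c\<in>A. \<forall>d\<in>A.
     N dvd a + b - (c + d) \<longrightarrow> (a = c \<and> b = d) \<or> (a = d \<and> b = c))"

text \<open>In a Sidon set a nonzero difference determines its ordered pair. In a - a' + b - b' = 0
  the case b = b' forces a = a', which leaves |A| |B| choices; otherwise (b, b') fixes (a, a'),
  which leaves at most |B|^2.\<close>

lemma sum_mu_square_mult_sidon:
  assumes N: "N > 0" and A: "sidon_mod N A" "A \<noteq> {}" and B: "B \<subseteq> {0..<N}" "B \<noteq> {}"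
  shows "(\<Sum>r\<in>{0..<N}. (cmod (mu N A r))\<^sup>2 * (cmod (mu N B r))\<^sup>2)
     \<le> of_int N / (real (card A))\<^sup>2 + of_int N / (real (card A) * real (card B))"
proof -
  have AZ: "A \<subseteq> {0..<N}" using A by (simp add: sidon_mod_def)
  have fA: "finite A" and fB: "finite B" using AZ B finite_subset by blast+
  let ?P = "{p \<in> (A \<times> A) \<times> (B \<times> B). N dvd fst (fst p) - snd (fst p) + (fst (snd p) - snd (snd p))}"
  let ?D = "{p \<in> ?P. fst (snd p) = snd (snd p)}" and ?O = "{p \<in> ?P. fst (snd p) \<noteq> snd (snd p)}"
  have fin: "finite ?P" using fA fB by (auto intro: finite_subset[of _ "(A \<times> A) \<times> (B \<times> B)"])
  have "card ?D \<le> card (A \<times> B)"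
  proof (rule card_inj_on_le[of "\<lambda>p. (fst (fst p), fst (snd p))"])
    show "inj_on (\<lambda>p. (fst (fst p), fst (snd p))) ?D"
      using AZ by (auto simp: inj_on_def dest!: dvd_diff_imp_eq)
  qed (use fA fB in auto)
  moreover have "card ?O \<le> card (B \<times> B)"
  proof (rule card_inj_on_le[of snd])
    show "inj_on snd ?O"
    proof (rule inj_onI)
      fix p q assume p: "p \<in> ?O" and q: "q \<in> ?O" and e: "snd p = snd q"
      obtain a a' b b' where P: "p = ((a, a'), (b, b'))" by (metis prod.collapse)
      obtain c c' d d' where Q: "q = ((c, c'), (d, d'))" by (metis prod.collapse)
      from e P Q have [simp]: "d = b" "d' = b'" by auto
      have m: "a \<in> A" "a' \<in> A" "c \<in> A" "c' \<in> A" "b \<in> B" "b' \<in> B" "b \<noteq> b'"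
        "N dvd a - a' + (b - b')" "N dvd c - c' + (b - b')"
        using p q P Q by auto
      have "N dvd a + c' - (c + a')"
        using dvd_diff[OF m(8,9)] by (simp add: algebra_simps)
      with m A have "(a = c \<and> c' = a') \<or> (a = a' \<and> c' = c)"
        unfolding sidon_mod_def by blast
      moreover have "a \<noteq> a'"
        using m dvd_diff_imp_eq[of N b b'] subsetD[OF B(1), of b] subsetD[OF B(1), of b'] by auto
      ultimately show "p = q" using P Q by auto
    qed
  qed (use fB in auto)
  moreover have "finite ?D" "finite ?O" by (rule finite_subset[OF _ fin], blast)+
  then have "card (?D \<union> ?O) = card ?D + card ?O" by (rule card_Un_disjoint) blast
  moreover have "?D \<union> ?O = ?P" by blast
  ultimately have "card ?P \<le> card A * card B + card B * card B"
    by (simp add: card_cartesian_product)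
  then have "real (card ?P) \<le> real (card A) * real (card B) + real (card B) ^ 2"
    unfolding power2_eq_square of_nat_mult[symmetric] of_nat_add[symmetric] of_nat_le_iff .
  then have "of_int N * real (card ?P) / (real (card A) ^ 2 * real (card B) ^ 2)
    \<le> of_int N * (real (card A) * real (card B) + real (card B) ^ 2) / (real (card A) ^ 2 * real (card B) ^ 2)"
    using N by (intro divide_right_mono mult_left_mono) auto
  also have "\<dots> = of_int N / (real (card A))\<^sup>2 + of_int N / (real (card A) * real (card B))"
    using fA fB A B by (simp add: field_simps power2_eq_square)
  finally show ?thesis
    using sum_mu_square_mult[OF N fA fB] by simp
qed

lemma sum_mu_power4_sidon:
  assumes N: "N > 0" and A: "sidon_mod N A" "A \<noteq> {}"
  shows "(\<Sum>r\<in>{0..<N}. (cmod (mu N A r)) ^ 4) \<le> 2 * of_int N / (real (card A))\<^sup>2"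
proof -
  have "A \<subseteq> {0..<N}" using A by (simp add: sidon_mod_def)
  from sum_mu_square_mult_sidon[OF N A this A(2)] show ?thesis
    by (simp add: power2_eq_square power4_eq_xxxx mult.assoc)
qed

section \<open>Bohr sets\<close>

text \<open>Closeness is measured by the chord to 1 instead of the distance to the nearest integer:
  chords are subadditive, and averaging them bounds the distance of a transform from 1.\<close>

definition bohr :: "int \<Rightarrow> int set \<Rightarrow> real \<Rightarrow> int set" where
  "bohr N R \<eta> = {x \<in> {0..<N}. \<forall>r\<in>R. cmod (ee N (r * x) - 1) \<le> \<eta>}"

lemma zero_in_bohr: "N > 0 \<Longrightarrow> \<eta> \<ge> 0 \<Longrightarrow> 0 \<in> bohr N R \<eta>"
  by (simp add: bohr_def)

lemma norm_ee_diff: "cmod (ee N k - ee N l) = cmod (ee N (k - l) - 1)"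
proof -
  have "ee N k - ee N l = ee N l * (ee N (k - l) - 1)"
    using ee_add[of N l "k - l"] by (simp add: algebra_simps)
  then show ?thesis by (simp add: norm_mult)
qed

lemma norm_ee_diff_same_cell:
  assumes N: "N > 0" and K: "K > 0"
    and eq: "int K * (k mod N) div N = int K * (l mod N) div N"
  shows "cmod (ee N (k - l) - 1) \<le> 2 * pi / real K"
proof -
  let ?u = "k mod N" and ?v = "l mod N"
  have cell: "(x div N) * N \<le> x \<and> x < (x div N) * N + N" for x
    using div_mult_mod_eq[of x N] pos_mod_bound[OF N, of x] pos_mod_sign[OF N, of x] by linarith
  define q where "q = int K * ?u div N"
  have "q * N \<le> int K * ?u" "int K * ?u < q * N + N" "q * N \<le> int K * ?v" "int K * ?v < q * N + N"
    using cell[of "int K * ?u"] cell[of "int K * ?v"] eq unfolding q_def by auto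
  then have "\<bar>int K * ?u - int K * ?v\<bar> \<le> N" by linarith
  then have "real_of_int \<bar>int K * ?u - int K * ?v\<bar> \<le> real_of_int N" by linarith
  then have "\<bar>real K * (real_of_int ?u - real_of_int ?v)\<bar> \<le> real_of_int N"
    by (simp add: algebra_simps)
  then have *: "\<bar>real_of_int ?u - real_of_int ?v\<bar> / real_of_int N \<le> 1 / real K"
    using N K unfolding abs_mult by (simp add: field_simps del: right_diff_distrib right_diff_distrib')
  have "cmod (ee N (k - l) - 1) = cmod (ee N k - ee N l)" by (simp add: norm_ee_diff)
  also have "ee N k = ee N ?u" by (rule ee_cong) (simp add: mod_eq_dvd_iff[symmetric])
  also have "ee N l = ee N ?v" by (rule ee_cong) (simp add: mod_eq_dvd_iff[symmetric])
  also have "cmod (ee N ?u - ee N ?v) \<le> \<bar>2 * pi * of_int ?u / of_int N - 2 * pi * of_int ?v / of_int N\<bar>"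
    unfolding ee_def by (rule norm_cis_diff_le)
  also have "2 * pi * of_int ?u / of_int N - 2 * pi * of_int ?v / of_int N
       = 2 * pi * ((real_of_int ?u - real_of_int ?v) / of_int N)"
    by (simp add: diff_divide_distrib right_diff_distrib)
  also have "\<bar>2 * pi * ((real_of_int ?u - real_of_int ?v) / of_int N)\<bar>
       = 2 * pi * (\<bar>real_of_int ?u - real_of_int ?v\<bar> / real_of_int N)"
    using N by (simp add: abs_mult)
  also have "\<dots> \<le> 2 * pi * (1 / real K)"
    using * by (intro mult_left_mono) auto
  finally show ?thesis by simp
qed

text \<open>Pigeonhole: cut the circle into \<open>K\<close> arcs for each frequency in
  \<open>R\<close>. Two points with the same pattern of arcs differ by an element of the Bohr set,
  and there are at most \<open>K ^ card R\<close> patterns.\<close>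

lemma card_bohr_ge:
  assumes N: "N > 0" and R: "finite R" and K: "K > 0" and K\<eta>: "2 * pi / real K \<le> \<eta>"
  shows "nat N \<le> K ^ card R * card (bohr N R \<eta>)"
proof -
  let ?Z = "{0..<N}"
  define f where "f x = (\<lambda>r\<in>R. int K * ((r * x) mod N) div N)" for x
  define T where "T = PiE R (\<lambda>_. {0..<int K})"
  have f_in: "f ` ?Z \<subseteq> T"
  proof -
    have "int K * ((r * x) mod N) div N \<in> {0..<int K}" for r x
    proof -
      have "int K * ((r * x) mod N) < int K * N"
        using N K by (intro mult_strict_left_mono) auto
      then have "\<not> int K * N \<le> (int K * ((r * x) mod N) div N) * N"
        using div_mult_mod_eq[of "int K * ((r * x) mod N)" N] pos_mod_sign[OF N, of "int K * ((r * x) mod N)"]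
        by linarith
      then have "int K * ((r * x) mod N) div N < int K"
        using N by (meson linorder_not_less mult_right_mono order_less_imp_le)
      then show ?thesis using N by (simp add: pos_imp_zdiv_nonneg_iff)
    qed
    then show ?thesis by (auto simp: f_def T_def)
  qed
  have cT: "card T = K ^ card R" "finite T" "T \<noteq> {}"
    using R K by (auto simp: T_def card_PiE finite_PiE PiE_eq_empty_iff)
  have fin: "finite (bohr N R \<eta>)" by (rule finite_subset[of _ ?Z]) (auto simp: bohr_def)
  have fibre: "card {x \<in> ?Z. f x = y} \<le> card (bohr N R \<eta>)" for y
  proof (cases "{x \<in> ?Z. f x = y} = {}")
    case False
    then obtain x0 where x0: "x0 \<in> ?Z" "f x0 = y" by blast
    show ?thesis
    \<comment> \<open>Subtracting one fixed point \<open>x0\<close> of the fibre carries the whole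
      fibre injectively into the Bohr set.\<close>
    proof (rule card_inj_on_le[of "\<lambda>x. (x - x0) mod N"])
      show "inj_on (\<lambda>x. (x - x0) mod N) {x \<in> ?Z. f x = y}"
      proof (rule inj_onI)
        fix x x' assume a: "x \<in> {x \<in> ?Z. f x = y}" "x' \<in> {x \<in> ?Z. f x = y}"
          and "(x - x0) mod N = (x' - x0) mod N"
        then have "N dvd x - x'" by (simp add: mod_eq_dvd_iff)
        then show "x = x'" using a dvd_diff_imp_eq by blast
      qed
      show "(\<lambda>x. (x - x0) mod N) ` {x \<in> ?Z. f x = y} \<subseteq> bohr N R \<eta>"
      proof safe
        fix x assume x: "x \<in> ?Z" and y: "y = f x"
        have "cmod (ee N (r * ((x - x0) mod N)) - 1) \<le> \<eta>" if "r \<in> R" for r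
        proof -
          have "int K * ((r * x) mod N) div N = int K * ((r * x0) mod N) div N"
            using fun_cong[of "f x" "f x0" r] that x0(2) y unfolding f_def restrict_def by simp
          from norm_ee_diff_same_cell[OF N K this]
          have "cmod (ee N (r * x - r * x0) - 1) \<le> \<eta>" using K\<eta> by simp
          moreover have "ee N (r * ((x - x0) mod N)) = ee N (r * x - r * x0)"
            by (rule ee_cong) (simp add: mod_eq_dvd_iff[symmetric] mod_mult_right_eq right_diff_distrib[symmetric])
          ultimately show ?thesis by simp
        qed
        then show "(x - x0) mod N \<in> bohr N R \<eta>" using N by (simp add: bohr_def)
      qed
    qed (rule fin)
  next
    case True
    then show ?thesis by (simp only: card.empty)
  qed
  have "nat N = card ?Z" by simp
  also have "?Z = (\<Union>y\<in>T. {x \<in> ?Z. f x = y})" using f_in by auto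
  also have "card \<dots> \<le> (\<Sum>y\<in>T. card {x \<in> ?Z. f x = y})" using cT by (intro card_UN_le) auto
  also have "\<dots> \<le> (\<Sum>y\<in>T. card (bohr N R \<eta>))" by (intro sum_mono fibre)
  finally show ?thesis by (simp add: cT)
qed

lemma norm_ee_add_minus_1: "cmod (ee N (k + l) - 1) \<le> cmod (ee N k - 1) + cmod (ee N l - 1)"
proof -
  have "ee N (k + l) - 1 = ee N k * (ee N l - 1) + (ee N k - 1)"
    by (simp add: ee_add algebra_simps)
  then have "cmod (ee N (k + l) - 1) \<le> cmod (ee N k * (ee N l - 1)) + cmod (ee N k - 1)"
    by (metis norm_triangle_ineq)
  then show ?thesis by (simp add: norm_mult)
qed

lemma norm_ee_minus_minus_1: "cmod (ee N (- k) - 1) = cmod (ee N k - 1)"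
  using norm_ee_diff[of N 0 k] by (simp add: norm_minus_commute)

lemma norm_ee_mult_minus_1: "cmod (ee N (m * k) - 1) \<le> \<bar>of_int m\<bar> * cmod (ee N k - 1)"
proof -
  have nat: "cmod (ee N (int n * k) - 1) \<le> real n * cmod (ee N k - 1)" for n
  proof (induction n)
    case (Suc n)
    then show ?case
      using norm_ee_add_minus_1[of N "int n * k" k] by (simp add: algebra_simps)
  qed simp
  show ?thesis
  proof (cases "m \<ge> 0")
    case True
    then show ?thesis using nat[of "nat m"] by simp
  next
    case False
    then show ?thesis using nat[of "nat (- m)"] norm_ee_minus_minus_1[of N "m * k"] by simp
  qed
qed

lemma norm_mu_minus_1_le:
  assumes "finite B" "B \<noteq> {}" "\<And>b. b \<in> B \<Longrightarrow> cmod (ee N (r * b) - 1) \<le> \<eta>"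
  shows "cmod (mu N B r - 1) \<le> \<eta>"
proof -
  have "mu N B r - 1 = (\<Sum>b\<in>B. ee N (r * b) - 1) / of_nat (card B)"
    using assms(1,2) by (simp add: mu_def sum_subtractf field_simps)
  then have "cmod (mu N B r - 1) = cmod (\<Sum>b\<in>B. ee N (r * b) - 1) / real (card B)"
    by (simp add: norm_divide)
  also have "cmod (\<Sum>b\<in>B. ee N (r * b) - 1) \<le> (\<Sum>b\<in>B. \<eta>)"
    using assms(3) by (intro sum_norm_le) auto
  finally show ?thesis using assms(1,2) by (simp add: divide_right_mono)
qed

section \<open>Smoothing a set along another set\<close>

text \<open>The convolution of the uniform measures on \<open>A\<close>, \<open>B\<close> and
  -\<open>B\<close>, as a density relative to the uniform measure, so its mean is 1 for nonempty
  sets. Using \<open>B\<close> together with -\<open>B\<close> makes the Fourier multiplier |mu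
  B|^2, which is real and lies in [0, 1].\<close>

definition smoothed :: "int \<Rightarrow> int set \<Rightarrow> int set \<Rightarrow> int \<Rightarrow> real" where
  "smoothed N A B x = of_int N * real (card {p \<in> A \<times> (B \<times> B). N dvd fst p + (fst (snd p) - snd (snd p)) - x})
     / (real (card A) * (real (card B))\<^sup>2)"

lemma smoothed_nonneg: "N > 0 \<Longrightarrow> smoothed N A B x \<ge> 0"
  by (simp add: smoothed_def)

lemma mult_sum_ee:
  "(\<Sum>p\<in>P. W p * ee N (r * L p)) * (\<Sum>q\<in>Q. V q * ee N (r * M q))
     = (\<Sum>z\<in>P \<times> Q. (W (fst z) * V (snd z)) * ee N (r * (L (fst z) + M (snd z))))"
  by (auto simp: sum_product sum.cartesian_product split_def ee_add distrib_left intro!: sum.cong)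

lemma smoothed_fourier:
  assumes N: "N > 0" and A: "finite A" and B: "finite B"
  shows "complex_of_real (smoothed N A B x)
     = (\<Sum>r\<in>{0..<N}. mu N A r * of_real ((cmod (mu N B r))\<^sup>2) * ee N (- (r * x)))"
proof -
  let ?P = "A \<times> (B \<times> B)"
  let ?k = "of_nat (card A) * (of_nat (card B))\<^sup>2 :: complex"
  define L :: "int \<times> int \<times> int \<Rightarrow> int" where "L p = fst p + (fst (snd p) - snd (snd p)) - x" for p
  have "mu N A r * of_real ((cmod (mu N B r))\<^sup>2) * ee N (- (r * x))
      = (\<Sum>p\<in>?P. 1 * ee N (r * L p)) / ?k" for r
  proof -
    have "of_real ((cmod (mu N B r))\<^sup>2)
        = (\<Sum>b\<in>B. 1 * ee N (r * b)) * (\<Sum>b\<in>B. 1 * ee N (r * (- b))) / (of_nat (card B))\<^sup>2"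
      unfolding complex_norm_square by (simp add: mu_def cnj_ee power2_eq_square)
    then have "mu N A r * of_real ((cmod (mu N B r))\<^sup>2) * ee N (- (r * x))
      = ((\<Sum>a\<in>A. 1 * ee N (r * a)) * ((\<Sum>b\<in>B. 1 * ee N (r * b)) * (\<Sum>b\<in>B. 1 * ee N (r * (- b)))))
          * ee N (- (r * x)) / ?k"
      by (simp add: mu_def)
    also have "\<dots> = (\<Sum>p\<in>?P. 1 * ee N (r * L p)) / ?k"
      unfolding mult_sum_ee L_def
      by (auto simp: sum_distrib_right ee_add[symmetric] right_diff_distrib intro!: arg_cong2[where f = "(/)"] sum.cong)
    finally show ?thesis .
  qed
  then have "(\<Sum>r\<in>{0..<N}. mu N A r * of_real ((cmod (mu N B r))\<^sup>2) * ee N (- (r * x)))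
     = (\<Sum>r\<in>{0..<N}. \<Sum>p\<in>?P. 1 * ee N (r * L p)) / ?k"
    by (simp add: sum_divide_distrib)
  also have "\<dots> = of_int N * (\<Sum>p\<in>{p\<in>?P. N dvd L p}. 1) / ?k"
    using assms by (subst sum_sum_ee) auto
  also have "\<dots> = complex_of_real (smoothed N A B x)"
    by (simp add: smoothed_def L_def)
  finally show ?thesis by simp
qed

lemma smoothed_periodic:
  assumes "N dvd x - y" shows "smoothed N A B x = smoothed N A B y"
proof -
  have "N dvd k - x \<longleftrightarrow> N dvd k - y" for k
    using dvd_add_right_iff[OF assms, of "k - x"] by simp
  then show ?thesis by (simp add: smoothed_def)
qed

lemma smoothed_transform:
  assumes N: "N > 0" and A: "finite A" and B: "finite B"
  shows "(\<Sum>x\<in>{0..<N}. complex_of_real (smoothed N A B x / of_int N) * ee N (s * x))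
     = mu N A s * of_real ((cmod (mu N B s))\<^sup>2)"
proof -
  let ?Z = "{0..<N}"
  define c where "c r = mu N A r * of_real ((cmod (mu N B r))\<^sup>2)" for r
  have "(\<Sum>x\<in>?Z. complex_of_real (smoothed N A B x) * ee N (s * x))
      = (\<Sum>x\<in>?Z. \<Sum>r\<in>?Z. c r * ee N (x * (s - r)))"
    unfolding smoothed_fourier[OF assms] c_def[symmetric] sum_distrib_right mult.assoc ee_add[symmetric]
    by (simp add: algebra_simps)
  also have "\<dots> = of_int N * (\<Sum>r\<in>{r\<in>?Z. N dvd s - r}. c r)"
    using N by (subst sum_sum_ee) auto
  also have "{r\<in>?Z. N dvd s - r} = {s mod N}"
    using N by (auto simp: mod_eq_dvd_iff[symmetric])
  finally have "(\<Sum>x\<in>?Z. complex_of_real (smoothed N A B x) * ee N (s * x)) = of_int N * c s"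
    by (simp add: c_def mu_mod)
  then have "(\<Sum>x\<in>?Z. complex_of_real (smoothed N A B x) * ee N (s * x)) / of_int N = c s"
    using N by simp
  then show ?thesis by (simp add: c_def sum_divide_distrib)
qed

lemma sum_smoothed:
  assumes N: "N > 0" and A: "finite A" "A \<noteq> {}" and B: "finite B" "B \<noteq> {}"
  shows "(\<Sum>x\<in>{0..<N}. smoothed N A B x) = of_int N"
proof -
  have "complex_of_real (\<Sum>x\<in>{0..<N}. smoothed N A B x / of_int N) = 1"
    using smoothed_transform[OF N A(1) B(1), of 0] A B by (simp add: mu_0)
  then have "(\<Sum>x\<in>{0..<N}. smoothed N A B x / of_int N) = 1"
    using of_real_eq_1_iff by blast
  then show ?thesis using N by (simp add: sum_divide_distrib[symmetric] field_simps)
qed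

lemma sum_smoothed_diff_square:
  assumes N: "N > 0" and A: "finite A" and B: "finite B" and C: "finite C"
  shows "(\<Sum>x\<in>{0..<N}. (smoothed N A B x - smoothed N A C x)\<^sup>2)
     = of_int N * (\<Sum>r\<in>{0..<N}. (cmod (mu N A r))\<^sup>2 * ((cmod (mu N B r))\<^sup>2 - (cmod (mu N C r))\<^sup>2)\<^sup>2)"
proof -
  define c where "c r = mu N A r * of_real ((cmod (mu N B r))\<^sup>2 - (cmod (mu N C r))\<^sup>2)" for r
  have "complex_of_real (smoothed N A B x - smoothed N A C x)
      = (\<Sum>r\<in>{0..<N}. c r * ee N (- (r * x)))" for x
    unfolding of_real_diff smoothed_fourier[OF N A B] smoothed_fourier[OF N A C]
    by (simp add: c_def sum_subtractf[symmetric] algebra_simps)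
  then have "(smoothed N A B x - smoothed N A C x)\<^sup>2
      = (cmod (\<Sum>r\<in>{0..<N}. c r * ee N (- (r * x))))\<^sup>2" for x
    by (metis norm_of_real power2_abs)
  then show ?thesis
    using parseval[OF N, of c] by (simp add: c_def norm_mult power_mult_distrib del: of_real_diff of_real_power)
qed

lemma sum_smoothed_square:
  assumes N: "N > 0" and A: "finite A" and B: "finite B"
  shows "(\<Sum>x\<in>{0..<N}. (smoothed N A B x)\<^sup>2)
     = of_int N * (\<Sum>r\<in>{0..<N}. (cmod (mu N A r))\<^sup>2 * (cmod (mu N B r)) ^ 4)"
proof -
  \<comment> \<open>The empty set plays the part of the zero function: division by zero makes both
    \<open>smoothed N A {}\<close> and \<open>mu N {}\<close> vanish.\<close>
  have "(\<Sum>x\<in>{0..<N}. (smoothed N A B x - smoothed N A {} x)\<^sup>2)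
     = of_int N * (\<Sum>r\<in>{0..<N}. (cmod (mu N A r))\<^sup>2 * ((cmod (mu N B r))\<^sup>2 - (cmod (mu N {} r))\<^sup>2)\<^sup>2)"
    by (rule sum_smoothed_diff_square) (use assms in auto)
  then show ?thesis by (simp add: smoothed_def mu_def)
qed

lemma sum_smoothed_shift_square:
  assumes N: "N > 0" and A: "finite A" and B: "finite B"
  shows "(\<Sum>x\<in>{0..<N}. (smoothed N A B (x + y) - smoothed N A B x)\<^sup>2)
     = of_int N * (\<Sum>r\<in>{0..<N}. (cmod (mu N A r))\<^sup>2 * (cmod (mu N B r)) ^ 4 * (cmod (ee N (r * y) - 1))\<^sup>2)"
proof -
  define c where "c r = mu N A r * of_real ((cmod (mu N B r))\<^sup>2) * (ee N (- (r * y)) - 1)" for r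
  have "complex_of_real (smoothed N A B (x + y) - smoothed N A B x)
      = (\<Sum>r\<in>{0..<N}. c r * ee N (- (r * x)))" for x
    unfolding of_real_diff smoothed_fourier[OF N A B]
    by (auto simp: c_def sum_subtractf[symmetric] algebra_simps ee_add[symmetric] intro!: sum.cong)
  then have "(smoothed N A B (x + y) - smoothed N A B x)\<^sup>2
      = (cmod (\<Sum>r\<in>{0..<N}. c r * ee N (- (r * x))))\<^sup>2" for x
    by (metis norm_of_real power2_abs)
  moreover have "(cmod (c r))\<^sup>2 = (cmod (mu N A r))\<^sup>2 * (cmod (mu N B r)) ^ 4 * (cmod (ee N (r * y) - 1))\<^sup>2" for r
    unfolding c_def norm_mult power_mult_distrib norm_ee_minus_minus_1 norm_of_real
    by (simp flip: power_mult)
  ultimately show ?thesis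
    using parseval[OF N, of c] by simp
qed

section \<open>Counting solutions of the equation\<close>

text \<open>Multiplication by a unit permutes the residues. This is how a dilate of
  \<open>mu N A\<close> by a coefficient keeps its moments.\<close>

lemma sum_dilate:
  fixes h :: "int \<Rightarrow> real"
  assumes N: "N > 0" and c: "coprime c N" and h: "\<And>r. h (r mod N) = h r"
  shows "(\<Sum>r\<in>{0..<N}. h (c * r)) = (\<Sum>r\<in>{0..<N}. h r)"
proof -
  let ?Z = "{0..<N}"
  have inj: "inj_on (\<lambda>r. (c * r) mod N) ?Z"
  proof (rule inj_onI)
    fix x y assume xy: "x \<in> ?Z" "y \<in> ?Z" and "(c * x) mod N = (c * y) mod N"
    then have "N dvd c * (x - y)" by (simp add: mod_eq_dvd_iff right_diff_distrib)
    then have "N dvd x - y" using c by (simp add: coprime_dvd_mult_right_iff coprime_commute)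
    then show "x = y" using xy dvd_diff_imp_eq by blast
  qed
  have im: "(\<lambda>r. (c * r) mod N) ` ?Z = ?Z"
    using N by (intro endo_inj_surj inj) auto
  have "(\<Sum>r\<in>?Z. h r) = (\<Sum>r\<in>?Z. h ((c * r) mod N))"
    using sum.reindex[OF inj, of h] im by simp
  then show ?thesis by (simp add: h)
qed

definition sols :: "int \<Rightarrow> (int \<times> int \<times> int \<times> int \<times> int) \<Rightarrow> int set \<Rightarrow> (int \<times> int \<times> int \<times> int \<times> int) set" where
  "sols N c X = {(x1, x2, x3, x4, x5). x1 \<in> X \<and> x2 \<in> X \<and> x3 \<in> X \<and> x4 \<in> X \<and> x5 \<in> X \<and>
     (case c of (c1, c2, c3, c4, c5) \<Rightarrow> N dvd c1 * x1 + c2 * x2 + c3 * x3 + c4 * x4 + c5 * x5)}"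

lemma finite_sols: "finite X \<Longrightarrow> finite (sols N c X)"
  by (rule finite_subset[of _ "X \<times> X \<times> X \<times> X \<times> X"]) (auto simp: sols_def)

definition prod5 :: "(int \<Rightarrow> 'a::comm_monoid_mult) \<Rightarrow> (int \<times> int \<times> int \<times> int \<times> int) \<Rightarrow> 'a" where
  "prod5 w = (\<lambda>(x1, x2, x3, x4, x5). w x1 * (w x2 * (w x3 * (w x4 * w x5))))"

definition dil5 :: "(int \<times> int \<times> int \<times> int \<times> int) \<Rightarrow> int \<Rightarrow> (int \<times> int \<times> int \<times> int \<times> int)" where
  "dil5 = (\<lambda>(c1, c2, c3, c4, c5) r. (c1 * r, c2 * r, c3 * r, c4 * r, c5 * r))"

text \<open>Expanding the product of five transforms leaves one character of the linear form with
  coefficients \<open>c\<close>. The weights will be uniform on \<open>A\<close> on one side, and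
  the smoothing of \<open>A\<close> on the other.\<close>

lemma sum_prod5_transform:
  assumes N: "N > 0" and X: "finite X"
  shows "(\<Sum>r\<in>{0..<N}. prod5 (\<lambda>s. \<Sum>x\<in>X. w x * ee N (s * x)) (dil5 c r))
    = of_int N * (\<Sum>p\<in>sols N c X. prod5 w p)"
proof -
  obtain c1 c2 c3 c4 c5 where c: "c = (c1, c2, c3, c4, c5)" by (metis prod.collapse)
  have r: "(\<Sum>x\<in>X. w x * ee N (k * r * x)) = (\<Sum>x\<in>X. w x * ee N (r * (k * x)))" for k r
    by (simp add: mult_ac)
  let ?P = "X \<times> X \<times> X \<times> X \<times> X"
  define L where "L p = c1 * fst p + (c2 * fst (snd p) + (c3 * fst (snd (snd p))
     + (c4 * fst (snd (snd (snd p))) + c5 * snd (snd (snd (snd p))))))" for p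
  have "(\<Sum>r\<in>{0..<N}. prod5 (\<lambda>s. \<Sum>x\<in>X. w x * ee N (s * x)) (dil5 c r))
     = (\<Sum>r\<in>{0..<N}. \<Sum>p\<in>?P. prod5 w p * ee N (r * L p))"
    by (simp add: c dil5_def prod5_def r mult_sum_ee split_def L_def)
  also have "\<dots> = of_int N * (\<Sum>p\<in>{p\<in>?P. N dvd L p}. prod5 w p)"
    using N X by (intro sum_sum_ee) auto
  also have "{p\<in>?P. N dvd L p} = sols N c X"
    by (auto simp: sols_def c L_def add.assoc)
  finally show ?thesis .
qed

section \<open>Stability of the five-variable count under a Fourier multiplier\<close>

lemma mult4_le:
  fixes a b c d :: real
  assumes "a \<ge> 0" "b \<ge> 0" "c \<ge> 0" "d \<ge> 0"
  shows "a * (b * (c * d)) \<le> (a ^ 4 + b ^ 4 + c ^ 4 + d ^ 4) / 4"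
proof -
  have sq: "x * y \<le> (x\<^sup>2 + y\<^sup>2) / 2" for x y :: real
    using zero_le_power2[of "x - y"] by (simp add: power2_diff)
  have "(a * b) * (c * d) \<le> ((a * b)\<^sup>2 + (c * d)\<^sup>2) / 2" by (rule sq)
  moreover have "a\<^sup>2 * b\<^sup>2 \<le> ((a\<^sup>2)\<^sup>2 + (b\<^sup>2)\<^sup>2) / 2" "c\<^sup>2 * d\<^sup>2 \<le> ((c\<^sup>2)\<^sup>2 + (d\<^sup>2)\<^sup>2) / 2" by (rule sq)+
  ultimately show ?thesis
    by (simp add: power_mult_distrib mult.assoc flip: power_mult)
qed

lemma one_minus_mult_le:
  fixes x y :: real
  assumes "0 \<le> x" "x \<le> 1" "0 \<le> y" "y \<le> 1"
  shows "1 - x * y \<le> (1 - x) + (1 - y)"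
  using mult_nonneg_nonneg[of "1 - x" "1 - y"] assms by (simp add: algebra_simps)

text \<open>The defect of a product is at most the sum of the defects 1 - mi. Each defect is paired
  with its own ti, which costs \<epsilon>; the other four factors go into fourth powers by the
  inequality of arithmetic and geometric means.\<close>

lemma mult5_diff_le:
  fixes t1 t2 t3 t4 t5 m1 m2 m3 m4 m5 \<epsilon> :: real
  assumes t: "t1 \<ge> 0" "t2 \<ge> 0" "t3 \<ge> 0" "t4 \<ge> 0" "t5 \<ge> 0"
    and m: "m1 \<in> {0..1}" "m2 \<in> {0..1}" "m3 \<in> {0..1}" "m4 \<in> {0..1}" "m5 \<in> {0..1}"
    and e: "t1 * (1 - m1) \<le> \<epsilon>" "t2 * (1 - m2) \<le> \<epsilon>" "t3 * (1 - m3) \<le> \<epsilon>" "t4 * (1 - m4) \<le> \<epsilon>" "t5 * (1 - m5) \<le> \<epsilon>"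
  shows "t1 * (t2 * (t3 * (t4 * t5))) * (1 - m1 * (m2 * (m3 * (m4 * m5))))
     \<le> \<epsilon> * (t1 ^ 4 + t2 ^ 4 + t3 ^ 4 + t4 ^ 4 + t5 ^ 4)"
proof -
  have "0 \<le> t1 * (1 - m1)" using t m by (intro mult_nonneg_nonneg) auto
  then have \<epsilon>: "\<epsilon> \<ge> 0" using e(1) by linarith
  have "1 - m1 * (m2 * (m3 * (m4 * m5))) \<le> (1 - m1) + (1 - m2 * (m3 * (m4 * m5)))"
    using m by (intro one_minus_mult_le mult_nonneg_nonneg mult_le_one) auto
  moreover have "1 - m2 * (m3 * (m4 * m5)) \<le> (1 - m2) + (1 - m3 * (m4 * m5))"
    using m by (intro one_minus_mult_le mult_nonneg_nonneg mult_le_one) auto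
  moreover have "1 - m3 * (m4 * m5) \<le> (1 - m3) + (1 - m4 * m5)"
    using m by (intro one_minus_mult_le mult_nonneg_nonneg mult_le_one) auto
  moreover have "1 - m4 * m5 \<le> (1 - m4) + (1 - m5)"
    using m by (intro one_minus_mult_le) auto
  ultimately have "1 - m1 * (m2 * (m3 * (m4 * m5))) \<le> (1 - m1) + (1 - m2) + (1 - m3) + (1 - m4) + (1 - m5)"
    by linarith
  then have "t1 * (t2 * (t3 * (t4 * t5))) * (1 - m1 * (m2 * (m3 * (m4 * m5))))
     \<le> t1 * (t2 * (t3 * (t4 * t5))) * ((1 - m1) + (1 - m2) + (1 - m3) + (1 - m4) + (1 - m5))"
    using t by (intro mult_left_mono) auto
  also have "\<dots> = (t1 * (1 - m1)) * (t2 * (t3 * (t4 * t5))) + (t2 * (1 - m2)) * (t1 * (t3 * (t4 * t5)))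
     + (t3 * (1 - m3)) * (t1 * (t2 * (t4 * t5))) + (t4 * (1 - m4)) * (t1 * (t2 * (t3 * t5)))
     + (t5 * (1 - m5)) * (t1 * (t2 * (t3 * t4)))"
    by (simp only: distrib_left mult_ac)
  also have "\<dots> \<le> \<epsilon> * ((t2 ^ 4 + t3 ^ 4 + t4 ^ 4 + t5 ^ 4) / 4) + \<epsilon> * ((t1 ^ 4 + t3 ^ 4 + t4 ^ 4 + t5 ^ 4) / 4)
     + \<epsilon> * ((t1 ^ 4 + t2 ^ 4 + t4 ^ 4 + t5 ^ 4) / 4) + \<epsilon> * ((t1 ^ 4 + t2 ^ 4 + t3 ^ 4 + t5 ^ 4) / 4)
     + \<epsilon> * ((t1 ^ 4 + t2 ^ 4 + t3 ^ 4 + t4 ^ 4) / 4)"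
    using t e \<epsilon> by (intro add_mono mult_mono mult4_le mult_nonneg_nonneg) auto
  also have "\<dots> = \<epsilon> * (t1 ^ 4 + t2 ^ 4 + t3 ^ 4 + t4 ^ 4 + t5 ^ 4)" by (simp add: field_simps)
  finally show ?thesis .
qed

definition coprime5 :: "int \<Rightarrow> (int \<times> int \<times> int \<times> int \<times> int) \<Rightarrow> bool" where
  "coprime5 N = (\<lambda>(c1, c2, c3, c4, c5). coprime c1 N \<and> coprime c2 N \<and> coprime c3 N \<and> coprime c4 N \<and> coprime c5 N)"

text \<open>The pointwise bound is summed over \<open>r\<close>; each of the five dilated fourth
  moments equals the undilated one, whence the factor 5.\<close>

lemma norm_sum_prod5_diff_le:
  fixes f :: "int \<Rightarrow> complex"
  assumes N: "N > 0" and c: "coprime5 N c"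
    and per: "\<And>r. f (r mod N) = f r" and m: "\<And>r. m r \<in> {0..1}"
    and e: "\<And>r. cmod (f r) * (1 - m r) \<le> \<epsilon>"
    and K: "(\<Sum>r\<in>{0..<N}. cmod (f r) ^ 4) \<le> K"
  shows "cmod ((\<Sum>r\<in>{0..<N}. prod5 f (dil5 c r)) - (\<Sum>r\<in>{0..<N}. prod5 (\<lambda>s. f s * of_real (m s)) (dil5 c r)))
     \<le> 5 * \<epsilon> * K"
proof -
  obtain c1 c2 c3 c4 c5 where cc: "c = (c1, c2, c3, c4, c5)" by (metis prod.collapse)
  let ?Z = "{0..<N}"
  have "0 \<le> cmod (f 0) * (1 - m 0)" using m[of 0] by (intro mult_nonneg_nonneg) auto
  then have \<epsilon>: "\<epsilon> \<ge> 0" using e[of 0] by linarith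
  have "cmod (prod5 f (dil5 c r) - prod5 (\<lambda>s. f s * of_real (m s)) (dil5 c r))
      \<le> \<epsilon> * (cmod (f (c1 * r)) ^ 4 + cmod (f (c2 * r)) ^ 4 + cmod (f (c3 * r)) ^ 4
           + cmod (f (c4 * r)) ^ 4 + cmod (f (c5 * r)) ^ 4)" (is "_ \<le> ?R") for r
  proof -
    let ?m = "m (c1 * r) * (m (c2 * r) * (m (c3 * r) * (m (c4 * r) * m (c5 * r))))"
    have "prod5 f (dil5 c r) - prod5 (\<lambda>s. f s * of_real (m s)) (dil5 c r)
       = f (c1 * r) * (f (c2 * r) * (f (c3 * r) * (f (c4 * r) * f (c5 * r)))) * of_real (1 - ?m)"
      by (simp add: cc dil5_def prod5_def right_diff_distrib mult_ac)
    moreover have "?m \<le> 1"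
      using m by (intro mult_le_one mult_nonneg_nonneg) auto
    ultimately have "cmod (prod5 f (dil5 c r) - prod5 (\<lambda>s. f s * of_real (m s)) (dil5 c r))
       = cmod (f (c1 * r)) * (cmod (f (c2 * r)) * (cmod (f (c3 * r)) * (cmod (f (c4 * r)) * cmod (f (c5 * r))))) * (1 - ?m)"
      by (simp only: norm_mult norm_of_real)
    also have "\<dots> \<le> ?R"
      by (rule mult5_diff_le) (use m e in auto)
    finally show ?thesis .
  qed
  then have "cmod (\<Sum>r\<in>?Z. prod5 f (dil5 c r) - prod5 (\<lambda>s. f s * of_real (m s)) (dil5 c r))
     \<le> (\<Sum>r\<in>?Z. \<epsilon> * (cmod (f (c1 * r)) ^ 4 + cmod (f (c2 * r)) ^ 4 + cmod (f (c3 * r)) ^ 4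
           + cmod (f (c4 * r)) ^ 4 + cmod (f (c5 * r)) ^ 4))"
    by (intro sum_norm_le) auto
  also have "\<dots> = \<epsilon> * ((\<Sum>r\<in>?Z. cmod (f (c1 * r)) ^ 4) + (\<Sum>r\<in>?Z. cmod (f (c2 * r)) ^ 4)
     + (\<Sum>r\<in>?Z. cmod (f (c3 * r)) ^ 4) + (\<Sum>r\<in>?Z. cmod (f (c4 * r)) ^ 4) + (\<Sum>r\<in>?Z. cmod (f (c5 * r)) ^ 4))"
    by (simp add: sum_distrib_left[symmetric] sum.distrib)
  also have "\<dots> = \<epsilon> * (5 * (\<Sum>r\<in>?Z. cmod (f r) ^ 4))"
  proof -
    have "(\<Sum>r\<in>?Z. cmod (f (k * r)) ^ 4) = (\<Sum>r\<in>?Z. cmod (f r) ^ 4)" if "coprime k N" for k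
      using sum_dilate[OF N that, of "\<lambda>r. cmod (f r) ^ 4"] per by simp
    then show ?thesis using c by (simp add: coprime5_def cc)
  qed
  also have "\<dots> \<le> \<epsilon> * (5 * K)" using K \<epsilon> by (intro mult_left_mono) auto
  finally show ?thesis by (simp add: sum_subtractf mult_ac)
qed

section \<open>Many solutions for an almost invariant function\<close>

lemma card_deviation_le:
  fixes f :: "int \<Rightarrow> real"
  assumes Z: "finite Z" and le: "(\<Sum>x\<in>Z. (f x)\<^sup>2) \<le> C" and t: "t > 0"
  shows "real (card {x\<in>Z. t < \<bar>f x\<bar>}) \<le> C / t\<^sup>2"
proof -
  have "real (card {x\<in>Z. t < \<bar>f x\<bar>}) * t\<^sup>2 = (\<Sum>x\<in>{x\<in>Z. t < \<bar>f x\<bar>}. t\<^sup>2)" by simp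
  also have "\<dots> \<le> (\<Sum>x\<in>{x\<in>Z. t < \<bar>f x\<bar>}. (f x)\<^sup>2)"
  proof (rule sum_mono)
    fix x assume "x \<in> {x\<in>Z. t < \<bar>f x\<bar>}"
    then have "t\<^sup>2 \<le> \<bar>f x\<bar>\<^sup>2" using t by (intro power_mono) auto
    then show "t\<^sup>2 \<le> (f x)\<^sup>2" by simp
  qed
  also have "\<dots> \<le> (\<Sum>x\<in>Z. (f x)\<^sup>2)" using Z by (intro sum_mono2) auto
  finally show ?thesis using le t by (simp add: field_simps)
qed

text \<open>Values below 1/2 carry at most half of the mass, so the large values carry at least N /
  2; Cauchy-Schwarz against the second moment bounds their number from below.\<close>

lemma card_large_values_ge:
  fixes g :: "int \<Rightarrow> real"
  assumes N: "N > 0" and s1: "(\<Sum>x\<in>{0..<N}. g x) = of_int N"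
    and s2: "(\<Sum>x\<in>{0..<N}. (g x)\<^sup>2) \<le> K * of_int N" and K: "K > 0"
  shows "real (card {x\<in>{0..<N}. g x \<ge> 1/2}) \<ge> of_int N / (4 * K)"
proof -
  let ?Z = "{0..<N}" and ?D = "{x\<in>{0..<N}. g x \<ge> 1/2}"
  define n where "n = real_of_int N"
  have n: "n > 0" using N by (simp add: n_def)
  have fin: "finite ?D" by (rule finite_subset[of _ ?Z]) auto
  have "(\<Sum>x\<in>?Z. g x) = (\<Sum>x\<in>?Z - ?D. g x) + (\<Sum>x\<in>?D. g x)"
    by (rule sum.subset_diff) auto
  moreover have "(\<Sum>x\<in>?Z - ?D. g x) \<le> (\<Sum>x\<in>?Z - ?D. 1/2)" by (intro sum_mono) auto
  moreover have "(\<Sum>x\<in>?Z - ?D. (1/2::real)) \<le> (\<Sum>x\<in>?Z. 1/2)" by (intro sum_mono2) auto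
  ultimately have half: "(\<Sum>x\<in>?D. g x) \<ge> n / 2" using s1 N by (simp add: n_def)
  \<comment> \<open>Cauchy-Schwarz by completing the square; 2 K is the value \<open>g\<close> takes
    on \<open>?D\<close> in the extremal case.\<close>
  have "0 \<le> (\<Sum>x\<in>?D. (g x - 2 * K)\<^sup>2)" by (intro sum_nonneg) auto
  also have "\<dots> = (\<Sum>x\<in>?D. (g x)\<^sup>2) - 4 * K * (\<Sum>x\<in>?D. g x) + 4 * K\<^sup>2 * real (card ?D)"
    by (simp add: power2_diff sum.distrib sum_subtractf sum_distrib_left algebra_simps power_mult_distrib)
  also have "(\<Sum>x\<in>?D. (g x)\<^sup>2) \<le> (\<Sum>x\<in>?Z. (g x)\<^sup>2)" by (intro sum_mono2) auto
  also have "\<dots> \<le> K * n" using s2 by (simp add: n_def)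
  finally have "4 * K * (\<Sum>x\<in>?D. g x) \<le> K * n + 4 * K\<^sup>2 * real (card ?D)" by simp
  moreover have "4 * K * (n / 2) \<le> 4 * K * (\<Sum>x\<in>?D. g x)" using half K by (intro mult_left_mono) auto
  ultimately have "K * n \<le> K * (4 * K * real (card ?D))" by (simp add: power2_eq_square)
  then have "n \<le> 4 * K * real (card ?D)" using K by simp
  then show ?thesis using K by (simp add: n_def field_simps)
qed

text \<open>The shifts \<open>a2 u\<close>, \<open>a3 v - a1 u\<close>, \<open>a4 w - a2 v\<close>, \<open>- a3 w\<close> of a base point parametrize solutions near
  the diagonal.\<close>

lemma sum_prod5_ge:
  fixes g :: "int \<Rightarrow> real"
  assumes N: "N > 0" and a: "coprime a1 N" "coprime a2 N" "coprime a3 N" "coprime a4 N"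
    and g0: "\<And>x. g x \<ge> 0" and per: "\<And>x. g (x mod N) = g x"
    and s1: "(\<Sum>x\<in>{0..<N}. g x) = of_int N"
    and s2: "(\<Sum>x\<in>{0..<N}. (g x)\<^sup>2) \<le> K * of_int N" and K: "K > 0"
    and T: "T \<subseteq> {0..<N}" and \<kappa>: "512 * \<kappa> * K \<le> 1"
    and inv: "\<And>u v w y. u \<in> T \<Longrightarrow> v \<in> T \<Longrightarrow> w \<in> T \<Longrightarrow> y \<in> {a2 * u, a3 * v - a1 * u, a4 * w - a2 * v, - a3 * w} \<Longrightarrow>
        (\<Sum>x\<in>{0..<N}. (g (x + y) - g x)\<^sup>2) \<le> \<kappa> * of_int N"
  shows "(\<Sum>p\<in>sols N (a1, a2, a3, a4, - (a1 + a2 + a3 + a4)) {0..<N}. prod5 g p)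
     \<ge> real (card T) ^ 3 * of_int N / (8192 * K)"
proof -
  let ?Z = "{0..<N}"
  define Y where "Y = (\<lambda>(u, v, w). {a2 * u, a3 * v - a1 * u, a4 * w - a2 * v, - a3 * w})"
  \<comment> \<open>At these base points g is at least 1/2 and no shift changes it by more than 1/4,
    so all five entries have value at least 1/4.\<close>
  define X where "X t = {x\<in>?Z. g x \<ge> 1/2 \<and> (\<forall>y\<in>Y t. \<bar>g (x + y) - g x\<bar> \<le> 1/4)}" for t
  have X_card: "real (card (X t)) \<ge> of_int N / (8 * K)" if t: "t \<in> T \<times> T \<times> T" for t
  proof -
    define E where "E y = {x\<in>?Z. 1/4 < \<bar>g (x + y) - g x\<bar>}" for y
    have finE: "finite (E y)" for y by (rule finite_subset[of _ ?Z]) (auto simp: E_def)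
    have E: "real (card (E y)) \<le> \<kappa> * of_int N / (1/4)\<^sup>2" if "y \<in> Y t" for y
      unfolding E_def using inv t that by (intro card_deviation_le) (auto simp: Y_def)
    have finX: "finite (X t)" by (rule finite_subset[of _ ?Z]) (auto simp: X_def)
    obtain u v w where tt: "t = (u, v, w)" by (metis prod.collapse)
    have Yt: "Y t = {a2 * u, a3 * v - a1 * u, a4 * w - a2 * v, - a3 * w}" by (simp add: tt Y_def)
    let ?U = "E (a2 * u) \<union> (E (a3 * v - a1 * u) \<union> (E (a4 * w - a2 * v) \<union> E (- a3 * w)))"
    have "{x\<in>?Z. g x \<ge> 1/2} \<subseteq> X t \<union> ?U"
      by (auto simp: X_def Yt E_def)
    then have "card {x\<in>?Z. g x \<ge> 1/2} \<le> card (X t \<union> ?U)"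
      using finX finE by (intro card_mono) auto
    also have "\<dots> \<le> card (X t) + (card (E (a2 * u)) + (card (E (a3 * v - a1 * u)) + (card (E (a4 * w - a2 * v)) + card (E (- a3 * w)))))"
      using card_Un_le[of "X t" ?U] card_Un_le[of "E (a2 * u)" "E (a3 * v - a1 * u) \<union> (E (a4 * w - a2 * v) \<union> E (- a3 * w))"]
        card_Un_le[of "E (a3 * v - a1 * u)" "E (a4 * w - a2 * v) \<union> E (- a3 * w)"]
        card_Un_le[of "E (a4 * w - a2 * v)" "E (- a3 * w)"]
      by linarith
    finally have "real (card {x\<in>?Z. g x \<ge> 1/2}) \<le> real (card (X t)) + (real (card (E (a2 * u))) + (real (card (E (a3 * v - a1 * u)))
         + (real (card (E (a4 * w - a2 * v))) + real (card (E (- a3 * w))))))" by linarith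
    also have "\<dots> \<le> real (card (X t)) + (\<kappa> * of_int N / (1/4)\<^sup>2 + (\<kappa> * of_int N / (1/4)\<^sup>2 + (\<kappa> * of_int N / (1/4)\<^sup>2 + \<kappa> * of_int N / (1/4)\<^sup>2)))"
      by (intro add_mono E order_refl) (auto simp: Yt)
    \<comment> \<open>Four shifts, each with an exceptional set of size at most 16 \<kappa> N; the
      condition on \<kappa> makes this at most half of the N / (4 K) large values.\<close>
    also have "\<dots> = real (card (X t)) + 64 * \<kappa> * of_int N" by (simp add: power2_eq_square)
    finally have "of_int N / (4 * K) \<le> real (card (X t)) + 64 * \<kappa> * of_int N"
      using card_large_values_ge[OF N s1 s2 K] by linarith
    moreover have "64 * \<kappa> * of_int N \<le> of_int N / (8 * K)"
    proof -
      have "64 * \<kappa> \<le> 1 / (8 * K)" using \<kappa> K by (simp add: field_simps)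
      then have "64 * \<kappa> * of_int N \<le> 1 / (8 * K) * of_int N" using N by (intro mult_right_mono) auto
      then show ?thesis by simp
    qed
    moreover have "of_int N / (4 * K) = of_int N / (8 * K) + of_int N / (8 * K)" by simp
    ultimately show ?thesis by linarith
  qed
  define \<Phi> where "\<Phi> = (\<lambda>((u, v, w), x). ((x + a2 * u) mod N, (x + (a3 * v - a1 * u)) mod N,
      (x + (a4 * w - a2 * v)) mod N, (x + (- a3 * w)) mod N, x))"
  define S where "S = Sigma (T \<times> T \<times> T) X"
  have finT: "finite T" using T finite_subset by blast
  have finS: "finite S" unfolding S_def
    using finT by (intro finite_SigmaI) (auto simp: X_def intro: finite_subset[of _ ?Z])
  have inj: "inj_on \<Phi> S"
  proof (rule inj_onI)
    fix p q assume p: "p \<in> S" and q: "q \<in> S" and e: "\<Phi> p = \<Phi> q"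
    obtain u v w x where P: "p = ((u, v, w), x)" by (metis prod.collapse)
    obtain u' v' w' x' where Q: "q = ((u', v', w'), x')" by (metis prod.collapse)
    have in_Z: "u \<in> ?Z" "v \<in> ?Z" "w \<in> ?Z" "u' \<in> ?Z" "v' \<in> ?Z" "w' \<in> ?Z"
      using p q T by (auto simp: P Q S_def)
    have x: "x' = x" using e by (simp add: \<Phi>_def P Q)
    have cancel: "y = y'" if "coprime k N" "N dvd k * y - k * y'" "y \<in> ?Z" "y' \<in> ?Z" for k y y'
    proof -
      have "N dvd k * (y - y')" using that by (simp add: right_diff_distrib)
      then have "N dvd y - y'" using that by (simp add: coprime_dvd_mult_right_iff coprime_commute)
      then show ?thesis using that dvd_diff_imp_eq by blast
    qed
    \<comment> \<open>The first three coordinates give back u, v and w in turn, because a2, a3 and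
      a4 are units modulo \<open>N\<close>.\<close>
    have "N dvd a2 * u - a2 * u'" using e by (simp add: \<Phi>_def P Q x mod_eq_dvd_iff)
    then have u: "u = u'" using cancel a in_Z by blast
    have "N dvd a3 * v - a3 * v'" using e by (simp add: \<Phi>_def P Q x u mod_eq_dvd_iff)
    then have v: "v = v'" using cancel a in_Z by blast
    have "N dvd a4 * w - a4 * w'" using e by (simp add: \<Phi>_def P Q x v mod_eq_dvd_iff)
    then have w: "w = w'" using cancel a in_Z by blast
    show "p = q" by (simp add: P Q u v w x)
  qed
  have im: "\<Phi> ` S \<subseteq> sols N (a1, a2, a3, a4, - (a1 + a2 + a3 + a4)) ?Z"
  proof (rule image_subsetI)
    fix p assume p: "p \<in> S"
    obtain u v w x where P: "p = ((u, v, w), x)" by (metis prod.collapse)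
    have md: "N dvd k * (y mod N) - k * y" for k y :: int
      by (simp add: mod_eq_dvd_iff[symmetric] mod_mult_right_eq)
    \<comment> \<open>Weighted by a1, ..., a4 the four shifts telescope to 0, so only the reductions
      modulo \<open>N\<close> remain to be checked.\<close>
    have "N dvd (a1 * ((x + a2 * u) mod N) - a1 * (x + a2 * u)) +
       (a2 * ((x + (a3 * v - a1 * u)) mod N) - a2 * (x + (a3 * v - a1 * u))) +
       (a3 * ((x + (a4 * w - a2 * v)) mod N) - a3 * (x + (a4 * w - a2 * v))) +
       (a4 * ((x + (- a3 * w)) mod N) - a4 * (x + (- a3 * w)))"
      by (intro dvd_add md)
    also have "\<dots> = a1 * ((x + a2 * u) mod N) + a2 * ((x + (a3 * v - a1 * u)) mod N)
       + a3 * ((x + (a4 * w - a2 * v)) mod N) + a4 * ((x + (- a3 * w)) mod N) + - (a1 + a2 + a3 + a4) * x"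
      by (simp add: algebra_simps)
    finally show "\<Phi> p \<in> sols N (a1, a2, a3, a4, - (a1 + a2 + a3 + a4)) ?Z"
      using p N by (auto simp: P \<Phi>_def sols_def S_def X_def)
  qed
  have low: "prod5 g (\<Phi> p) \<ge> 1 / 1024" if p: "p \<in> S" for p
  proof -
    obtain u v w x where P: "p = ((u, v, w), x)" by (metis prod.collapse)
    have "g x \<ge> 1/2" "\<forall>y\<in>Y (u, v, w). \<bar>g (x + y) - g x\<bar> \<le> 1/4"
      using p by (auto simp: P S_def X_def)
    then have ge: "g (x + y) \<ge> 1/4" if "y \<in> Y (u, v, w)" for y
      using that bspec[of "Y (u, v, w)" "\<lambda>y. \<bar>g (x + y) - g x\<bar> \<le> 1/4" y] by linarith
    have "g (x + a2 * u) * (g (x + (a3 * v - a1 * u)) * (g (x + (a4 * w - a2 * v)) * (g (x + (- a3 * w)) * g x)))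
       \<ge> 1/4 * (1/4 * (1/4 * (1/4 * (1/4))))"
      using \<open>g x \<ge> 1/2\<close> by (intro mult_mono ge mult_nonneg_nonneg g0) (auto simp: Y_def)
    then show ?thesis by (simp add: P \<Phi>_def prod5_def per)
  qed
  \<comment> \<open>8192 = 8 * 1024: density 1 / (8 K) of base points for each triple, and weight
    (1/4)^5 for each solution.\<close>
  have "real (card T) ^ 3 * of_int N / (8192 * K) = (\<Sum>t\<in>T \<times> T \<times> T. of_int N / (8 * K)) * (1 / 1024)"
    by (simp add: card_cartesian_product power3_eq_cube)
  also have "\<dots> \<le> (\<Sum>t\<in>T \<times> T \<times> T. real (card (X t))) * (1 / 1024)"
    by (intro mult_right_mono sum_mono X_card) auto
  also have "(\<Sum>t\<in>T \<times> T \<times> T. real (card (X t))) = real (card S)"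
    unfolding S_def using finT by (subst card_SigmaI) (auto simp: X_def intro: finite_subset[of _ ?Z])
  also have "real (card S) * (1 / 1024) = (\<Sum>p\<in>S. 1 / 1024)" by simp
  also have "\<dots> \<le> (\<Sum>p\<in>S. prod5 g (\<Phi> p))" by (intro sum_mono low)
  also have "\<dots> = (\<Sum>p\<in>\<Phi> ` S. prod5 g p)" using inj by (simp add: sum.reindex)
  also have "\<dots> \<le> (\<Sum>p\<in>sols N (a1, a2, a3, a4, - (a1 + a2 + a3 + a4)) ?Z. prod5 g p)"
    using im g0 by (intro sum_mono2 finite_sols) (auto simp: prod5_def split_def intro!: mult_nonneg_nonneg)
  finally show ?thesis .
qed

section \<open>Energy increment\<close>

text \<open>By Parseval this is the mean square of the smoothing of \<open>A\<close> along
  \<open>B\<close>.\<close>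

definition energy :: "int \<Rightarrow> int set \<Rightarrow> int set \<Rightarrow> real" where
  "energy N A B = (\<Sum>r\<in>{0..<N}. (cmod (mu N A r))\<^sup>2 * (cmod (mu N B r)) ^ 4)"

lemma sum_translate:
  fixes h :: "int \<Rightarrow> real"
  assumes N: "N > 0" and h: "\<And>x. h (x mod N) = h x"
  shows "(\<Sum>x\<in>{0..<N}. h (x + y)) = (\<Sum>x\<in>{0..<N}. h x)"
proof -
  have "(\<Sum>x\<in>{0..<N}. h ((x + y) mod N)) = (\<Sum>x\<in>{0..<N}. h x)"
    by (rule sum.reindex_bij_witness[of _ "\<lambda>x. (x - y) mod N" "\<lambda>x. (x + y) mod N"])
       (use N in \<open>auto simp: mod_simps\<close>)
  then show ?thesis by (simp add: h)
qed

lemma cmod_power4_le: "cmod (mu N B r) ^ 4 \<le> (cmod (mu N B r))\<^sup>2"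
  by (rule power_decreasing) (auto simp: norm_mu_le_1)

lemma energy_le_sum_square:
  "energy N A B \<le> (\<Sum>r\<in>{0..<N}. (cmod (mu N A r))\<^sup>2 * (cmod (mu N B r))\<^sup>2)"
  unfolding energy_def by (intro sum_mono mult_left_mono cmod_power4_le) auto

text \<open>Where \<open>mu B\<close> is not small, \<open>mu C\<close> is close to 1, so the multiplier essentially only increases from \<open>B\<close>
  to \<open>C\<close>.\<close>

lemma square_diff_le_energy_diff:
  assumes \<rho>: "0 < \<rho>" "\<rho> \<le> 1"
    and BC: "\<And>r. r \<in> {0..<N} \<Longrightarrow> cmod (mu N B r) \<ge> \<rho> \<Longrightarrow> cmod (mu N C r - 1) \<le> \<rho>"
    and K: "(\<Sum>r\<in>{0..<N}. (cmod (mu N A r))\<^sup>2 * (cmod (mu N B r))\<^sup>2) \<le> K"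
  shows "(\<Sum>r\<in>{0..<N}. (cmod (mu N A r))\<^sup>2 * ((cmod (mu N C r))\<^sup>2 - (cmod (mu N B r))\<^sup>2)\<^sup>2)
     \<le> energy N A C - energy N A B + 4 * \<rho> * K"
proof -
  let ?Z = "{0..<N}"
  let ?a = "\<lambda>r. (cmod (mu N A r))\<^sup>2" and ?b = "\<lambda>r. (cmod (mu N B r))\<^sup>2" and ?c = "\<lambda>r. (cmod (mu N C r))\<^sup>2"
  have pt: "(?c r - ?b r)\<^sup>2 \<le> cmod (mu N C r) ^ 4 - cmod (mu N B r) ^ 4 + 4 * \<rho> * ?b r" if r: "r \<in> ?Z" for r
  proof -
    define x y where "x = ?c r" and "y = ?b r"
    have xy: "0 \<le> x" "0 \<le> y" "y \<le> 1"
      by (auto simp: x_def y_def norm_mu_le_1 power_le_one)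
    have "y - x \<le> 2 * \<rho>"
    proof (cases "cmod (mu N B r) \<ge> \<rho>")
      case True
      have "1 - cmod (mu N C r) \<le> cmod (1 - mu N C r)"
        using norm_triangle_ineq2[of 1 "mu N C r"] by simp
      also have "\<dots> \<le> \<rho>" using BC[OF r True] by (simp add: norm_minus_commute)
      finally have "1 - \<rho> \<le> cmod (mu N C r)" by simp
      then have "(1 - \<rho>)\<^sup>2 \<le> x" unfolding x_def using \<rho> by (intro power_mono) auto
      moreover have "(1 - \<rho>)\<^sup>2 \<ge> 1 - 2 * \<rho>" by (simp add: power2_diff)
      ultimately show ?thesis using xy by linarith
    next
      case False
      then have "y \<le> \<rho>\<^sup>2" unfolding y_def by (intro power_mono) auto
      also have "\<dots> \<le> \<rho>" using \<rho> by (simp add: power2_eq_square mult_left_le)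
      finally show ?thesis using xy \<rho> by linarith
    qed
    \<comment> \<open>(x - y)^2 = x^2 - y^2 + 2 y (y - x), so an upper bound on the possible
      decrease y - x is all that is needed.\<close>
    then have "y * (y - x) \<le> y * (2 * \<rho>)" using xy by (intro mult_left_mono) auto
    then have "(x - y)\<^sup>2 \<le> x\<^sup>2 - y\<^sup>2 + 4 * \<rho> * y"
      by (simp add: power2_eq_square algebra_simps)
    then show ?thesis by (simp add: x_def y_def flip: power_mult)
  qed
  have "(\<Sum>r\<in>?Z. ?a r * (?c r - ?b r)\<^sup>2)
     \<le> (\<Sum>r\<in>?Z. ?a r * (cmod (mu N C r) ^ 4 - cmod (mu N B r) ^ 4 + 4 * \<rho> * ?b r))"
    by (intro sum_mono mult_left_mono pt) auto
  also have "\<dots> = energy N A C - energy N A B + 4 * \<rho> * (\<Sum>r\<in>?Z. ?a r * ?b r)"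
    by (simp add: energy_def distrib_left right_diff_distrib sum.distrib sum_subtractf sum_distrib_left mult_ac)
  also have "\<dots> \<le> energy N A C - energy N A B + 4 * \<rho> * K"
    using K \<rho> by (intro add_left_mono mult_left_mono) auto
  finally show ?thesis .
qed

text \<open>At each frequency one of two factors is small: either |mu B| is below \<rho>, or the
  character is within \<rho> of 1 at the shift. One factor |mu B|^2 is kept, to be summed against
  |mu A|^2.\<close>

lemma sum_shift_le:
  assumes \<rho>: "0 < \<rho>" "\<rho> \<le> 1"
    and y: "\<And>r. r \<in> {0..<N} \<Longrightarrow> cmod (mu N B r) \<ge> \<rho> \<Longrightarrow> cmod (ee N (r * y) - 1) \<le> \<rho>"
    and K: "(\<Sum>r\<in>{0..<N}. (cmod (mu N A r))\<^sup>2 * (cmod (mu N B r))\<^sup>2) \<le> K"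
  shows "(\<Sum>r\<in>{0..<N}. (cmod (mu N A r))\<^sup>2 * (cmod (mu N B r)) ^ 4 * (cmod (ee N (r * y) - 1))\<^sup>2) \<le> 4 * \<rho> * K"
proof -
  let ?Z = "{0..<N}"
  have \<rho>2: "\<rho>\<^sup>2 \<le> \<rho>" using \<rho> by (simp add: power2_eq_square mult_left_le)
  have pt: "(cmod (mu N B r)) ^ 4 * (cmod (ee N (r * y) - 1))\<^sup>2 \<le> 4 * \<rho> * (cmod (mu N B r))\<^sup>2"
    if r: "r \<in> ?Z" for r
  proof (cases "cmod (mu N B r) \<ge> \<rho>")
    case True
    have "(cmod (ee N (r * y) - 1))\<^sup>2 \<le> \<rho>\<^sup>2" using y[OF r True] by (intro power_mono) auto
    also have "\<dots> \<le> 4 * \<rho>" using \<rho>2 \<rho> by linarith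
    finally have "(cmod (mu N B r)) ^ 4 * (cmod (ee N (r * y) - 1))\<^sup>2 \<le> (cmod (mu N B r))\<^sup>2 * (4 * \<rho>)"
      using \<rho> by (intro mult_mono cmod_power4_le) auto
    then show ?thesis by (simp add: mult_ac)
  next
    case False
    have "cmod (ee N (r * y) - 1) \<le> 2"
      using norm_triangle_ineq4[of "ee N (r * y)" 1] by simp
    then have "(cmod (ee N (r * y) - 1))\<^sup>2 \<le> 2\<^sup>2" by (intro power_mono) auto
    moreover have "(cmod (mu N B r))\<^sup>2 \<le> \<rho>"
      using False power_mono[of "cmod (mu N B r)" \<rho> 2] \<rho>2 by simp
    ultimately have "(cmod (mu N B r))\<^sup>2 * (cmod (ee N (r * y) - 1))\<^sup>2 \<le> \<rho> * 4"
      using \<rho> by (intro mult_mono) auto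
    then have "(cmod (mu N B r))\<^sup>2 * ((cmod (mu N B r))\<^sup>2 * (cmod (ee N (r * y) - 1))\<^sup>2) \<le> (cmod (mu N B r))\<^sup>2 * (\<rho> * 4)"
      by (intro mult_left_mono) auto
    then show ?thesis by (simp add: mult_ac power4_eq_xxxx power2_eq_square)
  qed
  have "(\<Sum>r\<in>?Z. (cmod (mu N A r))\<^sup>2 * (cmod (mu N B r)) ^ 4 * (cmod (ee N (r * y) - 1))\<^sup>2)
     \<le> (\<Sum>r\<in>?Z. (cmod (mu N A r))\<^sup>2 * (4 * \<rho> * (cmod (mu N B r))\<^sup>2))"
    unfolding mult.assoc by (intro sum_mono mult_left_mono pt[unfolded mult.assoc]) auto
  also have "\<dots> = 4 * \<rho> * (\<Sum>r\<in>?Z. (cmod (mu N A r))\<^sup>2 * (cmod (mu N B r))\<^sup>2)"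
    by (simp add: sum_distrib_left mult_ac)
  also have "\<dots> \<le> 4 * \<rho> * K" using K \<rho> by (intro mult_left_mono) auto
  finally show ?thesis .
qed

lemma square_sum3_le: "(x + y + z)\<^sup>2 \<le> 3 * (x\<^sup>2 + y\<^sup>2 + (z::real)\<^sup>2)"
proof -
  have "0 \<le> (x - y)\<^sup>2 + (y - z)\<^sup>2 + (x - z)\<^sup>2" by simp
  then show ?thesis by (simp add: power2_eq_square algebra_simps)
qed

text \<open>Go from g(x + y) to h(x + y), to h(x), to g(x). Squaring a sum of three terms costs 3,
  and there are three errors \<open>C\<close>, whence 9.\<close>

lemma sum_shift_square_le:
  fixes g h :: "int \<Rightarrow> real"
  assumes N: "N > 0" and g: "\<And>x. g (x mod N) = g x" and h: "\<And>x. h (x mod N) = h x"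
    and gh: "(\<Sum>x\<in>{0..<N}. (g x - h x)\<^sup>2) \<le> C" and hh: "(\<Sum>x\<in>{0..<N}. (h (x + y) - h x)\<^sup>2) \<le> C"
  shows "(\<Sum>x\<in>{0..<N}. (g (x + y) - g x)\<^sup>2) \<le> 9 * C"
proof -
  have "(g (x + y) - g x)\<^sup>2 \<le> 3 * ((g (x + y) - h (x + y))\<^sup>2 + (h (x + y) - h x)\<^sup>2 + (g x - h x)\<^sup>2)" for x
    using square_sum3_le[of "g (x + y) - h (x + y)" "h (x + y) - h x" "h x - g x"]
    by (simp add: power2_commute[of "h x"])
  then have "(\<Sum>x\<in>{0..<N}. (g (x + y) - g x)\<^sup>2)
     \<le> (\<Sum>x\<in>{0..<N}. 3 * ((g (x + y) - h (x + y))\<^sup>2 + (h (x + y) - h x)\<^sup>2 + (g x - h x)\<^sup>2))"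
    by (intro sum_mono)
  also have "\<dots> = 3 * ((\<Sum>x\<in>{0..<N}. (g (x + y) - h (x + y))\<^sup>2) + (\<Sum>x\<in>{0..<N}. (h (x + y) - h x)\<^sup>2)
      + (\<Sum>x\<in>{0..<N}. (g x - h x)\<^sup>2))"
    by (simp add: sum_distrib_left[symmetric] sum.distrib)
  also have "(\<Sum>x\<in>{0..<N}. (g (x + y) - h (x + y))\<^sup>2) = (\<Sum>x\<in>{0..<N}. (g x - h x)\<^sup>2)"
    using sum_translate[OF N, of "\<lambda>x. (g x - h x)\<^sup>2"] g h by simp
  finally show ?thesis using gh hh by simp
qed

section \<open>One step of the increment: few large frequencies, dense Bohr sets\<close>

lemma card_threshold_le:
  fixes f :: "int \<Rightarrow> real"
  assumes Z: "finite Z" and f: "\<And>x. x \<in> Z \<Longrightarrow> f x \<ge> 0" and le: "(\<Sum>x\<in>Z. f x) \<le> C" and t: "t > 0"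
  shows "card {x\<in>Z. t \<le> f x} \<le> nat \<lceil>C / t\<rceil>"
proof -
  have "real (card {x\<in>Z. t \<le> f x}) * t = (\<Sum>x\<in>{x\<in>Z. t \<le> f x}. t)" by simp
  also have "\<dots> \<le> (\<Sum>x\<in>{x\<in>Z. t \<le> f x}. f x)" by (rule sum_mono) auto
  also have "\<dots> \<le> (\<Sum>x\<in>Z. f x)" using Z f by (intro sum_mono2) auto
  finally have "real (card {x\<in>Z. t \<le> f x}) \<le> C / t" using le t by (simp add: field_simps)
  then show ?thesis by linarith
qed

text \<open>The last condition is 2 N / |A|^2 + 1 \<le> K with denominators cleared. The first
  summand bounds the fourth moment; the 1 leaves room for N / (|A| |B|) in the mixed moment.\<close>

definition dense_sidon :: "real \<Rightarrow> (int \<times> int \<times> int \<times> int \<times> int) \<Rightarrow> int \<Rightarrow> int set \<Rightarrow> bool" where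
  "dense_sidon K c N A \<longleftrightarrow> N > 0 \<and> coprime5 N c \<and> sidon_mod N A \<and> A \<noteq> {} \<and>
     2 * of_int N + (real (card A))\<^sup>2 \<le> K * (real (card A))\<^sup>2"

lemma dense_sidon_finite: "dense_sidon K c N A \<Longrightarrow> finite A"
  unfolding dense_sidon_def sidon_mod_def using finite_subset by blast

lemma dense_sidon_N_le:
  assumes "dense_sidon K c N A"
  shows "2 * of_int N / (real (card A))\<^sup>2 + 1 \<le> K"
proof -
  have "real (card A) > 0"
    using assms dense_sidon_finite[OF assms] by (simp add: dense_sidon_def card_gt_0_iff)
  then show ?thesis using assms by (simp add: dense_sidon_def field_simps)
qed

lemma dense_sidon_sum_power4:
  assumes "dense_sidon K c N A"
  shows "(\<Sum>r\<in>{0..<N}. (cmod (mu N A r)) ^ 4) \<le> K"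
  using sum_mu_power4_sidon[of N A] dense_sidon_N_le[OF assms] assms by (simp add: dense_sidon_def)

text \<open>The two conditions on \<open>L\<close> give N \<le> |A| |B|, so the diagonal term N /
  (|A| |B|) is at most 1. Here \<open>A\<close> has to be large compared with the inverse density of
  \<open>B\<close>.\<close>

lemma dense_sidon_sum_square_mult:
  assumes A: "dense_sidon K c N A" and B: "B \<subseteq> {0..<N}" "B \<noteq> {}"
    and L: "of_int N \<le> L * real (card B)" "L \<le> real (card A)"
  shows "(\<Sum>r\<in>{0..<N}. (cmod (mu N A r))\<^sup>2 * (cmod (mu N B r))\<^sup>2) \<le> K"
proof -
  have N: "N > 0" using A by (simp add: dense_sidon_def)
  have a: "real (card A) > 0"
    using A dense_sidon_finite[OF A] by (simp add: dense_sidon_def card_gt_0_iff)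
  have b: "real (card B) > 0" using B finite_subset[OF B(1)] by (simp add: card_gt_0_iff)
  have "of_int N \<le> real (card A) * real (card B)"
    using L mult_right_mono[OF L(2), of "real (card B)"] by simp
  then have "of_int N / (real (card A) * real (card B)) \<le> 1" using a b by simp
  moreover have "of_int N / (real (card A))\<^sup>2 \<ge> 0" using N by simp
  moreover have "2 * (of_int N / (real (card A))\<^sup>2) + 1 \<le> K" using dense_sidon_N_le[OF A] by simp
  moreover have "(\<Sum>r\<in>{0..<N}. (cmod (mu N A r))\<^sup>2 * (cmod (mu N B r))\<^sup>2)
     \<le> of_int N / (real (card A))\<^sup>2 + of_int N / (real (card A) * real (card B))"
    using A by (intro sum_mu_square_mult_sidon[OF N _ _ B]) (auto simp: dense_sidon_def)
  ultimately show ?thesis by linarith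
qed

lemma bohr_dense:
  assumes N: "N > 0" and R: "finite R" "card R \<le> m" and \<eta>: "\<eta> > 0"
  shows "of_int N \<le> real (nat \<lceil>2 * pi / \<eta>\<rceil> ^ m) * real (card (bohr N R \<eta>))"
proof -
  define k where "k = nat \<lceil>2 * pi / \<eta>\<rceil>"
  have pos: "2 * pi / \<eta> > 0" using \<eta> by simp
  then have k: "k > 0" "2 * pi / \<eta> \<le> real k" unfolding k_def by linarith+
  then have "2 * pi / real k \<le> \<eta>" using \<eta> by (simp add: field_simps)
  then have "nat N \<le> k ^ card R * card (bohr N R \<eta>)" using N R k by (intro card_bohr_ge)
  also have "\<dots> \<le> k ^ m * card (bohr N R \<eta>)" using R k by (intro mult_right_mono power_increasing) auto
  finally have "real (nat N) \<le> real (k ^ m * card (bohr N R \<eta>))" by (rule of_nat_mono)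
  then show ?thesis using N by (simp add: k_def)
qed

lemma prod5_of_real_divide:
  "prod5 (\<lambda>x. complex_of_real (g x / n)) p = complex_of_real (prod5 g p) / complex_of_real n ^ 5"
  by (simp add: prod5_def split_def eval_nat_numeral)

text \<open>The error \<open>\<epsilon>\<close> in replacing \<open>A\<close> by its smoothing along \<open>C\<close> is chosen after the density of the Bohr set \<open>T\<close>
  of almost periods, which depends only on \<open>B\<close>; this is why two scales are compared.\<close>

lemma energy_increment:
  fixes a1 a2 a3 a4 :: int and K L :: real
  defines "c \<equiv> (a1, a2, a3, a4, - (a1 + a2 + a3 + a4))"
  assumes a: "a1 > 0" "a2 > 0" "a3 > 0" "a4 > 0" and K: "K \<ge> 1" and L: "L \<ge> 1"
  shows "\<exists>\<theta>>0. \<exists>L'\<ge>1. \<forall>N A B. dense_sidon K c N A \<longrightarrow> B \<subseteq> {0..<N} \<longrightarrow> B \<noteq> {} \<longrightarrow>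
    of_int N \<le> L * real (card B) \<longrightarrow> L' \<le> real (card A) \<longrightarrow>
    \<theta> * real (card A) ^ 5 \<le> of_int N * real (card (sols N c A)) \<or>
    (\<exists>C\<subseteq>{0..<N}. C \<noteq> {} \<and> of_int N \<le> L' * real (card C) \<and>
       energy N A C \<ge> energy N A B + 1 / (9216 * K))"
proof -
  \<comment> \<open>The diagonal count tolerates 9 \<kappa> with 512 * 9 = 4608. One half of
    \<kappa> is the energy gap, the other half is the error 4 \<rho> K, which fixes \<rho>.\<close>
  define \<kappa> where "\<kappa> = 1 / (4608 * K)"
  define \<rho> where "\<rho> = \<kappa> / (8 * K)"
  define s where "s = a1 + a2 + a3 + a4"
  have s: "real_of_int s > 0" using a by (simp add: s_def)
  have \<kappa>: "\<kappa> > 0" "512 * (9 * \<kappa>) * K \<le> 1" using K by (simp_all add: \<kappa>_def)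
  have \<rho>: "\<rho> > 0" "4 * \<rho> * K = \<kappa> / 2" using \<kappa> K by (simp_all add: \<rho>_def)
  have "\<kappa> \<le> 1" using K by (simp add: \<kappa>_def)
  then have \<rho>1: "\<rho> \<le> 1" using K \<kappa> unfolding \<rho>_def by (simp add: field_simps)
  \<comment> \<open>Parseval and the density of \<open>B\<close> bound the number of frequencies
    with |mu B| \<ge> \<rho>; \<open>M1\<close> then bounds N / |T|.\<close>
  define m1 where "m1 = nat \<lceil>L / \<rho>\<^sup>2\<rceil>"
  define M1 where "M1 = real (nat \<lceil>2 * pi / (\<rho> / real_of_int s)\<rceil> ^ m1)"
  have "2 * pi / (\<rho> / real_of_int s) > 0" using \<rho> s by simp
  then have "nat \<lceil>2 * pi / (\<rho> / real_of_int s)\<rceil> > 0" by linarith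
  then have M1: "M1 > 0" unfolding M1_def by simp
  define \<theta>0 where "\<theta>0 = 1 / (8192 * K * M1 ^ 3)"
  have \<theta>0: "\<theta>0 > 0" using M1 K by (simp add: \<theta>0_def)
  \<comment> \<open>Chosen so that the Fourier error 5 \<epsilon> K is half of the main term
    \<theta>0.\<close>
  define \<epsilon> where "\<epsilon> = \<theta>0 / (10 * K)"
  have \<epsilon>: "\<epsilon> > 0" "5 * \<epsilon> * K = \<theta>0 / 2" using \<theta>0 K by (simp_all add: \<epsilon>_def)
  define m2 where "m2 = nat \<lceil>K / \<epsilon> ^ 4\<rceil>"
  \<comment> \<open>\<rho> serves the comparison of \<open>C\<close> with \<open>B\<close>. For the
    count \<epsilon> / 2 is needed, because the multiplier |mu C|^2 has up to twice the defect of
    |mu C|.\<close>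
  define \<eta> where "\<eta> = min \<rho> (\<epsilon> / 2)"
  have \<eta>: "\<eta> > 0" "\<eta> \<le> \<rho>" "\<eta> \<le> \<epsilon> / 2" using \<rho> \<epsilon> by (auto simp: \<eta>_def)
  define M2 where "M2 = real (nat \<lceil>2 * pi / \<eta>\<rceil> ^ (m1 + m2))"
  \<comment> \<open>The maximum with \<open>L\<close> lets the single condition L' \<le> |A| give
    the mixed moment bound for both \<open>B\<close> and \<open>C\<close>.\<close>
  define L' where "L' = max L M2"
  show ?thesis
  proof (rule exI[of _ "\<theta>0 / 2"], intro exI[of _ L'] conjI allI impI)
    show "\<theta>0 / 2 > 0" using \<theta>0 by simp
    show "L' \<ge> 1" using L by (simp add: L'_def)
    fix N A B
    assume A: "dense_sidon K c N A" and B: "B \<subseteq> {0..<N}" "B \<noteq> {}"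
      and LB: "of_int N \<le> L * real (card B)" and LA: "L' \<le> real (card A)"
    let ?Z = "{0..<N}"
    have N: "N > 0" and cop: "coprime5 N c" and Ane: "A \<noteq> {}"
      using A by (simp_all add: dense_sidon_def)
    have fA: "finite A" using A by (rule dense_sidon_finite)
    have fB: "finite B" using B finite_subset by blast
    have B0: "real (card B) > 0" using B fB by (simp add: card_gt_0_iff)
    have A0: "real (card A) > 0" using Ane fA by (simp add: card_gt_0_iff)
    have N0: "real_of_int N > 0" using N by simp
    define R1 where "R1 = {r\<in>?Z. cmod (mu N B r) \<ge> \<rho>}"
    define R2 where "R2 = {r\<in>?Z. cmod (mu N A r) \<ge> \<epsilon>}"
    have fR: "finite R1" "finite R2" by (auto simp: R1_def R2_def intro: finite_subset[of _ ?Z])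
    have "card R1 \<le> card {r\<in>?Z. \<rho>\<^sup>2 \<le> (cmod (mu N B r))\<^sup>2}"
      using \<rho> by (intro card_mono) (auto simp: R1_def intro: finite_subset[of _ ?Z] power_mono)
    also have "\<dots> \<le> m1" unfolding m1_def
    proof (rule card_threshold_le)
      show "(\<Sum>r\<in>?Z. (cmod (mu N B r))\<^sup>2) \<le> L"
        unfolding sum_mu_square[OF N B] using LB B0 by (simp add: divide_le_eq)
    qed (use \<rho> in auto)
    finally have cR1: "card R1 \<le> m1" .
    have "card R2 \<le> card {r\<in>?Z. \<epsilon> ^ 4 \<le> cmod (mu N A r) ^ 4}"
      using \<epsilon> by (intro card_mono) (auto simp: R2_def intro: finite_subset[of _ ?Z] power_mono)
    also have "\<dots> \<le> m2" unfolding m2_def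
      using dense_sidon_sum_power4[OF A] \<epsilon> by (intro card_threshold_le) auto
    finally have cR2: "card R2 \<le> m2" .
    \<comment> \<open>Every shift in the diagonal count is k t + l t' with t, t' in \<open>T\<close>
      and |k| + |l| \<le> s, so radius \<rho> / s keeps it within \<rho> at the large frequencies of
      \<open>B\<close>.\<close>
    define T where "T = bohr N R1 (\<rho> / real_of_int s)"
    define C where "C = bohr N (R1 \<union> R2) \<eta>"
    have TZ: "T \<subseteq> ?Z" and CZ: "C \<subseteq> ?Z" by (auto simp: T_def C_def bohr_def)
    have Cne: "C \<noteq> {}" using zero_in_bohr[OF N, of \<eta>] \<eta> unfolding C_def by fastforce
    have fC: "finite C" using CZ finite_subset by blast
    have NT: "of_int N \<le> M1 * real (card T)"
      unfolding M1_def T_def using N fR cR1 \<rho> s by (intro bohr_dense) auto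
    have "of_int N \<le> M2 * real (card C)"
      unfolding M2_def C_def using N fR cR1 cR2 \<eta> card_Un_le[of R1 R2] by (intro bohr_dense) auto
    also have "\<dots> \<le> L' * real (card C)" by (intro mult_right_mono) (auto simp: L'_def)
    finally have NC: "of_int N \<le> L' * real (card C)" .
    have C_near: "cmod (mu N C r - 1) \<le> \<eta>" if "r \<in> R1 \<union> R2" for r
      using that fC Cne by (intro norm_mu_minus_1_le) (auto simp: C_def bohr_def)
    have KB: "(\<Sum>r\<in>?Z. (cmod (mu N A r))\<^sup>2 * (cmod (mu N B r))\<^sup>2) \<le> K"
      using A B LB LA by (intro dense_sidon_sum_square_mult) (auto simp: L'_def)
    have KC: "(\<Sum>r\<in>?Z. (cmod (mu N A r))\<^sup>2 * (cmod (mu N C r))\<^sup>2) \<le> K"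
      using A CZ Cne NC LA by (intro dense_sidon_sum_square_mult)
    have step: "(\<Sum>r\<in>?Z. (cmod (mu N A r))\<^sup>2 * ((cmod (mu N C r))\<^sup>2 - (cmod (mu N B r))\<^sup>2)\<^sup>2)
       \<le> energy N A C - energy N A B + \<kappa> / 2"
    proof -
      have "cmod (mu N C r - 1) \<le> \<rho>" if "r \<in> ?Z" "cmod (mu N B r) \<ge> \<rho>" for r
        using C_near[of r] that \<eta> by (simp add: R1_def)
      from square_diff_le_energy_diff[OF \<rho>(1) \<rho>1 this KB] show ?thesis using \<rho>(2) by simp
    qed
    have half: "1 / (9216 * K) = \<kappa> / 2" by (simp add: \<kappa>_def)
    show "\<theta>0 / 2 * real (card A) ^ 5 \<le> of_int N * real (card (sols N c A)) \<or>
      (\<exists>C\<subseteq>?Z. C \<noteq> {} \<and> of_int N \<le> L' * real (card C) \<and> energy N A C \<ge> energy N A B + 1 / (9216 * K))"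
    proof (cases "energy N A C \<ge> energy N A B + 1 / (9216 * K)")
      case True
      then show ?thesis using CZ Cne NC by blast
    next
      case False
      \<comment> \<open>Without an energy gain the fine smoothing \<open>g\<close> is close in mean
        square to the coarse one \<open>h\<close>, and \<open>h\<close> is almost invariant under
        these shifts. Hence \<open>g\<close> is both almost invariant and a good substitute for
        \<open>A\<close> in the count.\<close>
      define g where "g = smoothed N A C"
      define h where "h = smoothed N A B"
      have per: "g (x mod N) = g x" "h (x mod N) = h x" for x
        unfolding g_def h_def by (rule smoothed_periodic, simp add: mod_eq_dvd_iff[symmetric])+
      have "(\<Sum>r\<in>?Z. (cmod (mu N A r))\<^sup>2 * ((cmod (mu N C r))\<^sup>2 - (cmod (mu N B r))\<^sup>2)\<^sup>2) \<le> \<kappa>"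
        using step False half by linarith
      then have gh: "(\<Sum>x\<in>?Z. (g x - h x)\<^sup>2) \<le> \<kappa> * of_int N"
        unfolding g_def h_def sum_smoothed_diff_square[OF N fA fC fB] using N0 by simp
      have inv: "(\<Sum>x\<in>?Z. (g (x + y) - g x)\<^sup>2) \<le> 9 * \<kappa> * of_int N"
        if uvw: "u \<in> T" "v \<in> T" "w \<in> T" and y: "y \<in> {a2 * u, a3 * v - a1 * u, a4 * w - a2 * v, - a3 * w}" for u v w y
      proof -
        have near: "cmod (ee N (r * y) - 1) \<le> \<rho>" if r: "r \<in> ?Z" "cmod (mu N B r) \<ge> \<rho>" for r
        proof -
          have t: "cmod (ee N (r * t) - 1) \<le> \<rho> / real_of_int s" if "t \<in> T" for t
            using that r by (auto simp: T_def bohr_def R1_def)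
          have mlt: "cmod (ee N (k * (r * t)) - 1) \<le> \<bar>real_of_int k\<bar> * (\<rho> / real_of_int s)" if "t \<in> T" for k t
            using norm_ee_mult_minus_1[of N k "r * t"] mult_left_mono[OF t[OF that], of "\<bar>real_of_int k\<bar>"] by simp
          have two: "cmod (ee N (r * (k * t + l * t')) - 1) \<le> \<rho>"
            if "t \<in> T" "t' \<in> T" "\<bar>k\<bar> + \<bar>l\<bar> \<le> s" for k l t t'
          proof -
            have "cmod (ee N (r * (k * t + l * t')) - 1)
               \<le> cmod (ee N (k * (r * t)) - 1) + cmod (ee N (l * (r * t')) - 1)"
              using norm_ee_add_minus_1[of N "k * (r * t)" "l * (r * t')"] by (simp add: algebra_simps)
            also have "\<dots> \<le> \<bar>real_of_int k\<bar> * (\<rho> / real_of_int s) + \<bar>real_of_int l\<bar> * (\<rho> / real_of_int s)"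
              using that by (intro add_mono mlt)
            also have "\<dots> = (\<bar>real_of_int k\<bar> + \<bar>real_of_int l\<bar>) * (\<rho> / real_of_int s)"
              by (simp only: distrib_right)
            also have "\<dots> \<le> real_of_int s * (\<rho> / real_of_int s)"
            proof (rule mult_right_mono)
              show "\<bar>real_of_int k\<bar> + \<bar>real_of_int l\<bar> \<le> real_of_int s" using that(3) by linarith
            qed (use \<rho> s in simp)
            finally show ?thesis using s by simp
          qed
          have "\<exists>k l t t'. t \<in> T \<and> t' \<in> T \<and> \<bar>k\<bar> + \<bar>l\<bar> \<le> s \<and> y = k * t + l * t'"
          proof -
            consider "y = a2 * u" | "y = a3 * v - a1 * u" | "y = a4 * w - a2 * v" | "y = - a3 * w"
              using y by blast
            then show ?thesis
            proof cases
              case 1 then show ?thesis using uvw a by (intro exI[of _ a2] exI[of _ 0] exI[of _ u]) (auto simp: s_def)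
            next
              case 2 then show ?thesis using uvw a
                by (intro exI[of _ a3] exI[of _ "- a1"] exI[of _ v] exI[of _ u]) (auto simp: s_def)
            next
              case 3 then show ?thesis using uvw a
                by (intro exI[of _ a4] exI[of _ "- a2"] exI[of _ w] exI[of _ v]) (auto simp: s_def)
            next
              case 4 then show ?thesis using uvw a by (intro exI[of _ "- a3"] exI[of _ 0] exI[of _ w]) (auto simp: s_def)
            qed
          qed
          then show ?thesis using two by blast
        qed
        have "(\<Sum>r\<in>?Z. (cmod (mu N A r))\<^sup>2 * (cmod (mu N B r)) ^ 4 * (cmod (ee N (r * y) - 1))\<^sup>2) \<le> \<kappa>"
          using sum_shift_le[OF \<rho>(1) \<rho>1 near KB] \<rho>(2) \<kappa> by linarith
        then have "(\<Sum>x\<in>?Z. (h (x + y) - h x)\<^sup>2) \<le> \<kappa> * of_int N"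
          unfolding h_def sum_smoothed_shift_square[OF N fA fB] using N0 by simp
        from sum_shift_square_le[OF N per gh this] show ?thesis by simp
      qed
      have "energy N A C \<le> K" using energy_le_sum_square KC by (rule order_trans)
      then have s2: "(\<Sum>x\<in>?Z. (g x)\<^sup>2) \<le> K * of_int N"
        unfolding g_def sum_smoothed_square[OF N fA fC] energy_def using N0 by simp
      have s1: "(\<Sum>x\<in>?Z. g x) = of_int N"
        unfolding g_def by (rule sum_smoothed[OF N fA Ane fC Cne])
      have "real (card T) ^ 3 * of_int N / (8192 * K) \<le> (\<Sum>p\<in>sols N c ?Z. prod5 g p)"
        unfolding c_def
      proof (rule sum_prod5_ge[OF N _ _ _ _ _ per(1) s1 s2 _ TZ \<kappa>(2) inv])
        show "g x \<ge> 0" for x using N by (simp add: g_def smoothed_nonneg)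
      qed (use cop K in \<open>simp_all add: coprime5_def c_def\<close>)
      moreover have "\<theta>0 * of_int N ^ 4 \<le> real (card T) ^ 3 * of_int N / (8192 * K)"
      proof -
        have "of_int N ^ 3 \<le> (M1 * real (card T)) ^ 3" using NT N by (intro power_mono) auto
        moreover have "0 \<le> of_int N / (8192 * K * M1 ^ 3)" using N K M1 by simp
        ultimately have "of_int N ^ 3 * (of_int N / (8192 * K * M1 ^ 3)) \<le> (M1 * real (card T)) ^ 3 * (of_int N / (8192 * K * M1 ^ 3))"
          by (rule mult_right_mono)
        moreover have "of_int N ^ 3 * (of_int N / (8192 * K * M1 ^ 3)) = \<theta>0 * of_int N ^ 4"
          by (simp add: \<theta>0_def power4_eq_xxxx power3_eq_cube)
        moreover have "(M1 * real (card T)) ^ 3 * (of_int N / (8192 * K * M1 ^ 3)) = real (card T) ^ 3 * of_int N / (8192 * K)"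
          using M1 by (simp add: power_mult_distrib)
        ultimately show ?thesis by linarith
      qed
      ultimately have low: "\<theta>0 * of_int N ^ 4 \<le> (\<Sum>p\<in>sols N c ?Z. prod5 g p)" by linarith
      define m where "m r = (cmod (mu N C r))\<^sup>2" for r
      have m01: "m r \<in> {0..1}" for r by (simp add: m_def norm_mu_le_1 power_le_one)
      have "cmod (mu N A r) * (1 - m r) \<le> \<epsilon>" for r
      \<comment> \<open>Where |mu A| is large, \<open>C\<close> was built to have multiplier near 1;
        elsewhere |mu A| itself is the small factor.\<close>
      proof (cases "cmod (mu N A r) \<ge> \<epsilon>")
        case True
        have "r mod N \<in> R2" using True N by (simp add: R2_def mu_mod)
        then have "cmod (mu N C r - 1) \<le> \<epsilon> / 2" using C_near[of "r mod N"] \<eta> by (simp add: mu_mod)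
        moreover have "1 - cmod (mu N C r) \<le> cmod (mu N C r - 1)"
          using norm_triangle_ineq2[of 1 "mu N C r"] by (simp add: norm_minus_commute)
        ultimately have t: "1 - cmod (mu N C r) \<le> \<epsilon> / 2" by linarith
        have "1 - m r = (1 - cmod (mu N C r)) * (1 + cmod (mu N C r))"
          by (simp add: m_def power2_eq_square algebra_simps)
        also have "\<dots> \<le> (1 - cmod (mu N C r)) * 2"
          using norm_mu_le_1[of N C r] by (intro mult_left_mono) auto
        also have "\<dots> \<le> \<epsilon> / 2 * 2" using t by (intro mult_right_mono) auto
        finally have "1 - m r \<le> \<epsilon>" by simp
        then have "cmod (mu N A r) * (1 - m r) \<le> 1 * \<epsilon>"
          using norm_mu_le_1[of N A r] m01[of r] by (intro mult_mono) auto
        then show ?thesis by simp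
      next
        case False
        then have "cmod (mu N A r) * (1 - m r) \<le> \<epsilon> * 1"
          using m01[of r] \<epsilon> by (intro mult_mono) auto
        then show ?thesis by simp
      qed
      from norm_sum_prod5_diff_le[OF N cop mu_mod m01 this dense_sidon_sum_power4[OF A]]
      have diff: "cmod ((\<Sum>r\<in>?Z. prod5 (mu N A) (dil5 c r)) - (\<Sum>r\<in>?Z. prod5 (\<lambda>s. mu N A s * of_real (m s)) (dil5 c r)))
         \<le> \<theta>0 / 2" using \<epsilon>(2) by simp
      have "(\<Sum>r\<in>?Z. prod5 (\<lambda>s. mu N A s * of_real (m s)) (dil5 c r))
          = of_int N * (\<Sum>p\<in>sols N c ?Z. prod5 (\<lambda>x. complex_of_real (g x / of_int N)) p)"
        using sum_prod5_transform[OF N, of ?Z "\<lambda>x. complex_of_real (g x / of_int N)" c]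
        unfolding g_def smoothed_transform[OF N fA fC] m_def by simp
      also have "\<dots> = complex_of_real ((\<Sum>p\<in>sols N c ?Z. prod5 g p) / of_int N ^ 4)"
        using N0 unfolding prod5_of_real_divide by (simp add: sum_divide_distrib[symmetric] eval_nat_numeral)
      finally have e1: "(\<Sum>r\<in>?Z. prod5 (\<lambda>s. mu N A s * of_real (m s)) (dil5 c r))
          = complex_of_real ((\<Sum>p\<in>sols N c ?Z. prod5 g p) / of_int N ^ 4)" .
      have "mu N A = (\<lambda>s. \<Sum>x\<in>A. complex_of_real (1 / real (card A)) * ee N (s * x))"
        by (rule ext) (simp add: mu_def sum_divide_distrib)
      then have "(\<Sum>r\<in>?Z. prod5 (mu N A) (dil5 c r))
          = of_int N * (\<Sum>p\<in>sols N c A. prod5 (\<lambda>x. complex_of_real (1 / real (card A))) p)"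
        using sum_prod5_transform[OF N fA, of "\<lambda>x. complex_of_real (1 / real (card A))" c] by simp
      also have "\<dots> = complex_of_real (of_int N * real (card (sols N c A)) / real (card A) ^ 5)"
        unfolding prod5_of_real_divide by (simp add: prod5_def split_def sum_divide_distrib[symmetric])
      finally have e2: "(\<Sum>r\<in>?Z. prod5 (mu N A) (dil5 c r))
          = complex_of_real (of_int N * real (card (sols N c A)) / real (card A) ^ 5)" .
      have "\<bar>of_int N * real (card (sols N c A)) / real (card A) ^ 5 - (\<Sum>p\<in>sols N c ?Z. prod5 g p) / of_int N ^ 4\<bar> \<le> \<theta>0 / 2"
        using diff unfolding e1 e2 of_real_diff[symmetric] norm_of_real .
      moreover have "\<theta>0 \<le> (\<Sum>p\<in>sols N c ?Z. prod5 g p) / of_int N ^ 4"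
        using low N0 by (simp add: field_simps)
      ultimately have "\<theta>0 / 2 \<le> of_int N * real (card (sols N c A)) / real (card A) ^ 5" by linarith
      then show ?thesis using A0 by (simp add: field_simps)
    qed
  qed
qed

text \<open>Induction on the number \<open>k\<close> of increments that the bound \<open>K\<close>
  on the energy still permits; for k = 0 one more increment would exceed \<open>K\<close>. \<theta>
  and \<open>M\<close> have to precede \<open>N\<close>, \<open>A\<close> and \<open>B\<close>, and
  each increment trades \<open>L\<close> for a new \<open>L'\<close>, so \<open>L\<close> is
  generalised.\<close>

lemma card_sols_ge_aux:
  fixes a1 a2 a3 a4 :: int and K L :: real
  defines "c \<equiv> (a1, a2, a3, a4, - (a1 + a2 + a3 + a4))"
  assumes a: "a1 > 0" "a2 > 0" "a3 > 0" "a4 > 0" and K: "K \<ge> 1" and L: "L \<ge> 1"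
  shows "\<exists>\<theta>>0. \<exists>M. \<forall>N A B. dense_sidon K c N A \<longrightarrow> B \<subseteq> {0..<N} \<longrightarrow> B \<noteq> {} \<longrightarrow>
    of_int N \<le> L * real (card B) \<longrightarrow> M \<le> real (card A) \<longrightarrow> energy N A B \<ge> K - real k / (9216 * K) \<longrightarrow>
    \<theta> * real (card A) ^ 5 \<le> of_int N * real (card (sols N c A))"
  using L
proof (induction k arbitrary: L)
  case 0
  obtain \<theta> L' where \<theta>: "\<theta> > 0" "L' \<ge> 1" and H: "\<And>N A B. dense_sidon K c N A \<Longrightarrow> B \<subseteq> {0..<N} \<Longrightarrow> B \<noteq> {} \<Longrightarrow>
    of_int N \<le> L * real (card B) \<Longrightarrow> L' \<le> real (card A) \<Longrightarrow>
    \<theta> * real (card A) ^ 5 \<le> of_int N * real (card (sols N c A)) \<or>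
    (\<exists>C\<subseteq>{0..<N}. C \<noteq> {} \<and> of_int N \<le> L' * real (card C) \<and>
       energy N A C \<ge> energy N A B + 1 / (9216 * K))"
    using energy_increment[OF a K 0] unfolding c_def by blast
  show ?case
  proof (rule exI[of _ \<theta>], intro exI[of _ L'] conjI allI impI \<theta>)
    fix N A B
    assume A: "dense_sidon K c N A" and B: "B \<subseteq> {0..<N}" "B \<noteq> {}" "of_int N \<le> L * real (card B)"
      and LA: "L' \<le> real (card A)" and E: "energy N A B \<ge> K - real 0 / (9216 * K)"
    have "False" if C: "C \<subseteq> {0..<N}" "C \<noteq> {}" "of_int N \<le> L' * real (card C)"
       "energy N A C \<ge> energy N A B + 1 / (9216 * K)" for C
    proof -
      have "energy N A C \<le> K"
        using energy_le_sum_square dense_sidon_sum_square_mult[OF A C(1-3) LA] by (rule order_trans)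
      moreover have "1 / (9216 * K) > 0" using K by simp
      ultimately show False using C(4) E by simp
    qed
    then show "\<theta> * real (card A) ^ 5 \<le> of_int N * real (card (sols N c A))"
      using H[OF A B LA] by blast
  qed
next
  case (Suc k)
  obtain \<theta> L' where \<theta>: "\<theta> > 0" "L' \<ge> 1" and H: "\<And>N A B. dense_sidon K c N A \<Longrightarrow> B \<subseteq> {0..<N} \<Longrightarrow> B \<noteq> {} \<Longrightarrow>
    of_int N \<le> L * real (card B) \<Longrightarrow> L' \<le> real (card A) \<Longrightarrow>
    \<theta> * real (card A) ^ 5 \<le> of_int N * real (card (sols N c A)) \<or>
    (\<exists>C\<subseteq>{0..<N}. C \<noteq> {} \<and> of_int N \<le> L' * real (card C) \<and>
       energy N A C \<ge> energy N A B + 1 / (9216 * K))"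
    using energy_increment[OF a K Suc.prems] unfolding c_def by blast
  obtain \<theta>' M where \<theta>': "\<theta>' > 0" and I: "\<And>N A B. dense_sidon K c N A \<Longrightarrow> B \<subseteq> {0..<N} \<Longrightarrow> B \<noteq> {} \<Longrightarrow>
    of_int N \<le> L' * real (card B) \<Longrightarrow> M \<le> real (card A) \<Longrightarrow> energy N A B \<ge> K - real k / (9216 * K) \<Longrightarrow>
    \<theta>' * real (card A) ^ 5 \<le> of_int N * real (card (sols N c A))"
    using Suc.IH[OF \<theta>(2)] by blast
  show ?case
  proof (rule exI[of _ "min \<theta> \<theta>'"], intro exI[of _ "max L' M"] conjI allI impI)
    show "min \<theta> \<theta>' > 0" using \<theta> \<theta>' by simp
    fix N A B
    assume A: "dense_sidon K c N A" and B: "B \<subseteq> {0..<N}" "B \<noteq> {}" "of_int N \<le> L * real (card B)"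
      and LA: "max L' M \<le> real (card A)" and E: "energy N A B \<ge> K - real (Suc k) / (9216 * K)"
    have le: "min \<theta> \<theta>' * real (card A) ^ 5 \<le> \<theta> * real (card A) ^ 5" "min \<theta> \<theta>' * real (card A) ^ 5 \<le> \<theta>' * real (card A) ^ 5"
      by (intro mult_right_mono; simp)+
    have "\<theta>' * real (card A) ^ 5 \<le> of_int N * real (card (sols N c A))"
      if C: "C \<subseteq> {0..<N}" "C \<noteq> {}" "of_int N \<le> L' * real (card C)"
       "energy N A C \<ge> energy N A B + 1 / (9216 * K)" for C
    proof -
      have "real (Suc k) / (9216 * K) = real k / (9216 * K) + 1 / (9216 * K)"
        by (simp add: add_divide_distrib)
      then show ?thesis using I[OF A C(1-3)] C(4) LA E by simp
    qed
    moreover have "L' \<le> real (card A)" using LA by simp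
    ultimately have "\<theta> * real (card A) ^ 5 \<le> of_int N * real (card (sols N c A)) \<or>
        \<theta>' * real (card A) ^ 5 \<le> of_int N * real (card (sols N c A))"
      using H[OF A B] by blast
    then show "min \<theta> \<theta>' * real (card A) ^ 5 \<le> of_int N * real (card (sols N c A))"
      using le by linarith
  qed
qed

text \<open>The iteration starts from the whole residue group, with L = 1 and nothing known about
  its energy but nonnegativity; \<open>k\<close> gains of 1 / (9216 K) use up
  \<open>K\<close>.\<close>

lemma card_sols_ge:
  fixes a1 a2 a3 a4 :: int and K :: real
  defines "c \<equiv> (a1, a2, a3, a4, - (a1 + a2 + a3 + a4))"
  assumes a: "a1 > 0" "a2 > 0" "a3 > 0" "a4 > 0" and K: "K \<ge> 1"
  shows "\<exists>\<theta>>0. \<exists>M. \<forall>N A. dense_sidon K c N A \<longrightarrow> M \<le> real (card A) \<longrightarrow>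
    \<theta> * real (card A) ^ 5 \<le> of_int N * real (card (sols N c A))"
proof -
  define k where "k = nat \<lceil>9216 * K * K\<rceil>"
  have "9216 * K * K \<le> real k" unfolding k_def by linarith
  then have k: "K - real k / (9216 * K) \<le> 0" using K by (simp add: field_simps)
  obtain \<theta> M where "\<theta> > 0" and H: "\<And>N A B. dense_sidon K c N A \<Longrightarrow> B \<subseteq> {0..<N} \<Longrightarrow> B \<noteq> {} \<Longrightarrow>
    of_int N \<le> 1 * real (card B) \<Longrightarrow> M \<le> real (card A) \<Longrightarrow> energy N A B \<ge> K - real k / (9216 * K) \<Longrightarrow>
    \<theta> * real (card A) ^ 5 \<le> of_int N * real (card (sols N c A))"
    using card_sols_ge_aux[OF a K order_refl, of k] unfolding c_def by blast
  show ?thesis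
  proof (rule exI[of _ \<theta>], intro exI[of _ M] conjI allI impI \<open>\<theta> > 0\<close>)
    fix N A assume A: "dense_sidon K c N A" and M: "M \<le> real (card A)"
    have N: "N > 0" using A by (simp add: dense_sidon_def)
    have "energy N A {0..<N} \<ge> 0" unfolding energy_def by (intro sum_nonneg) auto
    then have "energy N A {0..<N} \<ge> K - real k / (9216 * K)" using k by linarith
    from H[OF A _ _ _ M this] show "\<theta> * real (card A) ^ 5 \<le> of_int N * real (card (sols N c A))"
      using N by simp
  qed
qed

section \<open>Degenerate solutions and the upper bound\<close>

lemma sidonD:
  assumes "sidon A" "a \<in> A" "b \<in> A" "c \<in> A" "d \<in> A" "a + b = c + d"
  shows "(a = c \<and> b = d) \<or> (a = d \<and> b = c)"
  using assms unfolding sidon_def by blast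

text \<open>Group the pairs by their common value and use 2 x y \<le> x^2 + y^2 in each group. It
  reduces a four-variable equation to collisions of two binary forms.\<close>

lemma card_collisions_le:
  fixes u :: "'a \<Rightarrow> int" and v :: "'b \<Rightarrow> int"
  assumes P: "finite P" and Q: "finite Q"
  shows "2 * card {(p, q). p \<in> P \<and> q \<in> Q \<and> u p = v q}
    \<le> card {(p, p'). p \<in> P \<and> p' \<in> P \<and> u p = u p'} + card {(q, q'). q \<in> Q \<and> q' \<in> Q \<and> v q = v q'}"
proof -
  define M where "M = u ` P \<union> v ` Q"
  define f where "f m = {p\<in>P. u p = m}" for m
  define g where "g m = {q\<in>Q. v q = m}" for m
  have M: "finite M" using P Q by (simp add: M_def)
  have fin: "finite (f m)" "finite (g m)" for m using P Q by (simp_all add: f_def g_def)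
  have eq: "{(p, q). p \<in> P \<and> q \<in> Q \<and> u p = v q} = (\<Union>m\<in>M. f m \<times> g m)"
    "{(p, p'). p \<in> P \<and> p' \<in> P \<and> u p = u p'} = (\<Union>m\<in>M. f m \<times> f m)"
    "{(q, q'). q \<in> Q \<and> q' \<in> Q \<and> v q = v q'} = (\<Union>m\<in>M. g m \<times> g m)"
    by (auto simp: M_def f_def g_def)
  have "card (\<Union>m\<in>M. f m \<times> g m) = (\<Sum>m\<in>M. card (f m) * card (g m))"
    using M fin by (subst card_UN_disjoint) (auto simp: f_def card_cartesian_product)
  moreover have "card (\<Union>m\<in>M. f m \<times> f m) = (\<Sum>m\<in>M. card (f m) * card (f m))"
    using M fin by (subst card_UN_disjoint) (auto simp: f_def card_cartesian_product)
  moreover have "card (\<Union>m\<in>M. g m \<times> g m) = (\<Sum>m\<in>M. card (g m) * card (g m))"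
    using M fin by (subst card_UN_disjoint) (auto simp: g_def card_cartesian_product)
  moreover have "2 * (x * y) \<le> x * x + y * y" for x y :: nat
    using nat_le_linear[of x y] by (auto simp: le_iff_add algebra_simps)
  then have "(\<Sum>m\<in>M. 2 * (card (f m) * card (g m))) \<le> (\<Sum>m\<in>M. card (f m) * card (f m) + card (g m) * card (g m))"
    by (rule sum_mono)
  ultimately show ?thesis unfolding eq by (simp add: sum_distrib_left sum.distrib)
qed

text \<open>If the first coordinates agree, so do the second ones. Otherwise the two first
  coordinates fix a nonzero difference of the second ones, and the Sidon property determines
  these.\<close>

lemma card_linear_collisions_le:
  assumes A: "sidon A" "finite A" and c: "c1 \<noteq> 0" "c2 \<noteq> 0"
  shows "card {(p, p'). p \<in> A \<times> A \<and> p' \<in> A \<times> A \<and> c1 * fst p + c2 * snd p = c1 * fst p' + c2 * snd p'}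
    \<le> 2 * card A ^ 2"
proof -
  let ?S = "{(p, p'). p \<in> A \<times> A \<and> p' \<in> A \<times> A \<and> c1 * fst p + c2 * snd p = c1 * fst p' + c2 * snd p'}"
  let ?D = "{z\<in>?S. fst (fst z) = fst (snd z)}" and ?O = "{z\<in>?S. fst (fst z) \<noteq> fst (snd z)}"
  have fin: "finite ?S" using A by (auto intro: finite_subset[of _ "(A \<times> A) \<times> (A \<times> A)"])
  have "card ?D \<le> card (A \<times> A)"
    by (rule card_inj_on_le[of fst]) (use A c in \<open>auto simp: inj_on_def\<close>)
  moreover have "card ?O \<le> card (A \<times> A)"
  proof (rule card_inj_on_le[of "\<lambda>z. (fst (fst z), fst (snd z))"])
    show "inj_on (\<lambda>z. (fst (fst z), fst (snd z))) ?O"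
    proof (rule inj_onI)
      fix z z' assume z: "z \<in> ?O" "z' \<in> ?O" and e: "(fst (fst z), fst (snd z)) = (fst (fst z'), fst (snd z'))"
      obtain y1 y2 w1 w2 where Z: "z = ((y1, y2), (w1, w2))" by (metis prod.collapse)
      obtain y2' w2' where Z': "z' = ((y1, y2'), (w1, w2'))" using e Z by (metis fst_conv prod.collapse prod.inject)
      have m: "y2 \<in> A" "w2 \<in> A" "y2' \<in> A" "w2' \<in> A" "y1 \<noteq> w1"
        and e1: "c1 * y1 + c2 * y2 = c1 * w1 + c2 * w2" and e2: "c1 * y1 + c2 * y2' = c1 * w1 + c2 * w2'"
        using z Z Z' by auto
      have "c2 * (y2 + w2') = c2 * (y2' + w2)" using e1 e2 by (simp add: distrib_left)
      then have "y2 + w2' = y2' + w2" using c by simp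
      moreover have "y2 \<noteq> w2" using e1 m c by auto
      ultimately have "y2 = y2' \<and> w2' = w2" using sidonD[OF A(1) m(1) m(4) m(3) m(2)] by blast
      then show "z = z'" using Z Z' by simp
    qed
  qed (use A in auto)
  moreover have "finite ?D" "finite ?O" by (rule finite_subset[OF _ fin], blast)+
  then have "card (?D \<union> ?O) = card ?D + card ?O" by (rule card_Un_disjoint) blast
  moreover have "?D \<union> ?O = ?S" by blast
  ultimately show ?thesis by (simp add: card_cartesian_product power2_eq_square)
qed

definition quad :: "int \<Rightarrow> int \<Rightarrow> int \<Rightarrow> int \<Rightarrow> int set \<Rightarrow> (int \<times> int \<times> int \<times> int) set" where
  "quad c1 c2 c3 c4 A = {(y1, y2, y3, y4). y1 \<in> A \<and> y2 \<in> A \<and> y3 \<in> A \<and> y4 \<in> A \<and>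
     c1 * y1 + c2 * y2 + c3 * y3 + c4 * y4 = 0}"

lemma finite_quad: "finite A \<Longrightarrow> finite (quad c1 c2 c3 c4 A)"
  by (rule finite_subset[of _ "A \<times> A \<times> A \<times> A"]) (auto simp: quad_def)

text \<open>The trivial bound |A|^3 would be of the same order as the main term |A|^5 / N; the Sidon
  property saves the needed factor |A|, whatever the nonzero coefficients.\<close>

lemma card_quad_le:
  assumes A: "sidon A" "finite A" and c: "c1 \<noteq> 0" "c2 \<noteq> 0" "c3 \<noteq> 0" "c4 \<noteq> 0"
  shows "card (quad c1 c2 c3 c4 A) \<le> 2 * card A ^ 2"
proof -
  let ?u = "\<lambda>p. c1 * fst p + c2 * snd p" and ?v = "\<lambda>p. (- c3) * fst p + (- c4) * snd p"
  let ?C = "{(p, q). p \<in> A \<times> A \<and> q \<in> A \<times> A \<and> ?u p = ?v q}"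
  have "card (quad c1 c2 c3 c4 A) \<le> card ?C"
  proof (rule card_inj_on_le[of "\<lambda>(y1, y2, y3, y4). ((y1, y2), (y3, y4))"])
    show "finite ?C" using A by (auto intro: finite_subset[of _ "(A \<times> A) \<times> (A \<times> A)"])
  qed (auto simp: inj_on_def quad_def)
  moreover have "2 * card ?C \<le> 2 * card A ^ 2 + 2 * card A ^ 2"
    using card_collisions_le[of "A \<times> A" "A \<times> A" ?u ?v] A
      card_linear_collisions_le[OF A, of c1 c2] card_linear_collisions_le[OF A, of "- c3" "- c4"] c
    by simp
  ultimately show ?thesis by linarith
qed

text \<open>Each of the ten ways to identify two entries leaves a four-variable equation. Positivity
  keeps every merged coefficient nonzero, including those of the form ai - s, and each case
  contributes at most 2 |A|^2.\<close>

lemma card_sols_avoiding_le: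
  assumes a: "a1 > 0" "a2 > 0" "a3 > 0" "a4 > 0"
    and A: "sidon A" "finite A" "avoids_eq a1 a2 a3 a4 A"
  shows "card {(x1, x2, x3, x4, x5). x1 \<in> A \<and> x2 \<in> A \<and> x3 \<in> A \<and> x4 \<in> A \<and> x5 \<in> A \<and>
     a1 * x1 + a2 * x2 + a3 * x3 + a4 * x4 = (a1 + a2 + a3 + a4) * x5} \<le> 20 * card A ^ 2" (is "card ?S \<le> _")
proof -
  define s where "s = a1 + a2 + a3 + a4"
  define F where "F = [(\<lambda>(y, z, w, t). (y, y, z, w, t)) ` quad (a1 + a2) a3 a4 (- s) A,
    (\<lambda>(y, z, w, t). (y, z, y, w, t)) ` quad (a1 + a3) a2 a4 (- s) A,
    (\<lambda>(y, z, w, t). (y, z, w, y, t)) ` quad (a1 + a4) a2 a3 (- s) A,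
    (\<lambda>(y, z, w, t). (y, z, w, t, y)) ` quad (a1 - s) a2 a3 a4 A,
    (\<lambda>(y, z, w, t). (z, y, y, w, t)) ` quad (a2 + a3) a1 a4 (- s) A,
    (\<lambda>(y, z, w, t). (z, y, w, y, t)) ` quad (a2 + a4) a1 a3 (- s) A,
    (\<lambda>(y, z, w, t). (z, y, w, t, y)) ` quad (a2 - s) a1 a3 a4 A,
    (\<lambda>(y, z, w, t). (z, w, y, y, t)) ` quad (a3 + a4) a1 a2 (- s) A,
    (\<lambda>(y, z, w, t). (z, w, y, t, y)) ` quad (a3 - s) a1 a2 a4 A,
    (\<lambda>(y, z, w, t). (z, w, t, y, y)) ` quad (a4 - s) a1 a2 a3 A]"
  have s: "s \<noteq> 0" "a1 - s \<noteq> 0" "a2 - s \<noteq> 0" "a3 - s \<noteq> 0" "a4 - s \<noteq> 0"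
    "a1 + a2 \<noteq> 0" "a1 + a3 \<noteq> 0" "a1 + a4 \<noteq> 0" "a2 + a3 \<noteq> 0" "a2 + a4 \<noteq> 0" "a3 + a4 \<noteq> 0"
    "a1 \<noteq> 0" "a2 \<noteq> 0" "a3 \<noteq> 0" "a4 \<noteq> 0"
    using a by (auto simp: s_def)
  have fin: "\<forall>X\<in>set F. finite X" using A by (simp add: F_def finite_quad)
  have "card (f ` quad c1 c2 c3 c4 A) \<le> 2 * card A ^ 2"
    if "c1 \<noteq> 0" "c2 \<noteq> 0" "c3 \<noteq> 0" "c4 \<noteq> 0" for f :: "_ \<Rightarrow> int \<times> int \<times> int \<times> int \<times> int" and c1 c2 c3 c4
    using card_image_le[OF finite_quad[OF A(2)], of f c1 c2 c3 c4] card_quad_le[OF A(1,2) that] by linarith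
  then have card: "\<forall>X\<in>set F. card X \<le> 2 * card A ^ 2"
    using s by (simp add: F_def)
  have union: "card (\<Union>(set Fs)) \<le> length Fs * (2 * card A ^ 2)"
    if "\<forall>X\<in>set Fs. card X \<le> 2 * card A ^ 2" for Fs :: "(int \<times> int \<times> int \<times> int \<times> int) set list"
    using that
  proof (induction Fs)
    case (Cons X Fs)
    then show ?case using card_Un_le[of X "\<Union>(set Fs)"] by (auto simp: algebra_simps)
  qed simp
  have sub: "?S \<subseteq> \<Union>(set F)"
  proof
    fix p assume "p \<in> ?S"
    then obtain x1 x2 x3 x4 x5 where p: "p = (x1, x2, x3, x4, x5)"
      and x: "x1 \<in> A" "x2 \<in> A" "x3 \<in> A" "x4 \<in> A" "x5 \<in> A"
      and e: "a1 * x1 + a2 * x2 + a3 * x3 + a4 * x4 = s * x5"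
      by (auto simp: s_def)
    have "\<not> distinct [x1, x2, x3, x4, x5]"
      using A(3) x e unfolding avoids_eq_def s_def by blast
    then consider "x1 = x2" | "x1 = x3" | "x1 = x4" | "x1 = x5" | "x2 = x3" | "x2 = x4" | "x2 = x5"
      | "x3 = x4" | "x3 = x5" | "x4 = x5" by auto
    then show "p \<in> \<Union>(set F)"
    proof cases
      case 1
      then have "p \<in> F ! 0" using x e by (auto simp: F_def quad_def p algebra_simps intro!: image_eqI[of _ _ "(x1, x3, x4, x5)"])
      then show ?thesis using nth_mem[of 0 F] by (auto simp: F_def)
    next
      case 2
      then have "p \<in> F ! 1" using x e by (auto simp: F_def quad_def p algebra_simps intro!: image_eqI[of _ _ "(x1, x2, x4, x5)"])
      then show ?thesis using nth_mem[of 1 F] by (auto simp: F_def)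
    next
      case 3
      then have "p \<in> F ! 2" using x e by (auto simp: F_def quad_def p algebra_simps intro!: image_eqI[of _ _ "(x1, x2, x3, x5)"])
      then show ?thesis using nth_mem[of 2 F] by (auto simp: F_def)
    next
      case 4
      then have "p \<in> F ! 3" using x e by (auto simp: F_def quad_def p algebra_simps intro!: image_eqI[of _ _ "(x1, x2, x3, x4)"])
      then show ?thesis using nth_mem[of 3 F] by (auto simp: F_def)
    next
      case 5
      then have "p \<in> F ! 4" using x e by (auto simp: F_def quad_def p algebra_simps intro!: image_eqI[of _ _ "(x2, x1, x4, x5)"])
      then show ?thesis using nth_mem[of 4 F] by (auto simp: F_def)
    next
      case 6
      then have "p \<in> F ! 5" using x e by (auto simp: F_def quad_def p algebra_simps intro!: image_eqI[of _ _ "(x2, x1, x3, x5)"])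
      then show ?thesis using nth_mem[of 5 F] by (auto simp: F_def)
    next
      case 7
      then have "p \<in> F ! 6" using x e by (auto simp: F_def quad_def p algebra_simps intro!: image_eqI[of _ _ "(x2, x1, x3, x4)"])
      then show ?thesis using nth_mem[of 6 F] by (auto simp: F_def)
    next
      case 8
      then have "p \<in> F ! 7" using x e by (auto simp: F_def quad_def p algebra_simps intro!: image_eqI[of _ _ "(x3, x1, x2, x5)"])
      then show ?thesis using nth_mem[of 7 F] by (auto simp: F_def)
    next
      case 9
      then have "p \<in> F ! 8" using x e by (auto simp: F_def quad_def p algebra_simps intro!: image_eqI[of _ _ "(x3, x1, x2, x4)"])
      then show ?thesis using nth_mem[of 8 F] by (auto simp: F_def)
    next
      case 10
      then have "p \<in> F ! 9" using x e by (auto simp: F_def quad_def p algebra_simps intro!: image_eqI[of _ _ "(x4, x1, x2, x3)"])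
      then show ?thesis using nth_mem[of 9 F] by (auto simp: F_def)
    qed
  qed
  have "card ?S \<le> card (\<Union>(set F))" using sub fin by (intro card_mono) auto
  also have "\<dots> \<le> length F * (2 * card A ^ 2)" using card by (rule union)
  finally show ?thesis by (simp add: F_def)
qed

section \<open>Passage from integers to residues, and the upper bound\<close>

lemma int_dvd_small: "(N::int) dvd x \<Longrightarrow> \<bar>x\<bar> < N \<Longrightarrow> x = 0"
  using dvd_imp_le_int[of x N] by force

lemma avoiding_sidon_small:
  fixes a1 a2 a3 a4 :: int and \<delta> :: real
  assumes a: "a1 > 0" "a2 > 0" "a3 > 0" "a4 > 0" and \<delta>: "\<delta> > 0"
  shows "\<forall>\<^sub>F n in sequentially. \<forall>A. A \<subseteq> {1..int n} \<longrightarrow> sidon A \<longrightarrow> avoids_eq a1 a2 a3 a4 A \<longrightarrow>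
     real (card A) < \<delta> * sqrt (real n)"
proof -
  define s where "s = a1 + a2 + a3 + a4"
  define Q where "Q = a1 * a2 * a3 * a4 * s"
  have s: "s > 0" using a by (simp add: s_def)
  have "1 \<le> a1 * a2 * a3 * a4" using a by (simp add: int_one_le_iff_zero_less)
  then have Qs: "s \<le> Q" using s mult_right_mono[of 1 "a1 * a2 * a3 * a4" s] by (simp add: Q_def)
  then have Q: "Q \<ge> 1" using s by linarith
  \<comment> \<open>From N = 2 Q n + 1 follows 2 N \<le> 6 Q n, and a counterexample has n \<le>
    |A|^2 / \<delta>^2.\<close>
  define K where "K = 6 * of_int Q / \<delta>\<^sup>2 + 1"
  have K: "K \<ge> 1" using Q by (simp add: K_def)
  let ?c = "(a1, a2, a3, a4, - (a1 + a2 + a3 + a4))"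
  obtain \<theta> M where \<theta>: "\<theta> > 0" and H: "\<And>N A. dense_sidon K ?c N A \<Longrightarrow> M \<le> real (card A) \<Longrightarrow>
    \<theta> * real (card A) ^ 5 \<le> of_int N * real (card (sols N ?c A))"
    using card_sols_ge[OF a K] by blast
  \<comment> \<open>Beyond this size a counterexample has |A| \<ge> M, as the count requires, and
    |A| > 10 K / \<theta>, which is what the two counts contradict.\<close>
  define X where "X = (max (max M (10 * K / \<theta> + 1)) 1 / \<delta>)\<^sup>2"
  have "\<forall>\<^sub>F n in sequentially. X \<le> real n"
    using filterlim_real_sequentially by (simp add: filterlim_at_top)
  then show ?thesis
  proof (rule eventually_mono, intro allI impI)
    fix n A
    assume n: "X \<le> real n" and A: "A \<subseteq> {1..int n}" "sidon A" "avoids_eq a1 a2 a3 a4 A"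
    show "real (card A) < \<delta> * sqrt (real n)"
    proof (rule ccontr)
      assume "\<not> real (card A) < \<delta> * sqrt (real n)"
      then have big: "\<delta> * sqrt (real n) \<le> real (card A)" by simp
      \<comment> \<open>Coprime to \<open>Q\<close>, hence to all five coefficients, and larger than
        s n and 2 n, so that on {1..n} congruences modulo \<open>N\<close> are equations.\<close>
      define N where "N = 2 * Q * int n + 1"
      have fA: "finite A" using A finite_subset by blast
      have "max (max M (10 * K / \<theta> + 1)) 1 / \<delta> \<le> sqrt (real n)"
        using n unfolding X_def by (rule real_le_rsqrt)
      then have "max (max M (10 * K / \<theta> + 1)) 1 \<le> \<delta> * sqrt (real n)" using \<delta> by (simp add: field_simps)
      then have cA: "M \<le> real (card A)" "10 * K / \<theta> + 1 \<le> real (card A)" "1 \<le> real (card A)"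
        using big by auto
      then have Ane: "A \<noteq> {}" by auto
      have n1: "n \<ge> 1" using Ane A by auto
      have Qn: "Q * int n \<ge> s * int n" "Q * int n \<ge> int n"
        using mult_right_mono[OF Qs, of "int n"] mult_right_mono[OF Q, of "int n"] by simp_all
      have N: "N > 0" "s * int n < N" "2 * int n < N"
        using Qn s by (simp_all add: N_def)
      have sid: "sidon_mod N A"
        unfolding sidon_mod_def
      proof (intro conjI ballI impI)
        show "A \<subseteq> {0..<N}" using A N by fastforce
        fix w x y z assume m: "w \<in> A" "x \<in> A" "y \<in> A" "z \<in> A" and d: "N dvd w + x - (y + z)"
        have "w \<in> {1..int n}" "x \<in> {1..int n}" "y \<in> {1..int n}" "z \<in> {1..int n}" using m A by auto
        then have "\<bar>w + x - (y + z)\<bar> < N" using N by auto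
        then have "w + x = y + z" using int_dvd_small[OF d] by simp
        then show "w = y \<and> x = z \<or> w = z \<and> x = y" using sidonD A m by blast
      qed
      have cop: "coprime5 N ?c"
      proof -
        have "coprime k N" if "k dvd Q" for k
        proof -
          have k: "k dvd 2 * Q * int n" using that by simp
          show ?thesis
          proof (rule coprimeI)
            fix d assume "d dvd k" "d dvd N"
            then show "d dvd 1"
              using dvd_add_right_iff[of d "2 * Q * int n" 1] dvd_trans[OF _ k] unfolding N_def by blast
          qed
        qed
        moreover have "a1 dvd Q" "a2 dvd Q" "a3 dvd Q" "a4 dvd Q" "s dvd Q" by (simp_all add: Q_def)
        ultimately have "coprime a1 N" "coprime a2 N" "coprime a3 N" "coprime a4 N" "coprime (- s) N" by simp_all
        then show ?thesis by (simp add: coprime5_def s_def)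
      qed
      have sq: "\<delta>\<^sup>2 * real n \<le> (real (card A))\<^sup>2"
        using power_mono[OF big, of 2] \<delta> by (simp add: power_mult_distrib)
      have KN: "2 * of_int N + (real (card A))\<^sup>2 \<le> K * (real (card A))\<^sup>2"
      proof -
        have "Q * int n \<ge> 1" using Qn(2) n1 by linarith
        then have "2 * N \<le> 6 * Q * int n" by (simp add: N_def)
        then have "real_of_int (2 * N) \<le> real_of_int (6 * Q * int n)" by linarith
        also have "\<dots> = 6 * of_int Q / \<delta>\<^sup>2 * (\<delta>\<^sup>2 * real n)" using \<delta> by simp
        also have "\<dots> \<le> 6 * of_int Q / \<delta>\<^sup>2 * (real (card A))\<^sup>2"
          using sq Q by (intro mult_left_mono) auto
        finally show ?thesis by (simp add: K_def distrib_right)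
      qed
      have ds: "dense_sidon K ?c N A"
        using N cop sid Ane KN by (simp add: dense_sidon_def)
      have "sols N ?c A \<subseteq> {(x1, x2, x3, x4, x5). x1 \<in> A \<and> x2 \<in> A \<and> x3 \<in> A \<and> x4 \<in> A \<and> x5 \<in> A \<and>
         a1 * x1 + a2 * x2 + a3 * x3 + a4 * x4 = (a1 + a2 + a3 + a4) * x5}" (is "_ \<subseteq> ?S")
      proof
        fix p assume p: "p \<in> sols N ?c A"
        obtain x1 x2 x3 x4 x5 where P: "p = (x1, x2, x3, x4, x5)" by (metis prod.collapse)
        have m: "x1 \<in> A" "x2 \<in> A" "x3 \<in> A" "x4 \<in> A" "x5 \<in> A"
          and d: "N dvd a1 * x1 + a2 * x2 + a3 * x3 + a4 * x4 + - (a1 + a2 + a3 + a4) * x5"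
          using p by (auto simp: P sols_def)
        have r: "x1 \<in> {1..int n}" "x2 \<in> {1..int n}" "x3 \<in> {1..int n}" "x4 \<in> {1..int n}" "x5 \<in> {1..int n}"
          using m A by auto
        have b: "0 \<le> k * x \<and> k * x \<le> k * int n" if "k > 0" "x \<in> {1..int n}" for k x
          using that by simp
        have "s * x5 = (a1 + a2 + a3 + a4) * x5" by (simp add: s_def)
        moreover have "s * int n = a1 * int n + a2 * int n + a3 * int n + a4 * int n"
          by (simp add: s_def distrib_right)
        ultimately have "\<bar>a1 * x1 + a2 * x2 + a3 * x3 + a4 * x4 + - (a1 + a2 + a3 + a4) * x5\<bar> < N"
          using b[OF a(1) r(1)] b[OF a(2) r(2)] b[OF a(3) r(3)] b[OF a(4) r(4)] b[OF s r(5)] N(2)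
          by linarith
        then have "a1 * x1 + a2 * x2 + a3 * x3 + a4 * x4 + - (a1 + a2 + a3 + a4) * x5 = 0"
          using int_dvd_small d by blast
        then show "p \<in> ?S" using m by (simp add: P algebra_simps)
      qed
      then have "card (sols N ?c A) \<le> card ?S"
        using fA by (intro card_mono) (auto intro: finite_subset[of _ "A \<times> A \<times> A \<times> A \<times> A"])
      also have "\<dots> \<le> 20 * card A ^ 2" using card_sols_avoiding_le[OF a A(2) fA A(3)] .
      finally have "real (card (sols N ?c A)) \<le> real (20 * card A ^ 2)" by (rule of_nat_mono)
      then have sol: "real (card (sols N ?c A)) \<le> 20 * (real (card A))\<^sup>2" by simp
      have NK: "of_int N \<le> K / 2 * (real (card A))\<^sup>2" using KN zero_le_power2[of "real (card A)"] by linarith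
      have "\<theta> * real (card A) ^ 5 \<le> of_int N * real (card (sols N ?c A))" using H[OF ds cA(1)] .
      also have "\<dots> \<le> (K / 2 * (real (card A))\<^sup>2) * (20 * (real (card A))\<^sup>2)"
        using NK sol K by (intro mult_mono) auto
      also have "\<dots> = 10 * K * real (card A) ^ 4" by (simp add: power2_eq_square power4_eq_xxxx)
      finally have "(\<theta> * real (card A)) * real (card A) ^ 4 \<le> (10 * K) * real (card A) ^ 4"
        by (simp add: eval_nat_numeral mult_ac)
      then have "\<theta> * real (card A) \<le> 10 * K" using cA(3) by (simp add: mult_le_cancel_right)
      then have "real (card A) \<le> 10 * K / \<theta>" using \<theta> by (simp add: field_simps)
      then show False using cA(2) by linarith
    qed
  qed
qed

section \<open>Existence of primes\<close>

text \<open>The reciprocals of \<open>(n + 1) (n choose j)\<close> form Leibniz's harmonic triangle, whose entries are integer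
  combinations of \<open>1, 1/2, \<dots>, 1/(n + 1)\<close>.\<close>

lemma Suc_mult_binomial_dvd:
  fixes d :: nat
  assumes "j \<le> n" and "\<And>i. i \<in> {1..Suc n} \<Longrightarrow> i dvd d"
  shows "Suc n * (n choose j) dvd d"
  using assms
proof (induction j arbitrary: n)
  case 0
  then show ?case by simp
next
  case (Suc j)
  then obtain n' where n: "n = Suc n'" by (cases n) auto
  define u v w where "u = Suc n' * (n' choose j)" and "v = Suc n * (n choose j)" and "w = Suc n * (n choose Suc j)"
  have "u dvd d" unfolding u_def using Suc.prems n by (intro Suc.IH) auto
  moreover have "v dvd d" unfolding v_def using Suc.prems by (intro Suc.IH) auto
  ultimately obtain x y where x: "d = u * x" and y: "d = v * y" by (elim dvdE)
  have pos: "n choose j > 0" "n choose Suc j > 0" "u > 0" "v > 0" "w > 0"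
    using Suc.prems n by (auto simp: u_def v_def w_def)
  have u: "u = Suc j * (n choose Suc j)"
    unfolding u_def n using Suc_times_binomial_eq[of n' j] by (simp add: mult_ac)
  have "Suc j * ((n choose j) + (n choose Suc j)) = Suc n * (n choose j)"
    using Suc_times_binomial_eq[of n j] by (simp add: mult_ac)
  then have "real (Suc j) * (real (n choose j) + real (n choose Suc j)) = real (Suc n) * real (n choose j)"
    unfolding of_nat_add[symmetric] of_nat_mult[symmetric] by (rule arg_cong)
  moreover define a b where "a = real (n choose j)" and "b = real (n choose Suc j)"
  ultimately have e: "real (Suc j) * (a + b) = real (Suc n) * a" by simp
  have ab: "a > 0" "b > 0" using pos by (auto simp: a_def b_def)
  \<comment> \<open>The recurrence of the harmonic triangle. Multiplied by \<open>d\<close> it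
    exhibits d / w as the integer x - y.\<close>
  have "1 / real u = 1 / real v + 1 / real w"
  proof -
    have "1 / real v + 1 / real w = (a + b) / (real (Suc n) * a * b)"
      using ab unfolding v_def w_def of_nat_mult a_def[symmetric] b_def[symmetric]
      by (simp add: field_simps del: of_nat_Suc)
    also have "\<dots> = (a + b) / (real (Suc j) * (a + b) * b)" using e by simp
    also have "\<dots> = 1 / (real (Suc j) * b)" using ab by (simp del: of_nat_Suc)
    finally show ?thesis unfolding u of_nat_mult b_def by simp
  qed
  then have "real d / real u = real d / real v + real d / real w"
    by (metis distrib_left mult.right_neutral times_divide_eq_right)
  moreover have "real d / real u = real x" using x pos by simp
  moreover have "real d / real v = real y" using y pos by simp
  ultimately have "real d = real w * (real x - real y)"
    using pos by (simp add: field_simps)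
  then have "real_of_int (int d) = real_of_int (int w * (int x - int y))" by simp
  then have "int d = int w * (int x - int y)" by linarith
  then have "int w dvd int d" by simp
  then show ?case unfolding w_def[symmetric] by simp
qed

text \<open>The least common multiple of 1, ..., N is the product over primes p \<le> N of the
  largest power of p not exceeding N, and each such power is at most N.\<close>

lemma common_multiple_le_power_primes:
  fixes N :: nat
  shows "\<exists>d>0. (\<forall>i\<in>{1..N}. i dvd d) \<and> d \<le> N ^ card {p. prime p \<and> p \<le> N}"
proof -
  define P where "P = {p. prime p \<and> p \<le> N}"
  define e where "e p = Max {k. p ^ k \<le> N}" for p
  have finP: "finite P" unfolding P_def by (rule finite_subset[of _ "{..N}"]) auto
  have fin: "finite {k. p ^ k \<le> N}" if "p \<in> P" for p
  proof (rule finite_subset[of _ "{..N}"])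
    have "p \<ge> 2" using that prime_ge_2_nat by (auto simp: P_def)
    then have "k < p ^ k" for k
      using power_mono[of 2 p k] less_exp[of k] by linarith
    then show "{k. p ^ k \<le> N} \<subseteq> {..N}" by (auto intro: less_imp_le order_less_le_trans)
  qed simp
  have eN: "p ^ e p \<le> N" if "p \<in> P" for p
  proof -
    have "p \<ge> 1" "p \<le> N" using that prime_ge_1_nat by (auto simp: P_def)
    then have "0 \<in> {k. p ^ k \<le> N}" by simp
    then have "e p \<in> {k. p ^ k \<le> N}" unfolding e_def using fin[OF that] by (intro Max_in) blast+
    then show ?thesis by simp
  qed
  define d where "d = (\<Prod>p\<in>P. p ^ e p)"
  have "d > 0" unfolding d_def using prime_gt_0_nat by (intro prod_pos) (auto simp: P_def)
  moreover have "i dvd d" if i: "i \<in> {1..N}" for i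
  proof -
    have sub: "prime_factors i \<subseteq> P"
      using i by (auto simp: P_def prime_factors_dvd dest: dvd_imp_le)
    have "i = (\<Prod>p\<in>prime_factors i. p ^ multiplicity p i)"
      using i by (simp add: prime_factorization_nat)
    also have "\<dots> dvd (\<Prod>p\<in>prime_factors i. p ^ e p)"
    proof (rule prod_dvd_prod)
      fix p assume p: "p \<in> prime_factors i"
      have "p ^ multiplicity p i \<le> i" using i by (intro dvd_imp_le multiplicity_dvd) auto
      then have "multiplicity p i \<in> {k. p ^ k \<le> N}" using i by simp
      then have "multiplicity p i \<le> e p" unfolding e_def using fin p sub by (intro Max_ge) auto
      then show "p ^ multiplicity p i dvd p ^ e p" by (rule le_imp_power_dvd)
    qed
    also have "\<dots> dvd d" unfolding d_def using sub finP by (intro prod_dvd_prod_subset)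
    finally show ?thesis .
  qed
  moreover have "d \<le> (\<Prod>p\<in>P. N)" unfolding d_def using eN by (intro prod_mono) auto
  then have "d \<le> N ^ card P" by simp
  ultimately show ?thesis unfolding P_def by blast
qed

text \<open>A Chebyshev lower bound for the number of primes: (2 m + 1) times the central binomial
  coefficient divides every common multiple of 1, ..., 2 m + 1 and is at least 4^m.\<close>

lemma four_power_le_power_primes: "4 ^ m \<le> Suc (2 * m) ^ card {p. prime p \<and> p \<le> Suc (2 * m)}"
proof (cases "m = 0")
  case False
  obtain d where d: "d > 0" "\<forall>i\<in>{1..Suc (2 * m)}. i dvd d" "d \<le> Suc (2 * m) ^ card {p. prime p \<and> p \<le> Suc (2 * m)}"
    using common_multiple_le_power_primes by blast
  have "Suc (2 * m) * ((2 * m) choose m) dvd d" using d(2) by (intro Suc_mult_binomial_dvd) auto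
  then have "Suc (2 * m) * ((2 * m) choose m) \<le> d" using d(1) by (rule dvd_imp_le)
  moreover have "4 ^ m \<le> Suc (2 * m) * ((2 * m) choose m)"
  proof -
    have "4 ^ m \<le> (2 * real m) * real ((2 * m) choose m)"
      using central_binomial_lower_bound[of m] False by (simp add: field_simps)
    also have "\<dots> \<le> real (Suc (2 * m)) * real ((2 * m) choose m)" by (intro mult_right_mono) auto
    finally have "real (4 ^ m) \<le> real (Suc (2 * m) * ((2 * m) choose m))" unfolding of_nat_mult by simp
    then show ?thesis by (simp only: of_nat_le_iff)
  qed
  ultimately show ?thesis using d(3) by linarith
qed simp

text \<open>If no prime lay between x^(1 - \<epsilon>) and x, there would be at most x^(1 -
  \<epsilon>) primes up to x, against the order x / ln x just obtained.\<close>

lemma eventually_prime_powr: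
  fixes \<epsilon> :: real
  assumes "\<epsilon> > 0" "\<epsilon> < 1"
  shows "\<forall>\<^sub>F x in sequentially. \<exists>p. prime p \<and> p \<le> x \<and> real x powr (1 - \<epsilon>) \<le> real p"
proof -
  have "\<forall>\<^sub>F x::real in at_top. (x powr (1 - \<epsilon>) + 1) * ln x < (x - 3) / 2 * ln 4"
    using assms by real_asymp
  then have "\<forall>\<^sub>F x::nat in sequentially. (real x powr (1 - \<epsilon>) + 1) * ln (real x) < (real x - 3) / 2 * ln 4"
    using filterlim_real_sequentially by (rule eventually_compose_filterlim)
  moreover have "\<forall>\<^sub>F x::nat in sequentially. x \<ge> 3" by (rule eventually_ge_at_top)
  ultimately show ?thesis
  proof eventually_elim
    case (elim x)
    define m where "m = (x - 1) div 2"
    have m: "Suc (2 * m) \<le> x" "real m \<ge> (real x - 3) / 2" using elim by (auto simp: m_def)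
    let ?P = "{p. prime p \<and> p \<le> Suc (2 * m)}"
    show ?case
    proof (rule ccontr)
      assume neg: "\<not> ?case"
      define y where "y = real x powr (1 - \<epsilon>)"
      have "?P \<subseteq> {..nat \<lfloor>y\<rfloor>} - {0}"
      proof
        fix p assume p: "p \<in> ?P"
        then have "real p < y" using neg m(1) unfolding y_def by (auto simp: not_le intro: order_trans)
        moreover have "p > 0" using p prime_gt_0_nat by auto
        ultimately show "p \<in> {..nat \<lfloor>y\<rfloor>} - {0}" by (simp add: le_nat_iff le_floor_iff)
      qed
      then have "card ?P \<le> card ({..nat \<lfloor>y\<rfloor>} - {0})" by (intro card_mono) auto
      also have "\<dots> = nat \<lfloor>y\<rfloor>" by simp
      finally have "real (card ?P) \<le> y" using of_nat_floor[of y] unfolding y_def by (smt (verit) of_nat_le_iff powr_ge_zero)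
      have "real (4 ^ m) \<le> real (Suc (2 * m) ^ card ?P)"
        using four_power_le_power_primes by (rule of_nat_mono)
      also have "\<dots> \<le> real (x ^ card ?P)" using m(1) by (intro of_nat_mono power_mono) auto
      finally have "ln (4 ^ m) \<le> ln (real x ^ card ?P)" using elim by (subst ln_le_cancel_iff) auto
      then have "real m * ln 4 \<le> real (card ?P) * ln (real x)" using elim by (simp add: ln_realpow)
      also have "\<dots> \<le> y * ln (real x)" using \<open>real (card ?P) \<le> y\<close> elim by (intro mult_right_mono) auto
      also have "\<dots> \<le> (y + 1) * ln (real x)" using elim by (intro mult_right_mono) auto
      also have "\<dots> < (real x - 3) / 2 * ln 4" using elim by (simp add: y_def)
      also have "\<dots> \<le> real m * ln 4" using m by (intro mult_right_mono) auto
      finally show False by simp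
    qed
  qed
qed

section \<open>The lower bound\<close>

text \<open>The leading digit k and the residue of k^2 are stored in base 2 q, where two residues
  add without a carry. A sum thus reveals k1 + k2 and k1^2 + k2^2 modulo q, which determine the pair
  for odd q.\<close>

lemma erdos_turan_sidon:
  fixes p :: nat
  assumes p: "prime p" "p > 2"
  shows "\<exists>X. X \<subseteq> {1..int (2 * p ^ 2)} \<and> sidon X \<and> card X = p"
proof -
  define q where "q = int p"
  have q: "q > 2" "prime q" using p by (auto simp: q_def)
  define f where "f k = 2 * q * k + (k ^ 2) mod q + 1" for k :: int
  let ?I = "{0..<q}"
  have rr: "0 \<le> k ^ 2 mod q \<and> k ^ 2 mod q < q" for k using q by simp
  have key: "k1 + k2 = k3 + k4 \<and> q dvd k1 ^ 2 + k2 ^ 2 - (k3 ^ 2 + k4 ^ 2)"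
    if "f k1 + f k2 = f k3 + f k4" for k1 k2 k3 k4
  proof -
    define u where "u = k1 ^ 2 mod q + k2 ^ 2 mod q"
    define v where "v = k3 ^ 2 mod q + k4 ^ 2 mod q"
    have uv: "0 \<le> u" "u < 2 * q" "0 \<le> v" "v < 2 * q"
      unfolding u_def v_def using rr[of k1] rr[of k2] rr[of k3] rr[of k4] by linarith+
    have e: "(2 * q) * (k1 + k2) + u = (2 * q) * (k3 + k4) + v"
      using that by (simp add: f_def u_def v_def algebra_simps)
    have "k1 + k2 = ((2 * q) * (k1 + k2) + u) div (2 * q)" using uv q by simp
    also have "\<dots> = k3 + k4" unfolding e using uv q by simp
    finally have k: "k1 + k2 = k3 + k4" .
    then have "u = v" using e by simp
    then have "(k1 ^ 2 + k2 ^ 2) mod q = (k3 ^ 2 + k4 ^ 2) mod q"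
      unfolding u_def v_def by (metis mod_add_eq)
    then show ?thesis using k by (simp add: mod_eq_dvd_iff)
  qed
  have small: "x = y" if "q dvd x - y" "x \<in> ?I" "y \<in> ?I" for x y
    using that by (simp add: mod_eq_dvd_iff[symmetric])
  have inj: "inj_on f ?I"
  proof (rule inj_onI)
    fix x y assume "f x = f y"
    then show "x = y" using key[of x x y y] by simp
  qed
  have "sidon (f ` ?I)"
    unfolding sidon_def
  proof (intro ballI impI)
    fix x1 x2 x3 x4 assume x: "x1 \<in> f ` ?I" "x2 \<in> f ` ?I" "x3 \<in> f ` ?I" "x4 \<in> f ` ?I" and e: "x1 + x2 = x3 + x4"
    obtain k1 k2 k3 k4 where k: "k1 \<in> ?I" "k2 \<in> ?I" "k3 \<in> ?I" "k4 \<in> ?I"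
      and x: "x1 = f k1" "x2 = f k2" "x3 = f k3" "x4 = f k4" using x by blast
    from key[of k1 k2 k3 k4] e x have s: "k1 + k2 = k3 + k4" and d: "q dvd k1 ^ 2 + k2 ^ 2 - (k3 ^ 2 + k4 ^ 2)"
      by auto
    have k2: "k2 = k3 + k4 - k1" using s by simp
    have "k1 ^ 2 + k2 ^ 2 - (k3 ^ 2 + k4 ^ 2) = 2 * ((k1 - k3) * (k1 - k4))"
      unfolding k2 by (simp add: power2_eq_square algebra_simps)
    with d have "q dvd 2 * ((k1 - k3) * (k1 - k4))" by simp
    moreover have "\<not> q dvd 2" using q zdvd_imp_le[of q 2] by auto
    ultimately have "q dvd k1 - k3 \<or> q dvd k1 - k4" using q by (simp add: prime_dvd_mult_iff)
    then have "k1 = k3 \<or> k1 = k4" using small k by blast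
    then show "(x1, x2) = (x3, x4) \<or> (x1, x2) = (x4, x3)" using s x by auto
  qed
  moreover have "f ` ?I \<subseteq> {1..int (2 * p ^ 2)}"
  proof (rule image_subsetI)
    fix k assume k: "k \<in> ?I"
    then have "2 * q * k \<le> 2 * q * (q - 1)" using q by (intro mult_left_mono) auto
    also have "\<dots> = 2 * q ^ 2 - 2 * q" by (simp add: power2_eq_square algebra_simps)
    finally have "f k \<le> 2 * q ^ 2" unfolding f_def using rr[of k] q by linarith
    moreover have "f k \<ge> 1" unfolding f_def using rr[of k] q k by simp
    ultimately show "f k \<in> {1..int (2 * p ^ 2)}" by (simp add: q_def)
  qed
  moreover have "card (f ` ?I) = p" using inj by (simp add: card_image q_def)
  ultimately show ?thesis by blast
qed

section \<open>Behrend sets: lattice points of a sphere written as digits\<close>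

lemma base_digits_unique:
  fixes f g :: "nat \<Rightarrow> nat"
  assumes "\<And>i. i < d \<Longrightarrow> f i < b" "\<And>i. i < d \<Longrightarrow> g i < b"
    and "(\<Sum>i<d. f i * b ^ i) = (\<Sum>i<d. g i * b ^ i)" "i < d"
  shows "f i = g i"
  using assms
proof (induction d arbitrary: f g i)
  case (Suc d)
  have split: "(\<Sum>i<Suc d. h i * b ^ i) = h 0 + b * (\<Sum>i<d. h (Suc i) * b ^ i)" for h
    by (simp add: sum.lessThan_Suc_shift sum_distrib_left mult_ac del: sum.lessThan_Suc)
  have b: "f 0 < b" "g 0 < b" using Suc.prems by auto
  have e: "f 0 + b * (\<Sum>i<d. f (Suc i) * b ^ i) = g 0 + b * (\<Sum>i<d. g (Suc i) * b ^ i)"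
    using Suc.prems(3) unfolding split .
  have "(f 0 + b * (\<Sum>i<d. f (Suc i) * b ^ i)) mod b = f 0" using b by simp
  moreover have "(g 0 + b * (\<Sum>i<d. g (Suc i) * b ^ i)) mod b = g 0" using b by simp
  ultimately have 0: "f 0 = g 0" using e by simp
  then have tail: "(\<Sum>i<d. f (Suc i) * b ^ i) = (\<Sum>i<d. g (Suc i) * b ^ i)" using e b by simp
  show ?case
  proof (cases i)
    case (Suc j)
    have "f (Suc j) = g (Suc j)"
      using Suc.IH[of "\<lambda>i. f (Suc i)" "\<lambda>i. g (Suc i)" j] tail Suc.prems Suc by simp
    then show ?thesis using Suc by simp
  qed (use 0 in simp)
qed simp

text \<open>On a common sphere |v - v5|^2 = 2 c - 2 (v . v5). The equation paired with v5 makes the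
  weighted sum of these squares vanish, so each term does.\<close>

lemma sphere_strictly_convex:
  fixes v1 v2 v3 v4 v5 :: "'i \<Rightarrow> int"
  assumes D: "finite D" and a: "a1 > 0" "a2 > 0" "a3 > 0" "a4 > 0"
    and sph: "(\<Sum>i\<in>D. (v1 i)\<^sup>2) = c" "(\<Sum>i\<in>D. (v2 i)\<^sup>2) = c" "(\<Sum>i\<in>D. (v3 i)\<^sup>2) = c" "(\<Sum>i\<in>D. (v4 i)\<^sup>2) = c"
      "(\<Sum>i\<in>D. (v5 i)\<^sup>2) = c"
    and eq: "\<And>i. i \<in> D \<Longrightarrow> a1 * v1 i + a2 * v2 i + a3 * v3 i + a4 * v4 i = (a1 + a2 + a3 + a4) * v5 i"
    and i: "i \<in> D"
  shows "v1 i = v5 i"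
proof -
  define E where "E v = (\<Sum>i\<in>D. (v i - v5 i)\<^sup>2)" for v
  define T where "T v = (\<Sum>i\<in>D. v i * v5 i)" for v
  have E: "E v = (\<Sum>i\<in>D. (v i)\<^sup>2) + c - 2 * T v" for v
    unfolding E_def T_def using sph(5) by (simp add: power2_diff sum.distrib sum_subtractf sum_distrib_left mult_ac)
  have "a1 * T v1 + a2 * T v2 + a3 * T v3 + a4 * T v4
      = (\<Sum>i\<in>D. (a1 * v1 i + a2 * v2 i + a3 * v3 i + a4 * v4 i) * v5 i)"
    by (simp add: T_def sum_distrib_left sum.distrib distrib_right mult.assoc)
  also have "\<dots> = (\<Sum>i\<in>D. (a1 + a2 + a3 + a4) * (v5 i)\<^sup>2)"
    by (intro sum.cong refl) (simp add: eq power2_eq_square)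
  also have "\<dots> = (a1 + a2 + a3 + a4) * c" using sph(5) by (simp add: sum_distrib_left[symmetric])
  finally have T: "a1 * T v1 + a2 * T v2 + a3 * T v3 + a4 * T v4 = (a1 + a2 + a3 + a4) * c" .
  have "a1 * E v1 + a2 * E v2 + a3 * E v3 + a4 * E v4
     = 2 * ((a1 + a2 + a3 + a4) * c) - 2 * (a1 * T v1 + a2 * T v2 + a3 * T v3 + a4 * T v4)"
    unfolding E sph by (simp add: algebra_simps)
  then have "a1 * E v1 + a2 * E v2 + a3 * E v3 + a4 * E v4 = 0" using T by simp
  moreover have E0: "E v \<ge> 0" for v unfolding E_def by (intro sum_nonneg) auto
  ultimately have "a1 * E v1 = 0"
    using mult_nonneg_nonneg[of a1 "E v1"] mult_nonneg_nonneg[of a2 "E v2"] mult_nonneg_nonneg[of a3 "E v3"]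
      mult_nonneg_nonneg[of a4 "E v4"] a E0[of v1] E0[of v2] E0[of v3] E0[of v4] by linarith
  then have "E v1 = 0" using a by simp
  then have "\<forall>i\<in>D. (v1 i - v5 i)\<^sup>2 = 0"
    unfolding E_def using D by (subst (asm) sum_nonneg_eq_0_iff) auto
  then show ?thesis using i by simp
qed

text \<open>Digits below \<open>m\<close> in base s m do not carry on either side of the equation,
  so it holds digit by digit. It is enough to conclude y1 = y5, since the forbidden solutions have
  distinct entries.\<close>

lemma behrend_set:
  fixes a1 a2 a3 a4 :: int and d m :: nat
  defines "s \<equiv> a1 + a2 + a3 + a4"
  assumes a: "a1 > 0" "a2 > 0" "a3 > 0" "a4 > 0" and d: "d > 0" and m: "m > 0"
  shows "\<exists>Y. Y \<subseteq> {0..<int ((nat s * m) ^ d)} \<and> m ^ d \<le> card Y * (d * m ^ 2) \<and>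
    (\<forall>y1\<in>Y. \<forall>y2\<in>Y. \<forall>y3\<in>Y. \<forall>y4\<in>Y. \<forall>y5\<in>Y.
       a1 * y1 + a2 * y2 + a3 * y3 + a4 * y4 = s * y5 \<longrightarrow> y1 = y5)"
proof -
  define b where "b = nat s * m"
  define n1 n2 n3 n4 where "n1 = nat a1" and "n2 = nat a2" and "n3 = nat a3" and "n4 = nat a4"
  have an: "a1 = int n1" "a2 = int n2" "a3 = int n3" "a4 = int n4" "nat s = n1 + n2 + n3 + n4"
    "n1 > 0" "n2 > 0" "n3 > 0" "n4 > 0"
    using a by (auto simp: n1_def n2_def n3_def n4_def s_def)
  have b: "b = (n1 + n2 + n3 + n4) * m" by (simp add: b_def an)
  have mb: "m \<le> b" using an by (simp add: b)
  define V where "V = PiE {..<d} (\<lambda>_. {..<m})"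
  define q where "q v = (\<Sum>i<d. (v i)\<^sup>2)" for v :: "nat \<Rightarrow> nat"
  define enc where "enc v = (\<Sum>i<d. v i * b ^ i)" for v :: "nat \<Rightarrow> nat"
  have V: "finite V" "card V = m ^ d" by (auto simp: V_def card_PiE intro: finite_PiE)
  have Vlt: "v i < m" if "v \<in> V" "i < d" for v i using that by (auto simp: V_def)
  have "q v < d * m ^ 2" if v: "v \<in> V" for v
  proof -
    have "q v < (\<Sum>i<d. m ^ 2)" unfolding q_def
    proof (rule sum_strict_mono)
      fix i assume "i \<in> {..<d}"
      then show "(v i)\<^sup>2 < m\<^sup>2" using Vlt[OF v] by (intro power_strict_mono) auto
    qed (use d in auto)
    then show ?thesis by simp
  qed
  \<comment> \<open>The squared norm takes fewer than or equal to d m^2 values, so some sphere holds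
    at least that fraction of the m^d vectors.\<close>
  then have "q \<in> V \<rightarrow> {..<d * m ^ 2}" by auto
  moreover have "{..<d * m ^ 2} \<noteq> {}" using d m by (simp add: lessThan_empty_iff)
  ultimately obtain c where c: "m ^ d \<le> card (q -` {c} \<inter> V) * (d * m ^ 2)"
    using pigeonhole_card[of q V "{..<d * m ^ 2}"] V by auto
  define W where "W = q -` {c} \<inter> V"
  have WV: "v \<in> V" "q v = c" if "v \<in> W" for v using that by (auto simp: W_def)
  have inj: "inj_on enc V"
  proof (rule inj_onI)
    fix v w assume v: "v \<in> V" and w: "w \<in> V" and e: "enc v = enc w"
    have "v i = w i" if "i < d" for i
      using base_digits_unique[of d v b w i] Vlt[OF v] Vlt[OF w] mb e that
      unfolding enc_def by (auto intro: order_less_le_trans)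
    then show "v = w" using v w unfolding V_def by (intro PiE_ext) auto
  qed
  define Y where "Y = (\<lambda>v. int (enc v)) ` W"
  have bound: "(\<Sum>i<k. v i * b ^ i) < b ^ k" if "\<And>i. i < k \<Longrightarrow> v i < b" for v :: "nat \<Rightarrow> nat" and k
    using that
  proof (induction k)
    case (Suc k)
    then have "(\<Sum>i<k. v i * b ^ i) < b ^ k" by simp
    moreover have "Suc (v k) * b ^ k \<le> b * b ^ k" using Suc.prems[of k] by (intro mult_right_mono) auto
    ultimately show ?case by simp
  qed simp
  have "Y \<subseteq> {0..<int ((nat s * m) ^ d)}"
  proof -
    have "enc v < b ^ d" if "v \<in> W" for v
      unfolding enc_def by (intro bound) (use Vlt WV that mb in \<open>auto intro: order_less_le_trans\<close>)
    then show ?thesis unfolding Y_def b_def[symmetric] by auto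
  qed
  moreover have "card Y = card W"
    unfolding Y_def using inj by (intro card_image) (auto simp: inj_on_def W_def)
  moreover have "y1 = y5" if y: "y1 \<in> Y" "y2 \<in> Y" "y3 \<in> Y" "y4 \<in> Y" "y5 \<in> Y"
    and e: "a1 * y1 + a2 * y2 + a3 * y3 + a4 * y4 = s * y5" for y1 y2 y3 y4 y5
  proof -
    obtain v1 v2 v3 v4 v5 where w: "v1 \<in> W" "v2 \<in> W" "v3 \<in> W" "v4 \<in> W" "v5 \<in> W"
      and yv: "y1 = int (enc v1)" "y2 = int (enc v2)" "y3 = int (enc v3)" "y4 = int (enc v4)" "y5 = int (enc v5)"
      using y unfolding Y_def by blast
    have "int (n1 * enc v1 + n2 * enc v2 + n3 * enc v3 + n4 * enc v4) = int ((n1 + n2 + n3 + n4) * enc v5)"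
      using e unfolding yv s_def an by simp
    then have e': "n1 * enc v1 + n2 * enc v2 + n3 * enc v3 + n4 * enc v4 = (n1 + n2 + n3 + n4) * enc v5"
      by (simp only: of_nat_eq_iff)
    let ?f = "\<lambda>i. n1 * v1 i + n2 * v2 i + n3 * v3 i + n4 * v4 i" and ?g = "\<lambda>i. (n1 + n2 + n3 + n4) * v5 i"
    have dig: "?f i = ?g i" if i: "i < d" for i
    proof (rule base_digits_unique[of d ?f b ?g])
      show "(\<Sum>i<d. ?f i * b ^ i) = (\<Sum>i<d. ?g i * b ^ i)"
        using e' unfolding enc_def by (simp add: sum_distrib_left distrib_right sum.distrib mult.assoc)
      show "?f i < b" if "i < d" for i
      proof -
        have lt: "n * v i < n * m" if "n > 0" "v \<in> W" for n v using that Vlt[OF WV(1) \<open>i < d\<close>] by simp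
        have "?f i < n1 * m + n2 * m + n3 * m + n4 * m"
          using lt[OF an(6) w(1)] lt[OF an(7) w(2)] lt[OF an(8) w(3)] lt[OF an(9) w(4)] by linarith
        then show ?thesis by (simp add: b distrib_right)
      qed
      show "?g i < b" if "i < d" for i
        using Vlt[OF WV(1)[OF w(5)] that] an unfolding b by (intro mult_strict_left_mono) auto
    qed (rule i)
    have sph: "(\<Sum>i\<in>{..<d}. (int (v i))\<^sup>2) = int c" if "v \<in> W" for v
      using WV(2)[OF that] unfolding q_def by (metis (mono_tags, lifting) of_nat_power of_nat_sum sum.cong)
    have "int (v1 i) = int (v5 i)" if "i < d" for i
    proof (rule sphere_strictly_convex[OF _ a sph[OF w(1)] sph[OF w(2)] sph[OF w(3)] sph[OF w(4)] sph[OF w(5)]])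
      fix i assume "i \<in> {..<d}"
      then have "int (?f i) = int (?g i)" using dig by simp
      then show "a1 * int (v1 i) + a2 * int (v2 i) + a3 * int (v3 i) + a4 * int (v4 i) = (a1 + a2 + a3 + a4) * int (v5 i)"
        by (simp add: an)
    qed (use that in auto)
    then have "enc v1 = enc v5" by (simp add: enc_def)
    then show ?thesis by (simp add: yv)
  qed
  ultimately show ?thesis using c unfolding W_def by (intro exI[of _ Y]) simp
qed

text \<open>Averaging: all differences x - y lie among 2 n values of \<open>t\<close>, so the
  intersections of \<open>X\<close> with the translates of \<open>Y\<close> have total size |X|
  |Y|.\<close>

lemma exists_translate_large_inter:
  fixes X Y :: "int set" and n :: nat
  assumes X: "X \<subseteq> {1..int n}" and Y: "Y \<subseteq> {0..<int n}"
  shows "\<exists>t. card X * card Y \<le> 2 * n * card {x\<in>X. x - t \<in> Y}"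
proof (rule ccontr)
  assume "\<not> ?thesis"
  then have lt: "2 * n * card {x\<in>X. x - t \<in> Y} < card X * card Y" for t by (simp add: not_le)
  let ?T = "{- int n<..int n}"
  have fX: "finite X" and fY: "finite Y" using X Y finite_subset by blast+
  have cT: "card ?T = 2 * n" by simp
  have n: "n > 0" using lt[of 0] X by (cases n) auto
  have "(\<Sum>t\<in>?T. card {x\<in>X. x - t \<in> Y}) = card (Sigma ?T (\<lambda>t. {x\<in>X. x - t \<in> Y}))"
    using fX by (subst card_SigmaI) auto
  also have "\<dots> = card (X \<times> Y)"
    by (rule bij_betw_same_card[of "\<lambda>(t, x). (x, x - t)"], rule bij_betwI[where g = "\<lambda>(x, y). (x - y, x)"])
       (use X Y in \<open>auto, fastforce+\<close>)
  finally have "(\<Sum>t\<in>?T. card {x\<in>X. x - t \<in> Y}) = card X * card Y" by (simp add: card_cartesian_product)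
  then have "2 * n * (card X * card Y) = (\<Sum>t\<in>?T. 2 * n * card {x\<in>X. x - t \<in> Y})"
    by (simp only: sum_distrib_left[symmetric])
  also have "\<dots> < (\<Sum>t\<in>?T. card X * card Y)"
    using n lt by (intro sum_strict_mono) auto
  also have "\<dots> = 2 * n * (card X * card Y)" using cT by simp
  finally show False by simp
qed

lemma eventually_sidon_avoiding:
  fixes a1 a2 a3 a4 :: int and \<epsilon> :: real
  assumes a: "a1 > 0" "a2 > 0" "a3 > 0" "a4 > 0" and \<epsilon>: "\<epsilon> > 0" "\<epsilon> < 1"
  shows "\<forall>\<^sub>F n in sequentially. \<exists>A. A \<subseteq> {1..int n} \<and> sidon A \<and> avoids_eq a1 a2 a3 a4 A \<and>
     real n powr (1/2 - \<epsilon>) \<le> real (card A)"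
proof -
  define s where "s = nat (a1 + a2 + a3 + a4)"
  have s: "s > 0" using a by (simp add: s_def)
  \<comment> \<open>The sphere costs m^2, about n^(2 / d); this \<open>d\<close> keeps the loss
    below n^(\<epsilon> / 4).\<close>
  define d where "d = nat \<lceil>8 / \<epsilon>\<rceil>"
  have d_ge: "real d \<ge> 8 / \<epsilon>" unfolding d_def by linarith
  have "8 / \<epsilon> \<ge> 8" using \<epsilon> by (simp add: field_simps)
  then have "real d \<ge> 8" using d_ge by linarith
  then have d: "d \<ge> 8" by simp
  have d\<epsilon>: "2 / real d \<le> \<epsilon> / 4" using d_ge d \<epsilon> by (simp add: field_simps)
  define C where "C = 1 / ((2 * real s) ^ (d - 2) * real d)"
  have C: "C > 0" using s d by (simp add: C_def)
  have nat_top: "\<forall>\<^sub>F n::nat in sequentially. P (real n)" if "\<forall>\<^sub>F x in at_top. P x" for P :: "real \<Rightarrow> bool"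
    using that filterlim_real_sequentially by (rule eventually_compose_filterlim)
  \<comment> \<open>Primes are sought up to sqrt (n / 2) because the Sidon set attached to p
    occupies {1..2 p^2}.\<close>
  have root_top: "filterlim (\<lambda>n::nat. nat \<lfloor>sqrt (real n / 2)\<rfloor>) sequentially sequentially"
    by real_asymp
  have ev1: "\<forall>\<^sub>F n::nat in sequentially. \<exists>p. prime p \<and> p \<le> nat \<lfloor>sqrt (real n / 2)\<rfloor> \<and>
      real (nat \<lfloor>sqrt (real n / 2)\<rfloor>) powr (1 - \<epsilon> / 2) \<le> real p"
    using \<epsilon> by (intro eventually_compose_filterlim[OF eventually_prime_powr root_top]) auto
  have "\<forall>\<^sub>F x::real in at_top. 5 \<le> x powr (1/2)" by real_asymp
  then have ev2: "\<forall>\<^sub>F n::nat in sequentially. 5 \<le> real n powr (1/2)" by (rule nat_top)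
  have "\<forall>\<^sub>F x::real in at_top. 4 < x powr (1/2 - \<epsilon> / 4)" using \<epsilon> by real_asymp
  then have ev3: "\<forall>\<^sub>F n::nat in sequentially. 4 < real n powr (1/2 - \<epsilon> / 4)" by (rule nat_top)
  have "1 / real d > 0" using d by simp
  then have "\<forall>\<^sub>F x::real in at_top. 2 * real s \<le> x powr (1 / real d)" by real_asymp
  then have ev4: "\<forall>\<^sub>F n::nat in sequentially. 2 * real s \<le> real n powr (1 / real d)" by (rule nat_top)
  have "\<forall>\<^sub>F x::real in at_top. 4 / C \<le> x powr (\<epsilon> / 2)" using \<epsilon> by real_asymp
  then have ev5: "\<forall>\<^sub>F n::nat in sequentially. 4 / C \<le> real n powr (\<epsilon> / 2)" by (rule nat_top)
  have ev6: "\<forall>\<^sub>F n::nat in sequentially. n \<ge> 1" by (rule eventually_ge_at_top)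
  show ?thesis
    using ev1 ev2 ev3 ev4 ev5 ev6
  proof eventually_elim
    case (elim n)
    have n: "real n \<ge> 1" using elim by simp
    obtain p where p: "prime p" "p \<le> nat \<lfloor>sqrt (real n / 2)\<rfloor>"
      "real (nat \<lfloor>sqrt (real n / 2)\<rfloor>) powr (1 - \<epsilon> / 2) \<le> real p" using elim(1) by blast
    \<comment> \<open>The summand 1 pays for rounding sqrt (n / 2) down.\<close>
    have half: "real n powr (1/2) / 2 + 1 \<le> sqrt (real n / 2)"
    proof (rule real_le_rsqrt)
      define y where "y = real n powr (1/2)"
      have y: "y \<ge> 5" "y\<^sup>2 = real n" using elim(2) n by (auto simp: y_def powr_half_sqrt)
      have "5 * y \<le> y\<^sup>2" unfolding power2_eq_square using y(1) by (intro mult_right_mono) auto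
      then have "(y / 2 + 1)\<^sup>2 \<le> y\<^sup>2 / 2" using y(1) by (simp add: power2_sum power_divide)
      then show "(real n powr (1/2) / 2 + 1)\<^sup>2 \<le> real n / 2" using y(2) by (simp add: y_def)
    qed
    have p_large: "real n powr (1/2 - \<epsilon> / 4) / 2 \<le> real p"
    proof -
      have "real n powr (1/2 - \<epsilon> / 4) / 2 = (real n powr (1/2)) powr (1 - \<epsilon> / 2) / 2 powr 1"
        by (simp add: powr_powr field_simps)
      also have "\<dots> \<le> (real n powr (1/2)) powr (1 - \<epsilon> / 2) / 2 powr (1 - \<epsilon> / 2)"
        using \<epsilon> by (intro divide_left_mono powr_mono) auto
      also have "\<dots> = (real n powr (1/2) / 2) powr (1 - \<epsilon> / 2)" by (simp add: powr_divide)
      also have "\<dots> \<le> real (nat \<lfloor>sqrt (real n / 2)\<rfloor>) powr (1 - \<epsilon> / 2)"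
      proof (rule powr_mono2)
        show "real n powr (1/2) / 2 \<le> real (nat \<lfloor>sqrt (real n / 2)\<rfloor>)" using half by linarith
      qed (use \<epsilon> in auto)
      finally show ?thesis using p(3) by linarith
    qed
    have "p > 2" using p_large elim(3) by linarith
    have "real p \<le> sqrt (real n / 2)"
      using p(2) by (simp add: le_nat_iff le_floor_iff)
    then have "(real p)\<^sup>2 \<le> (sqrt (real n / 2))\<^sup>2" by (intro power_mono) auto
    then have "real (2 * p\<^sup>2) \<le> real n" by simp
    then have pn: "2 * p\<^sup>2 \<le> n" by (simp only: of_nat_le_iff)
    obtain X where X: "X \<subseteq> {1..int (2 * p ^ 2)}" "sidon X" "card X = p"
      using erdos_turan_sidon[OF p(1) \<open>p > 2\<close>] by blast
    have Xn: "X \<subseteq> {1..int n}"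
    proof -
      have "{1..int (2 * p ^ 2)} \<subseteq> {1..int n}" using pn by (simp only: atLeastatMost_subset_iff of_nat_le_iff) simp
      then show ?thesis using X(1) by blast
    qed
    define r where "r = real n powr (1 / real d)"
    define m where "m = nat \<lfloor>r / real s\<rfloor>"
    have rs: "r / real s \<ge> 2" using elim(4) s by (simp add: r_def field_simps)
    have m1: "real m \<le> r / real s" using rs unfolding m_def by simp
    have "real m \<ge> r / real s - 1" unfolding m_def by linarith
    then have m2: "real m \<ge> r / (2 * real s)" using rs by simp
    have m0: "m > 0" using m2 rs s by (auto intro!: gr0I simp: field_simps)
    have r0: "r > 0" using n by (simp add: r_def)
    have rd: "r ^ k = real n powr (real k / real d)" for k
      using r0 n by (simp add: r_def powr_powr flip: powr_realpow)
    have "(real s * real m) ^ d \<le> r ^ d"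
      using m1 s by (intro power_mono) (auto simp: field_simps)
    also have "\<dots> = real n" using rd[of d] d n by simp
    finally have "real ((s * m) ^ d) \<le> real n" by simp
    then have smn: "(s * m) ^ d \<le> n" by (simp only: of_nat_le_iff)
    obtain Y where Y: "Y \<subseteq> {0..<int ((s * m) ^ d)}" "m ^ d \<le> card Y * (d * m ^ 2)"
      and Yeq: "\<And>y1 y2 y3 y4 y5. y1 \<in> Y \<Longrightarrow> y2 \<in> Y \<Longrightarrow> y3 \<in> Y \<Longrightarrow> y4 \<in> Y \<Longrightarrow> y5 \<in> Y \<Longrightarrow>
       a1 * y1 + a2 * y2 + a3 * y3 + a4 * y4 = (a1 + a2 + a3 + a4) * y5 \<Longrightarrow> y1 = y5"
      using behrend_set[OF a, of d m] d m0 unfolding s_def by fastforce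
    have Yn: "Y \<subseteq> {0..<int n}"
    proof
      fix y assume "y \<in> Y"
      then have "y \<in> {0..<int ((s * m) ^ d)}" using Y(1) by blast
      moreover have "int ((s * m) ^ d) \<le> int n" using smn by (simp only: of_nat_le_iff)
      ultimately show "y \<in> {0..<int n}" unfolding atLeastLessThan_iff by linarith
    qed
    have Y_large: "C * real n powr (1 - \<epsilon> / 4) \<le> real (card Y)"
    proof -
      have "d - 2 + 2 = d" using d by simp
      then have "m ^ (d - 2) * m ^ 2 = m ^ d" by (metis power_add)
      then have "m ^ (d - 2) * m ^ 2 \<le> (card Y * d) * m ^ 2"
        using Y(2) by (simp add: mult.assoc)
      then have "m ^ (d - 2) \<le> card Y * d" using m0 by simp
      then have "real (m ^ (d - 2)) \<le> real (card Y * d)" by (rule of_nat_mono)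
      moreover have "(r / (2 * real s)) ^ (d - 2) \<le> real m ^ (d - 2)"
        using m2 r0 s by (intro power_mono) auto
      ultimately have "r ^ (d - 2) / (2 * real s) ^ (d - 2) \<le> real (card Y) * real d"
        by (simp add: power_divide)
      then have "r ^ (d - 2) / (2 * real s) ^ (d - 2) / real d \<le> real (card Y)"
        using d by (subst pos_divide_le_eq) auto
      then have "C * r ^ (d - 2) \<le> real (card Y)" by (simp add: C_def)
      moreover have "C * real n powr (1 - \<epsilon> / 4) \<le> C * r ^ (d - 2)"
      proof (rule mult_left_mono)
        have "1 - \<epsilon> / 4 \<le> real (d - 2) / real d"
          using d\<epsilon> d by (simp add: of_nat_diff diff_divide_distrib)
        then show "real n powr (1 - \<epsilon> / 4) \<le> r ^ (d - 2)" unfolding rd using n by (rule powr_mono)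
      qed (use C in simp)
      ultimately show ?thesis by linarith
    qed
    obtain t where t: "card X * card Y \<le> 2 * n * card {x\<in>X. x - t \<in> Y}"
      using exists_translate_large_inter[OF Xn Yn] by blast
    define A where "A = {x\<in>X. x - t \<in> Y}"
    have "A \<subseteq> {1..int n}" using Xn by (auto simp: A_def)
    moreover have "sidon A" using X(2) unfolding sidon_def A_def by blast
    moreover have "avoids_eq a1 a2 a3 a4 A"
    proof -
      have "x1 = x5" if x: "x1 \<in> A" "x2 \<in> A" "x3 \<in> A" "x4 \<in> A" "x5 \<in> A"
        and e: "a1 * x1 + a2 * x2 + a3 * x3 + a4 * x4 = (a1 + a2 + a3 + a4) * x5" for x1 x2 x3 x4 x5
      proof -
        have eq: "a1 * (x1 - t) + a2 * (x2 - t) + a3 * (x3 - t) + a4 * (x4 - t) = (a1 + a2 + a3 + a4) * (x5 - t)"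
          using e by (simp add: algebra_simps)
        have "x1 - t \<in> Y" "x2 - t \<in> Y" "x3 - t \<in> Y" "x4 - t \<in> Y" "x5 - t \<in> Y"
          using x by (auto simp: A_def)
        from Yeq[OF this eq] show ?thesis by simp
      qed
      then show ?thesis unfolding avoids_eq_def by fastforce
    qed
    moreover have "real n powr (1/2 - \<epsilon>) \<le> real (card A)"
    proof -
      have "(real n powr (1/2 - \<epsilon> / 4) / 2) * (C * real n powr (1 - \<epsilon> / 4)) \<le> real (card X) * real (card Y)"
        using p_large Y_large X(3) C by (intro mult_mono) auto
      also have "\<dots> = real (card X * card Y)" by simp
      also have "\<dots> \<le> real (2 * n * card A)" using t unfolding A_def by (rule of_nat_mono)
      finally have h: "C / 2 * (real n powr (1/2 - \<epsilon> / 4) * real n powr (1 - \<epsilon> / 4)) \<le> 2 * real n * real (card A)"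
        by (simp add: mult_ac)
      \<comment> \<open>Both sets lose n^(\<epsilon> / 4), and averaging divides by 2 n; compared
        with the target exponent a factor n^(\<epsilon> / 2) is left to absorb the constant C /
        4.\<close>
      have "real n powr (1/2 - \<epsilon> / 4) * real n powr (1 - \<epsilon> / 4) = real n powr (1 + \<epsilon> / 2 + (1/2 - \<epsilon>))"
        by (simp add: powr_add[symmetric])
      also have "\<dots> = real n * real n powr (\<epsilon> / 2) * real n powr (1/2 - \<epsilon>)"
        unfolding powr_add using n by simp
      finally have "real n * (C / 2 * (real n powr (\<epsilon> / 2) * real n powr (1/2 - \<epsilon>))) \<le> real n * (2 * real (card A))"
        using h by (simp add: mult_ac)
      then have "C / 4 * real n powr (\<epsilon> / 2) * real n powr (1/2 - \<epsilon>) \<le> real (card A)" using n by simp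
      moreover have "1 \<le> C / 4 * real n powr (\<epsilon> / 2)" using elim(5) C by (simp add: field_simps)
      then have "1 * real n powr (1/2 - \<epsilon>) \<le> C / 4 * real n powr (\<epsilon> / 2) * real n powr (1/2 - \<epsilon>)"
        by (rule mult_right_mono) auto
      ultimately show ?thesis by simp
    qed
    ultimately show ?case by blast
  qed
qed

section \<open>From individual sets to the extremal function\<close>

lemma S_max_attained:
  "\<exists>A. A \<subseteq> {1..int n} \<and> sidon A \<and> avoids_eq a1 a2 a3 a4 A \<and> card A = S_max a1 a2 a3 a4 n"
  and card_le_S_max:
  "A \<subseteq> {1..int n} \<Longrightarrow> sidon A \<Longrightarrow> avoids_eq a1 a2 a3 a4 A \<Longrightarrow> card A \<le> S_max a1 a2 a3 a4 n"
proof -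
  let ?T = "{card A | A. A \<subseteq> {1..int n} \<and> sidon A \<and> avoids_eq a1 a2 a3 a4 A}"
  have fin: "finite ?T" by (rule finite_subset[of _ "card ` Pow {1..int n}"]) auto
  have "card {} \<in> ?T" by (intro CollectI exI[of _ "{}"]) (simp add: sidon_def avoids_eq_def)
  then have "Max ?T \<in> ?T" using fin by (intro Max_in) blast+
  then obtain B where "B \<subseteq> {1..int n}" "sidon B" "avoids_eq a1 a2 a3 a4 B" "Max ?T = card B" by blast
  then show "\<exists>A. A \<subseteq> {1..int n} \<and> sidon A \<and> avoids_eq a1 a2 a3 a4 A \<and> card A = S_max a1 a2 a3 a4 n"
    unfolding S_max_def by (intro exI[of _ B]) simp
  show "card A \<le> S_max a1 a2 a3 a4 n" if "A \<subseteq> {1..int n}" "sidon A" "avoids_eq a1 a2 a3 a4 A"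
    unfolding S_max_def using fin that by (intro Max_ge) auto
qed

theorem theorem1p15:
  fixes a1 a2 a3 a4 :: int
  assumes "a1 > 0" "a2 > 0" "a3 > 0" "a4 > 0"
  shows "(\<lambda>n. real (S_max a1 a2 a3 a4 n) / sqrt (real n)) \<longlonglongrightarrow> 0 \<and>
    (\<forall>\<epsilon>>0. \<forall>\<^sub>F n in sequentially. real (S_max a1 a2 a3 a4 n) \<ge> real n powr (1/2 - \<epsilon>))"
proof (intro conjI allI impI)
  show "(\<lambda>n. real (S_max a1 a2 a3 a4 n) / sqrt (real n)) \<longlonglongrightarrow> 0"
  proof (rule tendstoI)
    fix \<delta> :: real assume "\<delta> > 0"
    from avoiding_sidon_small[OF assms this] eventually_ge_at_top[of 1]
    show "\<forall>\<^sub>F n in sequentially. dist (real (S_max a1 a2 a3 a4 n) / sqrt (real n)) 0 < \<delta>"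
    proof eventually_elim
      case (elim n)
      have "real (S_max a1 a2 a3 a4 n) < \<delta> * sqrt (real n)"
        using elim(1) S_max_attained[of n a1 a2 a3 a4] by metis
      then show ?case using elim(2) by (simp add: divide_less_eq)
    qed
  qed
next
  fix \<epsilon> :: real assume \<epsilon>: "\<epsilon> > 0"
  \<comment> \<open>The construction is stated for exponents below 1; a smaller \<epsilon> gives a
    stronger bound because n \<ge> 1.\<close>
  have "min \<epsilon> (1/2) > 0" "min \<epsilon> (1/2) < 1" using \<epsilon> by auto
  from eventually_sidon_avoiding[OF assms this] eventually_ge_at_top[of 1]
  show "\<forall>\<^sub>F n in sequentially. real (S_max a1 a2 a3 a4 n) \<ge> real n powr (1/2 - \<epsilon>)"
  proof eventually_elim
    case (elim n)
    then obtain A where A: "A \<subseteq> {1..int n}" "sidon A" "avoids_eq a1 a2 a3 a4 A"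
      and le: "real n powr (1/2 - min \<epsilon> (1/2)) \<le> real (card A)" by blast
    have "real n powr (1/2 - \<epsilon>) \<le> real n powr (1/2 - min \<epsilon> (1/2))"
      using elim(2) by (intro powr_mono) auto
    also note le
    also have "real (card A) \<le> real (S_max a1 a2 a3 a4 n)"
      using card_le_S_max[OF A] by (rule of_nat_mono)
    finally show ?case .
  qed
qed

end
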